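(* If $\phi$ is a totally positive function of type-I, then for $\beta>0$ $$\lim_{\gamma\to0}M_{\phi_\gamma,1/\beta}=\frac{\beta^2}{4}.$$ Consequently, if $\alpha,\beta>0$ and $\alpha\beta<1$, then there exists a $\gamma>0$ depending on $\alpha\beta$ such that $\mathcal{G}(\phi_\gamma,\alpha,\beta)$ forms a frame for $L^2(\mathbb{R})$.
   Context: The Fourier transform is $\widehat f(w)=\int_{-\infty}^{\infty}f(x)e^{-2\pi i wx}\,dx$. A function $\phi\in L^1(\mathbb{R})$ is (a totally positive function) of type-I if its Fourier transform has the form $$\widehat\phi(w)=e^{-\pi w^2}\prod_{j=1}^{\infty}(1+2\pi i v_jw)^{-1}e^{2\pi i v_jw},\qquad v_j\in\mathbb{R},\quad 0\le\sum_j v_j^2<\infty.$$ For $\gamma>0$, $\phi_\gamma(x)=\sqrt{\gamma}\,\phi(\gamma x)$. For $h>0$, $$M_{\phi,h}:=\operatorname*{ess\,sup}_{w\in[0,1/h]}\frac{\sum_{l\in\mathbb{Z}}(w+\frac{l}{h})^2|\widehat\phi(w+\frac{l}{h})|^2}{\sum_{l\in\mathbb{Z}}|\widehat\phi(w+\frac{l}{h})|^2}.$$ For $\phi\in L^2(\mathbb{R})$ and $\alpha,\beta>0$, $\mathcal{G}(\phi,\alpha,\beta)=\{e^{2\pi i\beta m\cdot}\phi(\cdot-\alpha k):k,m\in\mathbb{Z}\}$; it is a frame for $L^2(\mathbb{R})$ if there are constants $A,B>0$ with $A\|f\|^2\le\sum_{k,m\in\mathbb{Z}}|\langle f,e^{2\pi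 i\beta m\cdot}\phi(\cdot-\alpha k)\rangle|^2\le B\|f\|^2$ for all $f\in L^2(\mathbb{R})$. *)

theory Defs
  imports "HOL-Probability.Essential_Supremum"
begin

definition fourier :: "(real \<Rightarrow> complex) \<Rightarrow> real \<Rightarrow> complex" where
  "fourier f w = (LINT x|lebesgue. f x * exp (- 2 * of_real pi * \<i> * of_real (w * x)))"

text \<open>The condition on the Fourier transform makes \<open>\<phi>\<close> real almost everywhere (in fact a totally
  positive function, by Schoenberg), so complex values cost nothing. The factors are indexed from
  \<open>0\<close>; square summability of \<open>v\<close> makes the product converge, so \<open>prodinf\<close> is its value. A finite
  product is the case where \<open>v\<close> is eventually \<open>0\<close>.\<close>

definition type_I :: "(real \<Rightarrow> complex) \<Rightarrow> bool" where
  "type_I \<phi> \<longleftrightarrow> integrable lebesgue \<phi> \<and>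
    (\<exists>v :: nat \<Rightarrow> real. summable (\<lambda>j. (v j)\<^sup>2) \<and>
      (\<forall>w. fourier \<phi> w = of_real (exp (- pi * w\<^sup>2)) *
        (\<Prod>j. inverse (1 + 2 * of_real pi * \<i> * of_real (v j * w))
              * exp (2 * of_real pi * \<i> * of_real (v j * w)))))"

definition dilate :: "real \<Rightarrow> (real \<Rightarrow> complex) \<Rightarrow> real \<Rightarrow> complex" where
  "dilate \<gamma> \<phi> x = of_real (sqrt \<gamma>) * \<phi> (\<gamma> * x)"

text \<open>Taken in the extended nonnegative reals, where the sums always exist and may be infinite.\<close>

definition M_const :: "(real \<Rightarrow> complex) \<Rightarrow> real \<Rightarrow> ennreal" where
  "M_const \<phi> h = esssup (restrict_space lebesgue {0..1/h}) (\<lambda>w.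
     (\<Sum>\<^sub>\<infinity>l\<in>(UNIV :: int set).
        ennreal ((w + of_int l / h)\<^sup>2 * (cmod (fourier \<phi> (w + of_int l / h)))\<^sup>2)) /
     (\<Sum>\<^sub>\<infinity>l\<in>(UNIV :: int set).
        ennreal ((cmod (fourier \<phi> (w + of_int l / h)))\<^sup>2)))"

definition L2 :: "(real \<Rightarrow> complex) set" where
  "L2 = {f. f \<in> borel_measurable lebesgue \<and> integrable lebesgue (\<lambda>x. (cmod (f x))\<^sup>2)}"

definition L2_inner :: "(real \<Rightarrow> complex) \<Rightarrow> (real \<Rightarrow> complex) \<Rightarrow> complex" where
  "L2_inner f g = (LINT x|lebesgue. f x * cnj (g x))"

definition L2_norm :: "(real \<Rightarrow> complex) \<Rightarrow> real" where
  "L2_norm f = sqrt (LINT x|lebesgue. (cmod (f x))\<^sup>2)"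

definition gabor_atom ::
  "(real \<Rightarrow> complex) \<Rightarrow> real \<Rightarrow> real \<Rightarrow> int \<Rightarrow> int \<Rightarrow> real \<Rightarrow> complex" where
  "gabor_atom \<phi> \<alpha> \<beta> k m x =
     exp (2 * of_real pi * \<i> * of_real (\<beta> * of_int m * x)) * \<phi> (x - \<alpha> * of_int k)"

text \<open>The sum runs over the index set, i.e. the system is treated as a family. Taking it in the
  extended nonnegative reals makes its convergence part of the upper bound.\<close>

definition gabor_frame :: "(real \<Rightarrow> complex) \<Rightarrow> real \<Rightarrow> real \<Rightarrow> bool" where
  "gabor_frame \<phi> \<alpha> \<beta> \<longleftrightarrow> \<phi> \<in> L2 \<and>
    (\<exists>A B :: real. 0 < A \<and> 0 < B \<and>
      (\<forall>f \<in> L2.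
        ennreal (A * (L2_norm f)\<^sup>2)
          \<le> (\<Sum>\<^sub>\<infinity>(k, m)\<in>(UNIV :: (int \<times> int) set).
               ennreal ((cmod (L2_inner f (gabor_atom \<phi> \<alpha> \<beta> k m)))\<^sup>2)) \<and>
        (\<Sum>\<^sub>\<infinity>(k, m)\<in>(UNIV :: (int \<times> int) set).
               ennreal ((cmod (L2_inner f (gabor_atom \<phi> \<alpha> \<beta> k m)))\<^sup>2))
          \<le> ennreal (B * (L2_norm f)\<^sup>2)))"

end

theory Submission
  imports Defs "HOL-Probability.Probability"
begin

text \<open>Write \<open>G\<close> for the squared modulus of the Fourier transform of the window. Besides being integrable,
  a window of type I enters the proof only through the fact that \<open>G\<close> is positive and decreases at a
  Gaussian rate: \<open>G x \<le> exp (- c (x\<^sup>2 - y\<^sup>2)) G y\<close> whenever \<open>\<bar>y\<bar> \<le> \<bar>x\<bar>\<close>. This holds with \<open>c = 2 \<pi>\<close> for the window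
  itself, hence with \<open>c = 2 \<pi> / \<gamma>\<^sup>2\<close> for its dilate (\<open>dilate_gaussian_decreasing\<close>).

  The limit. The quotient that defines \<open>M_const\<close> is the mean of \<open>x\<^sup>2\<close> over a coset of \<open>\<beta> \<int>\<close>, with
  weights \<open>G\<close>. Points with \<open>\<bar>x\<bar> \<le> \<beta> / 2\<close> contribute at most \<open>\<beta>\<^sup>2 / 4\<close> to the mean. At the other
  points the excess of \<open>x\<^sup>2\<close> over \<open>\<beta>\<^sup>2 / 4\<close> is either small or carries an exponentially small weight
  relative to the point nearest to the origin, and the weighted excesses sum to \<open>O(1 / c) = O(\<gamma>\<^sup>2)\<close>
  (\<open>lattice_mean_square_le\<close>). In the other direction, all points of the coset of
  some \<open>w\<close> just below \<open>\<beta> / 2\<close> have modulus at least \<open>w\<close> (\<open>M_const_bounds\<close>).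

  The frame. Fix the translation index \<open>k\<close>. Modulations by multiples of \<open>\<beta>\<close> are the characters of
  period \<open>1 / \<beta>\<close>, so Parseval's identity turns the sum over them into the mean square, over one
  period, of the periodization of \<open>f\<close> times the translated window. At each point \<open>x\<close>, the values of
  these periodizations are samples, at step \<open>\<alpha>\<close>, of one function \<open>F\<close>: a combination of translates of
  the window by multiples of \<open>1 / \<beta>\<close> whose coefficients are, up to conjugation, the values of
  \<open>f\<close> on \<open>x + \<int> / \<beta>\<close> (\<open>gabor_square_sum\<close>). So everything follows from bounds that compare the square sum of the samples
  of such an \<open>F\<close> with the square sum of its coefficients (\<open>sampling_frame_bounds\<close>).

  The transform of \<open>F\<close> is the transform of the window times a trigonometric polynomial of period \<open>\<beta>\<close>.
  By Plancherel's identity, the energy of \<open>F\<close> is comparable to the square sum of the coefficients, and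
  the energy of \<open>F'\<close> is at most \<open>4 \<pi>\<^sup>2 M\<close> times that of \<open>F\<close> if \<open>M\<close> bounds the mean of \<open>x\<^sup>2\<close>. Wirtinger's
  inequality on the intervals of length \<open>\<alpha>\<close> around the sampling points says that, for every
  \<open>\<omega> < \<pi> / \<alpha>\<close>, the energy of \<open>F\<close> is at most \<open>1 / \<omega>\<^sup>2\<close> times that of \<open>F'\<close> plus a multiple of the square sum
  of the samples (\<open>sampling_inequalities\<close>). The first term is absorbed if \<open>2 \<pi> \<surd>M < \<omega>\<close>; such an \<open>\<omega>\<close>
  exists if \<open>2 \<alpha> \<surd>M < 1\<close>. For small \<open>\<gamma>\<close>, \<open>M\<close> is close to \<open>\<beta>\<^sup>2 / 4\<close>, and the condition becomes
  \<open>\<alpha> \<beta> < 1\<close>.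

  The window is known only through its transform. Fourier inversion (\<open>fourier_inversion\<close>) recovers it
  almost everywhere as a continuous function. The frame inequalities are proved for continuous
  functions of compact support, for which periodizations are finite sums, and extended by density
  (\<open>supported_dense\<close>, \<open>frame_extend\<close>).\<close>

abbreviation sq_norm :: "complex \<Rightarrow> ennreal" where
  "sq_norm z \<equiv> ennreal ((cmod z)\<^sup>2)"

abbreviation energy :: "(real \<Rightarrow> complex) \<Rightarrow> ennreal" where
  "energy f \<equiv> (\<integral>\<^sup>+x. sq_norm (f x) \<partial>lborel)"

section \<open>Sums over a lattice of Gaussian-dominated functions\<close>

lemma summable_on_ennreal_fun:
  fixes f :: "'a \<Rightarrow> ennreal"
  shows "f summable_on A"
  by (rule nonneg_summable_on_complete) simp

lemma infsum_nat_ennreal: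
  fixes f :: "nat \<Rightarrow> ennreal"
  shows "infsum f UNIV = (\<Sum>n. f n)"
  by (rule sums_unique[OF has_sum_imp_sums[OF has_sum_infsum]]) (rule summable_on_ennreal_fun)

lemma infsum_ennreal_eq_nn_integral:
  fixes f :: "'a \<Rightarrow> ennreal"
  assumes "countable A"
  shows "infsum f A = (\<integral>\<^sup>+x. f x \<partial>count_space A)"
proof (cases "finite A")
  case True
  then show ?thesis
    by (simp add: nn_integral_count_space_finite)
next
  case False
  note bij = bij_betw_from_nat_into[OF assms False]
  have "infsum f A = infsum (\<lambda>n. f (from_nat_into A n)) UNIV"
    using infsum_reindex_bij_betw[OF bij, of f] by simp
  also have "\<dots> = (\<Sum>n. f (from_nat_into A n))"
    by (rule infsum_nat_ennreal)
  also have "\<dots> = (\<integral>\<^sup>+x. f x \<partial>count_space A)"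
    by (simp add: nn_integral_bij_count_space[symmetric, OF bij] nn_integral_count_space_nat)
  finally show ?thesis .
qed

text \<open>This property of the squared modulus of the transform is what the proof retains of type I. Taking
  \<open>x = - y\<close> shows that such a function is even.\<close>

definition gaussian_decreasing :: "real \<Rightarrow> (real \<Rightarrow> real) \<Rightarrow> bool" where
  "gaussian_decreasing c G \<longleftrightarrow>
     (\<forall>x. 0 < G x) \<and> (\<forall>x y. \<bar>y\<bar> \<le> \<bar>x\<bar> \<longrightarrow> G x \<le> exp (- c * (x\<^sup>2 - y\<^sup>2)) * G y)"

lemma gaussian_decreasingD:
  assumes "gaussian_decreasing c G"
  shows "0 < G x" and "\<bar>y\<bar> \<le> \<bar>x\<bar> \<Longrightarrow> G x \<le> exp (- c * (x\<^sup>2 - y\<^sup>2)) * G y"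
  using assms unfolding gaussian_decreasing_def by auto

abbreviation lattice_sum :: "real \<Rightarrow> (real \<Rightarrow> real) \<Rightarrow> real \<Rightarrow> ennreal" where
  "lattice_sum b v w \<equiv> (\<Sum>\<^sub>\<infinity>l. ennreal (v (w + of_int l * b)))"

text \<open>A summable majorant for what the \<open>l\<close>-th lattice point contributes, uniform over cosets. For
  \<open>l \<noteq> 0\<close>, \<open>b\<^sup>2 (l\<^sup>2 - \<bar>l\<bar>)\<close> is the least value of \<open>(w + l b)\<^sup>2 - b\<^sup>2 / 4\<close> for \<open>w\<close> within half a period of
  the origin.\<close>

definition lattice_weight :: "real \<Rightarrow> int \<Rightarrow> real" where
  "lattice_weight b l = 1 / (1 + b\<^sup>2 * real_of_int (l\<^sup>2 - \<bar>l\<bar>))"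

abbreviation lattice_mass :: "real \<Rightarrow> ennreal" where
  "lattice_mass b \<equiv> (\<Sum>\<^sub>\<infinity>l. ennreal (lattice_weight b l))"

lemma abs_le_square_int: "\<bar>l\<bar> \<le> (l::int)\<^sup>2"
proof (cases "l = 0")
  case False
  then have "\<bar>l\<bar> * 1 \<le> \<bar>l\<bar> * \<bar>l\<bar>"
    by (intro mult_left_mono) auto
  then show ?thesis
    by (simp add: power2_eq_square)
qed simp

lemma lattice_weight_pos: "0 < lattice_weight b l"
  unfolding lattice_weight_def using abs_le_square_int[of l]
  by (intro divide_pos_pos add_pos_nonneg mult_nonneg_nonneg) (auto simp del: of_int_diff)

lemma summable_lattice_weight:
  assumes "0 < b"
  shows "summable (\<lambda>n. lattice_weight b (int n))"
proof -
  have "summable (\<lambda>n. lattice_weight b (int (n + 2)))"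
  proof (rule summable_comparison_test)
    show "summable (\<lambda>n. (1 / b\<^sup>2) * inverse (real (Suc n) ^ 2))"
      by (intro summable_mult) (use inverse_power_summable[of 2, where ?'a=real] in \<open>subst summable_Suc_iff; simp\<close>)
    have "norm (lattice_weight b (int (n + 2))) \<le> (1 / b\<^sup>2) * inverse (real (Suc n) ^ 2)" for n
    proof -
      have "b\<^sup>2 * (real (Suc n))\<^sup>2 \<le> 1 + b\<^sup>2 * real_of_int ((int (n + 2))\<^sup>2 - \<bar>int (n + 2)\<bar>)"
      proof -
        have "(real (Suc n))\<^sup>2 \<le> real_of_int ((int (n + 2))\<^sup>2 - \<bar>int (n + 2)\<bar>)"
          by (simp add: power2_eq_square algebra_simps)
        then show ?thesis
          by (smt (verit) mult_left_mono zero_le_power2)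
      qed
      moreover have "0 < b\<^sup>2 * (real (Suc n))\<^sup>2"
        using assms by simp
      ultimately have "1 / (1 + b\<^sup>2 * real_of_int ((int (n + 2))\<^sup>2 - \<bar>int (n + 2)\<bar>)) \<le> 1 / (b\<^sup>2 * (real (Suc n))\<^sup>2)"
        by (intro divide_left_mono) (linarith | simp add: add_pos_pos)+
      then show ?thesis
        using lattice_weight_pos[of b "int (n + 2)"] unfolding lattice_weight_def
        by (simp add: inverse_eq_divide del: of_int_diff)
    qed
    then show "\<exists>N. \<forall>n\<ge>N. norm (lattice_weight b (int (n + 2))) \<le> (1 / b\<^sup>2) * inverse (real (Suc n) ^ 2)"
      by blast
  qed
  then show ?thesis
    by (subst (asm) summable_iff_shift)
qed

lemma lattice_weight_sum_finite:
  assumes "0 < b"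
  shows "lattice_mass b < \<top>"
proof -
  let ?f = "\<lambda>l. ennreal (lattice_weight b l)"
  have fin: "(\<Sum>n. ennreal (lattice_weight b (int n))) < \<top>"
    using summable_lattice_weight[OF assms] lattice_weight_pos[of b]
    by (subst suminf_ennreal2) (auto simp: less_imp_le)
  have eq: "infsum (\<lambda>n::nat. ennreal (lattice_weight b (int n))) UNIV
      = (\<Sum>n. ennreal (lattice_weight b (int n)))"
    by (rule infsum_nat_ennreal)
  have 1: "infsum ?f (range int) = (\<Sum>n. ennreal (lattice_weight b (int n)))"
    unfolding eq[symmetric]
    using infsum_reindex_bij_betw[of int UNIV "range int" ?f] by (simp add: bij_betw_def)
  have 2: "infsum ?f (range (\<lambda>n. - int n)) = (\<Sum>n. ennreal (lattice_weight b (int n)))"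
    unfolding eq[symmetric]
    using infsum_reindex_bij_betw[of "\<lambda>n. - int n" UNIV "range (\<lambda>n. - int n)" ?f]
    by (simp add: bij_betw_def inj_def lattice_weight_def)
  have U: "(UNIV :: int set) = range int \<union> (range (\<lambda>n. - int n) - range int)"
    by (auto intro: int_cases2)
  have "infsum ?f UNIV = infsum ?f (range int) + infsum ?f (range (\<lambda>n. - int n) - range int)"
    by (subst U, rule infsum_Un_disjoint) (auto intro: summable_on_ennreal_fun)
  also have "\<dots> \<le> infsum ?f (range int) + infsum ?f (range (\<lambda>n. - int n))"
    by (intro add_left_mono infsum_mono_neutral) (auto intro: summable_on_ennreal_fun)
  finally show ?thesis
    using fin unfolding 1 2 by (simp add: order.strict_trans1)
qed

lemma infsum_int_shift:
  fixes f :: "int \<Rightarrow> ennreal"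
  shows "(\<Sum>\<^sub>\<infinity>l. f (l + a)) = (\<Sum>\<^sub>\<infinity>l. f l)"
  using infsum_reindex_bij_betw[of "\<lambda>l. l + a" UNIV UNIV f]
  by (metis bij_betw_def inj_def add_right_cancel surj_plus_right)

lemma infsum_ennreal_cmult:
  fixes f :: "'a \<Rightarrow> ennreal"
  assumes "countable A"
  shows "(\<Sum>\<^sub>\<infinity>l\<in>A. c * f l) = c * (\<Sum>\<^sub>\<infinity>l\<in>A. f l)"
  by (simp add: infsum_ennreal_eq_nn_integral[OF assms] nn_integral_cmult)

lemma infsum_ennreal_add:
  fixes f :: "'a \<Rightarrow> ennreal"
  shows "(\<Sum>\<^sub>\<infinity>l\<in>A. f l + g l) = (\<Sum>\<^sub>\<infinity>l\<in>A. f l) + (\<Sum>\<^sub>\<infinity>l\<in>A. g l)"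
  by (rule infsum_add) (rule summable_on_ennreal_fun)+

lemma term_le_infsum_ennreal:
  fixes f :: "'a \<Rightarrow> ennreal"
  assumes "a \<in> A"
  shows "f a \<le> infsum f A"
  using infsum_mono_neutral[of f "{a}" f A] assms by (simp add: summable_on_ennreal_fun)

lemma lattice_reduce:
  assumes "0 < (b::real)"
  obtains k :: int where "\<bar>w + of_int k * b\<bar> \<le> b / 2"
proof
  have "\<bar>of_int (round (w / b)) - w / b\<bar> \<le> 1/2"
    by (rule of_int_round_abs_le)
  then have "\<bar>of_int (round (w / b)) - w / b\<bar> * b \<le> 1/2 * b"
    using assms by (intro mult_right_mono) auto
  then have "\<bar>of_int (round (w / b)) * b - w\<bar> \<le> b / 2"
    using assms by (simp add: abs_mult_pos left_diff_distrib)
  then show "\<bar>w + of_int (- round (w / b)) * b\<bar> \<le> b / 2"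
    by (simp add: abs_minus_commute)
qed

lemma lattice_distance:
  assumes "0 < b" "\<bar>w\<bar> \<le> b / 2"
  shows "b\<^sup>2 * real_of_int (l\<^sup>2 - \<bar>l\<bar>) \<le> (w + of_int l * b)\<^sup>2 - b\<^sup>2 / 4 \<or> l = 0"
proof (cases "l = 0")
  case False
  then have l: "1 \<le> \<bar>l\<bar>" by auto
  have "(real_of_int \<bar>l\<bar> - 1/2) * b \<le> \<bar>w + of_int l * b\<bar>"
  proof -
    have "real_of_int \<bar>l\<bar> * b = \<bar>of_int l * b\<bar>"
      using assms by (simp add: abs_mult)
    also have "\<dots> \<le> \<bar>w + of_int l * b\<bar> + \<bar>w\<bar>"
      by linarith
    finally show ?thesis
      using assms by (simp add: algebra_simps)
  qed
  moreover have "0 \<le> (real_of_int \<bar>l\<bar> - 1/2) * b"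
    using assms l by simp
  ultimately have "((real_of_int \<bar>l\<bar> - 1/2) * b)\<^sup>2 \<le> \<bar>w + of_int l * b\<bar>\<^sup>2"
    by (intro power_mono)
  moreover have "((real_of_int \<bar>l\<bar> - 1/2) * b)\<^sup>2 = b\<^sup>2 * real_of_int (l\<^sup>2 - \<bar>l\<bar>) + b\<^sup>2 / 4"
    by (simp add: power2_eq_square algebra_simps)
  ultimately show ?thesis
    by simp
qed simp

lemma exp_minus_le_inverse:
  fixes x :: real
  assumes "0 \<le> x"
  shows "exp (- x) \<le> 1 / (1 + x)"
  using exp_ge_add_one_self[of x] assms by (simp add: exp_minus divide_simps)

lemma x_exp_minus_le_inverse:
  fixes t :: real
  assumes "0 \<le> t"
  shows "t * exp (- t) \<le> 4 / (1 + t)"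
proof -
  have "(1 + t/2)\<^sup>2 \<le> (exp (t/2))\<^sup>2"
    using assms exp_ge_add_one_self[of "t/2"] by (intro power_mono) auto
  also have "(exp (t/2))\<^sup>2 = exp t"
    by (simp add: power2_eq_square flip: exp_add)
  finally have "t * (1 + t) \<le> 4 * exp t"
    using assms by (simp add: power2_eq_square algebra_simps)
  then show ?thesis
    using assms by (simp add: exp_minus divide_simps mult.commute)
qed

text \<open>With \<open>X = (w + l b)\<^sup>2 - b\<^sup>2 / 4 > 0\<close>, the weight of the \<open>l\<close>-th point relative to \<open>w\<close> is at most
  \<open>exp (- c X)\<close>. Since \<open>X exp (- c X)\<close> is \<open>O(1 / c)\<close> with a remaining factor of order \<open>1 / (1 + c X)\<close>, the
  excess is small and still summable over \<open>l\<close>.\<close>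

lemma lattice_excess_term:
  assumes G: "gaussian_decreasing c G" and c: "1 \<le> c" and b: "0 < b" and w: "\<bar>w\<bar> \<le> b / 2"
  shows "((w + of_int l * b)\<^sup>2 - b\<^sup>2 / 4) * G (w + of_int l * b) \<le> 4 / c * lattice_weight b l * G w"
proof (cases "(w + of_int l * b)\<^sup>2 - b\<^sup>2 / 4 \<le> 0")
  case True
  have "((w + of_int l * b)\<^sup>2 - b\<^sup>2 / 4) * G (w + of_int l * b) \<le> 0"
    using True gaussian_decreasingD(1)[OF G] by (intro mult_nonpos_nonneg) (auto simp: less_imp_le)
  also have "0 \<le> 4 / c * lattice_weight b l * G w"
    using c lattice_weight_pos[of b l] gaussian_decreasingD(1)[OF G, of w] by simp
  finally show ?thesis .
next
  case False
  define X where "X = (w + of_int l * b)\<^sup>2 - b\<^sup>2 / 4"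
  have X: "0 < X"
    using False by (simp add: X_def)
  have wb: "w\<^sup>2 \<le> b\<^sup>2 / 4"
    using power_mono[OF w, of 2] by (simp add: power_divide)
  have "w\<^sup>2 \<le> (w + of_int l * b)\<^sup>2"
    using X wb by (simp add: X_def)
  then have "\<bar>w\<bar> \<le> \<bar>w + of_int l * b\<bar>"
    by (simp add: abs_le_square_iff)
  then have "G (w + of_int l * b) \<le> exp (- c * ((w + of_int l * b)\<^sup>2 - w\<^sup>2)) * G w"
    by (rule gaussian_decreasingD(2)[OF G])
  also have "\<dots> \<le> exp (- (c * X)) * G w"
    using wb c gaussian_decreasingD(1)[OF G, of w] by (auto simp: X_def intro!: mult_left_mono)
  finally have "X * G (w + of_int l * b) \<le> X * (exp (- (c * X)) * G w)"
    using X by (intro mult_left_mono) auto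
  also have "\<dots> = (1 / c) * ((c * X) * exp (- (c * X))) * G w"
    using c by simp
  also have "\<dots> \<le> (1 / c) * (4 / (1 + c * X)) * G w"
    using c X gaussian_decreasingD(1)[OF G, of w]
    by (intro mult_right_mono mult_left_mono x_exp_minus_le_inverse) auto
  also have "\<dots> \<le> (1 / c) * (4 * lattice_weight b l) * G w"
  proof -
    have "b\<^sup>2 * real_of_int (l\<^sup>2 - \<bar>l\<bar>) \<le> c * X"
    proof -
      have "b\<^sup>2 * real_of_int (l\<^sup>2 - \<bar>l\<bar>) \<le> X"
        using lattice_distance[OF b w, of l] X by (auto simp: X_def)
      also have "X \<le> c * X"
        using c X by simp
      finally show ?thesis .
    qed
    moreover have "0 \<le> b\<^sup>2 * real_of_int (l\<^sup>2 - \<bar>l\<bar>)"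
      using abs_le_square_int[of l] by (intro mult_nonneg_nonneg) (auto simp del: of_int_diff)
    ultimately have "1 / (1 + c * X) \<le> lattice_weight b l"
      unfolding lattice_weight_def by (intro divide_left_mono mult_pos_pos) linarith+
    then show ?thesis
      using c gaussian_decreasingD(1)[OF G, of w]
      by (intro mult_right_mono mult_left_mono) auto
  qed
  finally show ?thesis
    by (simp add: X_def)
qed

text \<open>What the squares exceed \<open>b\<^sup>2 / 4\<close> by is paid for by the weight of the point nearest to the origin,
  which is itself one of the terms on the right.\<close>

lemma lattice_mean_square_le:
  assumes G: "gaussian_decreasing c G" and c: "1 \<le> c" and b: "0 < b"
  shows "lattice_sum b (\<lambda>x. x\<^sup>2 * G x) w
     \<le> (ennreal (b\<^sup>2 / 4) + ennreal (4 / c) * lattice_mass b)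
        * lattice_sum b G w"
proof -
  obtain k :: int where k: "\<bar>w + of_int k * b\<bar> \<le> b / 2"
    using lattice_reduce[OF b] .
  define v where "v = w + of_int k * b"
  let ?W = "\<Sum>\<^sub>\<infinity>l. ennreal (lattice_weight b l)"
  have v: "\<bar>v\<bar> \<le> b / 2"
    using k by (simp add: v_def)
  have shift: "(\<Sum>\<^sub>\<infinity>l. F (w + of_int l * b)) = (\<Sum>\<^sub>\<infinity>l. F (v + of_int l * b))" for F :: "real \<Rightarrow> ennreal"
    using infsum_int_shift[of "\<lambda>l. F (w + of_int l * b)" k, symmetric]
    by (simp add: v_def algebra_simps)
  note pos = gaussian_decreasingD(1)[OF G]
  have "lattice_sum b (\<lambda>x. x\<^sup>2 * G x) v
     \<le> (\<Sum>\<^sub>\<infinity>l. ennreal (b\<^sup>2 / 4) * ennreal (G (v + of_int l * b))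
              + (ennreal (4 / c) * ennreal (G v)) * ennreal (lattice_weight b l))"
  proof (rule infsum_mono)
    fix l :: int
    have "(v + of_int l * b)\<^sup>2 * G (v + of_int l * b)
        \<le> b\<^sup>2 / 4 * G (v + of_int l * b) + 4 / c * G v * lattice_weight b l"
      using lattice_excess_term[OF G c b v, of l] by (simp add: algebra_simps)
    then show "ennreal ((v + of_int l * b)\<^sup>2 * G (v + of_int l * b))
        \<le> ennreal (b\<^sup>2 / 4) * ennreal (G (v + of_int l * b))
              + (ennreal (4 / c) * ennreal (G v)) * ennreal (lattice_weight b l)"
      using pos[THEN less_imp_le] c lattice_weight_pos[of b l]
      by (simp add: ennreal_leI flip: ennreal_mult ennreal_plus)
  qed (rule summable_on_ennreal_fun)+
  also have "\<dots> = ennreal (b\<^sup>2 / 4) * lattice_sum b G v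
              + (ennreal (4 / c) * ennreal (G v)) * ?W"
    by (simp add: infsum_ennreal_add infsum_ennreal_cmult)
  also have "\<dots> \<le> ennreal (b\<^sup>2 / 4) * lattice_sum b G v
              + (ennreal (4 / c) * lattice_sum b G v) * ?W"
    using term_le_infsum_ennreal[of 0 UNIV "\<lambda>l. ennreal (G (v + of_int l * b))"]
    by (intro add_left_mono mult_right_mono mult_left_mono) auto
  also have "\<dots> = (ennreal (b\<^sup>2 / 4) + ennreal (4 / c) * ?W) * lattice_sum b G v"
    by (simp add: algebra_simps)
  finally show ?thesis
    using shift[of "\<lambda>x. ennreal (x\<^sup>2 * G x)"] shift[of "\<lambda>x. ennreal (G x)"] by simp
qed

lemma gaussian_decreasing_le:
  assumes "gaussian_decreasing c G"
  shows "G x \<le> exp (- c * x\<^sup>2) * G 0"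
  using gaussian_decreasingD(2)[OF assms, of 0 x] by simp

lemma lattice_sum_le:
  assumes G: "gaussian_decreasing c G" and c: "1 \<le> c" and b: "0 < b"
  shows "lattice_sum b G w
     \<le> ennreal (G 0) * lattice_mass b"
proof -
  obtain k :: int where k: "\<bar>w + of_int k * b\<bar> \<le> b / 2"
    using lattice_reduce[OF b] .
  define v where "v = w + of_int k * b"
  have "lattice_sum b G w = lattice_sum b G v"
    using infsum_int_shift[of "\<lambda>l. ennreal (G (w + of_int l * b))" k, symmetric]
    by (simp add: v_def algebra_simps)
  also have "\<dots> \<le> (\<Sum>\<^sub>\<infinity>l. ennreal (G 0) * ennreal (lattice_weight b l))"
  proof (rule infsum_mono)
    fix l :: int
    let ?x = "v + of_int l * b"
    have nn: "0 \<le> b\<^sup>2 * real_of_int (l\<^sup>2 - \<bar>l\<bar>)"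
      using abs_le_square_int[of l] by (intro mult_nonneg_nonneg) (auto simp del: of_int_diff)
    have "b\<^sup>2 * real_of_int (l\<^sup>2 - \<bar>l\<bar>) \<le> ?x\<^sup>2"
    proof (cases "l = 0")
      case False
      have "0 \<le> b\<^sup>2 / 4" by simp
      then show ?thesis
        using lattice_distance[OF b, of v l] k False unfolding v_def by linarith
    qed simp
    also have "?x\<^sup>2 \<le> c * ?x\<^sup>2"
      using c by (simp add: mult_le_cancel_right1)
    finally have le: "b\<^sup>2 * real_of_int (l\<^sup>2 - \<bar>l\<bar>) \<le> c * ?x\<^sup>2" .
    have "G ?x \<le> exp (- (c * ?x\<^sup>2)) * G 0"
      using gaussian_decreasing_le[OF G, of ?x] by simp
    also have "\<dots> \<le> 1 / (1 + c * ?x\<^sup>2) * G 0"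
      using c gaussian_decreasingD(1)[OF G, of 0]
      by (intro mult_right_mono exp_minus_le_inverse) auto
    also have "\<dots> \<le> lattice_weight b l * G 0"
      unfolding lattice_weight_def using le nn gaussian_decreasingD(1)[OF G, of 0]
      by (intro mult_right_mono divide_left_mono mult_pos_pos) linarith+
    finally show "ennreal (G ?x) \<le> ennreal (G 0) * ennreal (lattice_weight b l)"
      using gaussian_decreasingD(1)[OF G, of 0] lattice_weight_pos[of b l]
      by (simp add: ennreal_leI mult.commute flip: ennreal_mult)
  qed (rule summable_on_ennreal_fun)+
  finally show ?thesis
    by (simp add: infsum_ennreal_cmult)
qed

section \<open>Fourier transforms of type I\<close>

text \<open>The exponential cancels the linear term of the inverse, so a square summable sequence gives an
  absolutely convergent product.\<close>

lemma type_I_factor_close: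
  fixes t :: real
  shows "cmod (inverse (1 + \<i> * of_real t) * exp (\<i> * of_real t) - 1) \<le> t\<^sup>2"
proof -
  have n: "1 \<le> cmod (1 + \<i> * of_real t)"
    using abs_Re_le_cmod[of "1 + \<i> * of_real t"] by simp
  then have nz: "1 + \<i> * of_real t \<noteq> 0"
    by force
  have "cmod (exp (\<i> * of_real t) - (\<Sum>k\<le>1. (\<i> * of_real t) ^ k / fact k)) \<le> \<bar>t\<bar> ^ Suc 1 / fact (Suc 1)"
    using iexp_approx1[of t 1] by simp
  then have e: "cmod (exp (\<i> * of_real t) - (1 + \<i> * of_real t)) \<le> t\<^sup>2 / 2"
    by (simp add: power2_eq_square)
  have "inverse (1 + \<i> * of_real t) * exp (\<i> * of_real t) - 1
      = (exp (\<i> * of_real t) - (1 + \<i> * of_real t)) / (1 + \<i> * of_real t)"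
    using nz by (simp add: field_simps)
  then have "cmod (inverse (1 + \<i> * of_real t) * exp (\<i> * of_real t) - 1)
      = cmod (exp (\<i> * of_real t) - (1 + \<i> * of_real t)) / cmod (1 + \<i> * of_real t)"
    by (simp add: norm_divide)
  also have "\<dots> \<le> (t\<^sup>2 / 2) / 1"
    using n e by (intro frac_le) auto
  finally show ?thesis
    using zero_le_power2[of t] by linarith
qed

text \<open>Only the moduli of the factors matter. They are \<open>(1 + (2 \<pi> v\<^sub>j w)\<^sup>2)\<^sup>-\<^sup>1\<^sup>/\<^sup>2\<close>, hence decreasing
  in \<open>\<bar>w\<bar>\<close>, and the Gaussian factor supplies the rate.\<close>

lemma type_I_gaussian_decreasing:
  assumes "type_I \<phi>"
  shows "gaussian_decreasing (2 * pi) (\<lambda>w. (cmod (fourier \<phi> w))\<^sup>2)"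
proof -
  obtain v :: "nat \<Rightarrow> real" where sv: "summable (\<lambda>j. (v j)\<^sup>2)" and
    F: "\<And>w. fourier \<phi> w = of_real (exp (- pi * w\<^sup>2)) *
        (\<Prod>j. inverse (1 + 2 * of_real pi * \<i> * of_real (v j * w))
              * exp (2 * of_real pi * \<i> * of_real (v j * w)))"
    using assms unfolding type_I_def by (elim conjE exE) (rule that, assumption, rule spec)
  define f where "f w j = inverse (1 + \<i> * of_real (2 * pi * v j * w)) * exp (\<i> * of_real (2 * pi * v j * w))"
    for w j
  have f: "f w j = inverse (1 + 2 * of_real pi * \<i> * of_real (v j * w))
              * exp (2 * of_real pi * \<i> * of_real (v j * w))" for w j
    by (simp add: f_def mult_ac)
  define P where "P w = prodinf (f w)" for w
  have FP: "fourier \<phi> w = of_real (exp (- pi * w\<^sup>2)) * P w" for w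
    unfolding P_def using F[of w] f[of w] by presburger
  have nz: "1 + \<i> * of_real t \<noteq> 0" for t :: real
    by (simp add: complex_eq_iff)
  have fnz: "f w j \<noteq> 0" for w j
    unfolding f_def using nz[of "2 * pi * v j * w"] by (simp del: of_real_mult)
  have conv: "convergent_prod (f w)" for w
  proof -
    have "summable (\<lambda>j. norm (f w j - 1))"
    proof (rule summable_comparison_test)
      show "summable (\<lambda>j. (2 * pi * w)\<^sup>2 * (v j)\<^sup>2)"
        by (intro summable_mult sv)
      have "norm (norm (f w j - 1)) \<le> (2 * pi * w)\<^sup>2 * (v j)\<^sup>2" for j
        using type_I_factor_close[of "2 * pi * v j * w"]
        by (simp add: f_def power_mult_distrib mult_ac)
      then show "\<exists>N. \<forall>n\<ge>N. norm (norm (f w n - 1)) \<le> (2 * pi * w)\<^sup>2 * (v n)\<^sup>2"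
        by blast
    qed
    then show ?thesis
      by (intro abs_convergent_prod_imp_convergent_prod summable_imp_abs_convergent_prod)
  qed
  have Pnz: "P w \<noteq> 0" for w
    unfolding P_def by (intro prodinf_nonzero conv fnz)
  have hp: "f w has_prod P w" for w
    unfolding P_def by (intro convergent_prod_has_prod conv)
  have mono: "cmod (P x) \<le> cmod (P y)" if xy: "\<bar>y\<bar> \<le> \<bar>x\<bar>" for x y
  proof (rule has_prod_le)
    show "(\<lambda>j. cmod (f x j)) has_prod cmod (P x)" "(\<lambda>j. cmod (f y j)) has_prod cmod (P y)"
      by (intro has_prod_norm hp)+
    fix j
    have sq: "(cmod (1 + \<i> * of_real t))\<^sup>2 = 1 + t\<^sup>2" for t :: real
      by (simp add: cmod_power2)
    have "(2 * pi * v j * y)\<^sup>2 \<le> (2 * pi * v j * x)\<^sup>2"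
      using xy by (simp add: power_mult_distrib mult_left_mono abs_le_square_iff)
    then have "(cmod (1 + \<i> * of_real (2 * pi * v j * y)))\<^sup>2 \<le> (cmod (1 + \<i> * of_real (2 * pi * v j * x)))\<^sup>2"
      unfolding sq by simp
    then have "cmod (1 + \<i> * of_real (2 * pi * v j * y)) \<le> cmod (1 + \<i> * of_real (2 * pi * v j * x))"
      by (rule power2_le_imp_le) simp
    moreover have "0 < cmod (1 + \<i> * of_real (2 * pi * v j * y))"
      using nz[of "2 * pi * v j * y"] by (metis zero_less_norm_iff)
    moreover have "cmod (f w j) = inverse (cmod (1 + \<i> * of_real (2 * pi * v j * w)))" for w
      unfolding f_def by (simp only: norm_mult norm_inverse norm_exp_i_times mult_1_right)
    ultimately show "0 \<le> cmod (f x j) \<and> cmod (f x j) \<le> cmod (f y j)"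
      by (metis norm_ge_zero le_imp_inverse_le)
  qed
  have sqF: "(cmod (fourier \<phi> w))\<^sup>2 = exp (- 2 * pi * w\<^sup>2) * (cmod (P w))\<^sup>2" for w
    by (simp add: FP norm_mult power_mult_distrib flip: exp_double)
  show ?thesis
    unfolding gaussian_decreasing_def
  proof (intro conjI allI impI)
    fix x
    show "0 < (cmod (fourier \<phi> x))\<^sup>2"
      using Pnz[of x] by (simp add: FP)
  next
    fix x y :: real
    assume "\<bar>y\<bar> \<le> \<bar>x\<bar>"
    then have "(cmod (P x))\<^sup>2 \<le> (cmod (P y))\<^sup>2"
      by (intro power_mono mono) auto
    then have "(cmod (fourier \<phi> x))\<^sup>2 \<le> exp (- 2 * pi * x\<^sup>2) * (cmod (P y))\<^sup>2"
      unfolding sqF by (intro mult_left_mono) auto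
    also have "\<dots> = exp (- (2 * pi) * (x\<^sup>2 - y\<^sup>2)) * (cmod (fourier \<phi> y))\<^sup>2"
    proof -
      have "exp (- 2 * pi * x\<^sup>2) = exp (- (2 * pi) * (x\<^sup>2 - y\<^sup>2)) * exp (- 2 * pi * y\<^sup>2)"
        by (simp add: algebra_simps flip: exp_add)
      then show ?thesis
        unfolding sqF by (metis mult.assoc)
    qed
    finally show "(cmod (fourier \<phi> x))\<^sup>2 \<le> exp (- (2 * pi) * (x\<^sup>2 - y\<^sup>2)) * (cmod (fourier \<phi> y))\<^sup>2" .
  qed
qed

section \<open>Fourier inversion and the Plancherel identity\<close>

definition wave :: "real \<Rightarrow> complex" where
  "wave t = exp (2 * of_real pi * \<i> * of_real t)"

lemma wave_iexp: "wave t = iexp (2 * pi * t)"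
  unfolding wave_def by (intro arg_cong[where f = exp]) simp

lemma norm_wave [simp]: "cmod (wave t) = 1"
  unfolding wave_iexp by (simp only: norm_exp_i_times)

lemma cnj_wave: "cnj (wave t) = wave (- t)"
  unfolding wave_def exp_cnj by (intro arg_cong[where f = exp]) simp

lemma wave_0 [simp]: "wave 0 = 1"
  by (simp add: wave_def)

lemma wave_add: "wave (s + t) = wave s * wave t"
  unfolding wave_def exp_add[symmetric] by (intro arg_cong[where f = exp]) (simp add: algebra_simps)

lemma continuous_on_wave [continuous_intros]:
  "continuous_on S f \<Longrightarrow> continuous_on S (\<lambda>x. wave (f x))"
  unfolding wave_def by (intro continuous_intros)

lemma tendsto_wave [tendsto_intros]:
  "(f \<longlongrightarrow> a) F \<Longrightarrow> ((\<lambda>x. wave (f x)) \<longlongrightarrow> wave a) F"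
  unfolding wave_def by (intro tendsto_intros)

lemma wave_measurable [measurable (raw)]:
  assumes "f \<in> borel_measurable M"
  shows "(\<lambda>x. wave (f x)) \<in> borel_measurable M"
proof -
  have "wave \<in> borel_measurable borel"
    by (intro borel_measurable_continuous_onI continuous_intros)
  then show ?thesis
    using measurable_compose[OF assms] by blast
qed

lemma cnj_measurable [measurable (raw)]:
  assumes "f \<in> borel_measurable M"
  shows "(\<lambda>x. cnj (f x)) \<in> borel_measurable M"
proof -
  have "cnj \<in> borel_measurable borel"
    by (intro borel_measurable_continuous_onI continuous_intros)
  then show ?thesis
    using measurable_compose[OF assms] by blast
qed

lemma wave_has_vector_derivative:
  "((\<lambda>t. wave (t * x)) has_vector_derivative (2 * of_real pi * \<i> * of_real x * wave (w * x))) (at w within S)"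
proof -
  have "((\<lambda>z. exp (2 * of_real pi * \<i> * of_real x * z)) has_field_derivative
      (2 * of_real pi * \<i> * of_real x * exp (2 * of_real pi * \<i> * of_real x * of_real w))) (at (of_real w))"
    by (auto intro!: derivative_eq_intros)
  from has_vector_derivative_real_field[OF this, where s = S]
  show ?thesis
    unfolding wave_def by (simp add: mult_ac)
qed

lemma norm_wave_diff_le: "cmod (wave s - wave t) \<le> 2 * pi * \<bar>s - t\<bar>"
proof -
  have "wave s - wave t = wave t * (iexp (2 * pi * (s - t)) - 1)"
    using wave_add[of t "s - t"] by (simp add: wave_iexp[of "s - t"] algebra_simps)
  then have "cmod (wave s - wave t) = cmod (iexp (2 * pi * (s - t)) - 1)"
    by (simp only: norm_mult norm_wave mult_1_left)
  also have "\<dots> \<le> \<bar>2 * pi * (s - t)\<bar>"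
    using iexp_approx1[of "2 * pi * (s - t)" 0] by simp
  finally show ?thesis
    by (simp add: abs_mult)
qed

lemma fourier_wave: "fourier f w = (LINT x|lebesgue. f x * wave (- (w * x)))"
  unfolding fourier_def wave_def by simp

lemma borel_measurable_imp_lebesgue:
  "f \<in> borel_measurable borel \<Longrightarrow> f \<in> borel_measurable lebesgue"
  by (simp add: measurable_completion)

lemma integrable_lebesgue_iff:
  fixes f :: "real \<Rightarrow> 'b::{banach, second_countable_topology}"
  shows "f \<in> borel_measurable borel \<Longrightarrow> integrable lebesgue f \<longleftrightarrow> integrable lborel f"
  by (rule integrable_completion) simp

lemma integral_lebesgue_eq:
  fixes f :: "real \<Rightarrow> 'b::{banach, second_countable_topology}"
  shows "f \<in> borel_measurable borel \<Longrightarrow> integral\<^sup>L lebesgue f = integral\<^sup>L lborel f"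
  by (rule integral_completion) simp

lemma sigma_finite_lebesgue: "sigma_finite_measure (lebesgue :: real measure)"
proof -
  obtain A :: "real set set" where A: "countable A" "A \<subseteq> sets lborel" "\<Union>A = space lborel"
      "\<forall>a\<in>A. emeasure lborel a \<noteq> \<infinity>"
    using lborel.sigma_finite_countable by auto
  show ?thesis
  proof (standard, intro exI conjI)
    show "countable A" "\<Union>A = space lebesgue" "A \<subseteq> sets lebesgue"
      using A by auto
    show "\<forall>a\<in>A. emeasure lebesgue a \<noteq> \<infinity>"
      using A by (auto simp: subset_iff emeasure_completion)
  qed
qed

lemma integrable_mult_wave:
  assumes "integrable lebesgue f" "g \<in> borel_measurable borel"
  shows "integrable lebesgue (\<lambda>x. f x * wave (g x))"
proof (rule Bochner_Integration.integrable_bound[OF assms(1)])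
  have "(\<lambda>x. wave (g x)) \<in> borel_measurable lebesgue"
    using assms(2) by (intro borel_measurable_imp_lebesgue) measurable
  then show "(\<lambda>x. f x * wave (g x)) \<in> borel_measurable lebesgue"
    using assms(1) by (intro borel_measurable_times) auto
qed (simp add: norm_mult)

lemma norm_fourier_le:
  "cmod (fourier f w) \<le> (LINT x|lebesgue. cmod (f x))"
  unfolding fourier_wave
  by (rule order.trans[OF integral_norm_bound]) (simp add: norm_mult)

lemma continuous_fourier:
  assumes f: "integrable lebesgue f"
  shows "continuous_on UNIV (fourier f)"
  unfolding continuous_on_sequentially
proof (intro allI ballI impI)
  fix X :: "nat \<Rightarrow> real" and a
  assume "(\<forall>n. X n \<in> UNIV) \<and> X \<longlonglongrightarrow> a"
  then have X: "X \<longlonglongrightarrow> a" by simp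
  have "(\<lambda>n. LINT x|lebesgue. f x * wave (- (X n * x))) \<longlonglongrightarrow> (LINT x|lebesgue. f x * wave (- (a * x)))"
  proof (rule integral_dominated_convergence[where w = "\<lambda>x. cmod (f x)"])
    show "AE x in lebesgue. (\<lambda>n. f x * wave (- (X n * x))) \<longlonglongrightarrow> f x * wave (- (a * x))"
      by (intro always_eventually allI tendsto_intros X)
    have "(\<lambda>x. f x * wave (- (c * x))) \<in> borel_measurable lebesgue" for c
      by (rule borel_measurable_integrable, rule integrable_mult_wave[OF f]) measurable
    then show "(\<lambda>x. f x * wave (- (a * x))) \<in> borel_measurable lebesgue"
      "\<And>n. (\<lambda>x. f x * wave (- (X n * x))) \<in> borel_measurable lebesgue"
      by blast+
  qed (use f in \<open>auto simp: norm_mult\<close>)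
  then show "(fourier f \<circ> X) \<longlonglongrightarrow> fourier f a"
    by (simp add: fourier_wave o_def)
qed

lemma measurable_fourier:
  assumes f: "integrable lebesgue f"
  shows "fourier f \<in> borel_measurable borel"
  by (intro borel_measurable_continuous_onI continuous_fourier f)

lemma fourier_dilate:
  assumes "0 < \<gamma>"
  shows "fourier (dilate \<gamma> \<phi>) w = of_real (1 / sqrt \<gamma>) * fourier \<phi> (w / \<gamma>)"
proof -
  have "fourier \<phi> (w / \<gamma>) = \<bar>\<gamma>\<bar> *\<^sub>R (LINT x|lebesgue. \<phi> (0 + \<gamma> * x) * wave (- (w / \<gamma> * (0 + \<gamma> * x))))"
    unfolding fourier_wave by (rule lebesgue_integral_real_affine) (use assms in simp)
  also have "\<dots> = \<gamma> *\<^sub>R (LINT x|lebesgue. \<phi> (\<gamma> * x) * wave (- (w * x)))"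
    using assms by simp
  finally have 1: "fourier \<phi> (w / \<gamma>) = of_real \<gamma> * (LINT x|lebesgue. \<phi> (\<gamma> * x) * wave (- (w * x)))"
    by (simp add: scaleR_conv_of_real)
  have "fourier (dilate \<gamma> \<phi>) w = of_real (sqrt \<gamma>) * (LINT x|lebesgue. \<phi> (\<gamma> * x) * wave (- (w * x)))"
    unfolding fourier_wave dilate_def by (simp add: mult.assoc)
  moreover have "complex_of_real (1 / sqrt \<gamma>) * of_real \<gamma> = of_real (sqrt \<gamma>)"
    using assms by (metis of_real_mult real_div_sqrt times_divide_eq_left mult_1 less_imp_le)
  ultimately show ?thesis
    unfolding 1 by (simp only: mult.assoc[symmetric])
qed

lemma integrable_dilate:
  assumes "0 < \<gamma>" "integrable lebesgue \<phi>"
  shows "integrable lebesgue (dilate \<gamma> \<phi>)"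
  unfolding dilate_def
  using lebesgue_integrable_real_affine[OF assms(2), of \<gamma> 0] assms(1) by simp

text \<open>Differentiation under the integral sign: the difference quotients of the characters differ from
  their limits by at most \<open>4 \<pi> \<bar>x\<bar>\<close>, so dominated convergence applies.\<close>

lemma fourier_has_vector_derivative:
  assumes f: "integrable lebesgue f" and xf: "integrable lebesgue (\<lambda>x. of_real x * f x)"
  shows "(fourier f has_vector_derivative fourier (\<lambda>x. - 2 * of_real pi * \<i> * of_real x * f x) w) (at w)"
proof -
  define D where "D x = - 2 * of_real pi * \<i> * of_real x * f x" for x
  have D: "integrable lebesgue D"
    unfolding D_def using integrable_mult_right[OF xf, of "- 2 * of_real pi * \<i>"]
    by (simp add: mult.assoc)
  have "((\<lambda>y. (fourier f y - fourier f w - (y - w) *\<^sub>R fourier D w) /\<^sub>R norm (y - w)) \<longlongrightarrow> 0) (at w)"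
    unfolding tendsto_at_iff_sequentially
  proof (intro allI impI)
    fix X :: "nat \<Rightarrow> real"
    assume Xw: "\<forall>i. X i \<in> UNIV - {w}" and X: "X \<longlonglongrightarrow> w"
    let ?d = "\<lambda>x. - 2 * of_real pi * \<i> * of_real x * wave (- (w * x))"
    let ?q = "\<lambda>y x. (wave (- (y * x)) - wave (- (w * x)) - (y - w) *\<^sub>R ?d x) /\<^sub>R norm (y - w)"
    have q: "(fourier f (X n) - fourier f w - (X n - w) *\<^sub>R fourier D w) /\<^sub>R norm (X n - w)
        = (LINT x|lebesgue. f x * ?q (X n) x)" for n
    proof -
      let ?D = "\<lambda>x. f x * wave (- (X n * x)) - f x * wave (- (w * x)) - (X n - w) *\<^sub>R (D x * wave (- (w * x)))"
      have int: "integrable lebesgue (\<lambda>x. f x * wave (- (c * x)))" "integrable lebesgue (\<lambda>x. D x * wave (- (c * x)))" for c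
        by (rule integrable_mult_wave, rule f D, measurable)+
      have "(LINT x|lebesgue. f x * ?q (X n) x) = (LINT x|lebesgue. ?D x /\<^sub>R norm (X n - w))"
        by (rule Bochner_Integration.integral_cong)
           (simp_all add: D_def algebra_simps scaleR_conv_of_real)
      also have "\<dots> = (LINT x|lebesgue. ?D x) /\<^sub>R norm (X n - w)"
        by (rule integral_scaleR_right)
      also have "(LINT x|lebesgue. ?D x) = (LINT x|lebesgue. f x * wave (- (X n * x))) - (LINT x|lebesgue. f x * wave (- (w * x)))
              - (X n - w) *\<^sub>R (LINT x|lebesgue. D x * wave (- (w * x)))"
        using int by simp
      finally show ?thesis
        by (simp only: fourier_wave)
    qed
    have "(\<lambda>n. LINT x|lebesgue. f x * ?q (X n) x) \<longlonglongrightarrow> (LINT (x::real)|lebesgue. 0)"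
    proof (rule integral_dominated_convergence[where w = "\<lambda>x. 4 * pi * cmod (of_real x * f x)"])
      show "integrable lebesgue (\<lambda>x. 4 * pi * cmod (of_real x * f x))"
        by (intro integrable_mult_right integrable_norm xf)
      show "\<And>n. (\<lambda>x. f x * ?q (X n) x) \<in> borel_measurable lebesgue"
        by (intro borel_measurable_times borel_measurable_integrable[OF f] borel_measurable_imp_lebesgue) measurable
      show "AE x in lebesgue. (\<lambda>n. f x * ?q (X n) x) \<longlonglongrightarrow> 0"
      proof (intro always_eventually allI)
        fix x
        have "((\<lambda>y. ?q y x) \<longlongrightarrow> 0) (at w)"
          using wave_has_vector_derivative[of "- x" w UNIV]
          unfolding has_vector_derivative_def has_derivative_at_within by simp
        then have "(\<lambda>n. ?q (X n) x) \<longlonglongrightarrow> 0"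
          using Xw X unfolding tendsto_at_iff_sequentially o_def by blast
        from tendsto_mult_left[OF this, of "f x"]
        show "(\<lambda>n. f x * ?q (X n) x) \<longlonglongrightarrow> 0" by simp
      qed
      show "\<And>n. AE x in lebesgue. norm (f x * ?q (X n) x) \<le> 4 * pi * cmod (of_real x * f x)"
      proof (intro always_eventually allI)
        fix n x
        have nz: "0 < norm (X n - w)"
          using Xw by auto
        have "\<bar>- (X n * x) - - (w * x)\<bar> = \<bar>x\<bar> * norm (X n - w)"
          by (simp add: abs_minus_commute left_diff_distrib[symmetric] abs_mult flip: minus_diff_eq[of "w * x" "X n * x"])
        then have "cmod (wave (- (X n * x)) - wave (- (w * x))) \<le> 2 * pi * \<bar>x\<bar> * norm (X n - w)"
          using norm_wave_diff_le[of "- (X n * x)" "- (w * x)"] by (simp add: mult.assoc)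
        moreover have "cmod ((X n - w) *\<^sub>R ?d x) = 2 * pi * \<bar>x\<bar> * norm (X n - w)"
          by (simp add: norm_mult mult_ac)
        ultimately have "cmod (wave (- (X n * x)) - wave (- (w * x)) - (X n - w) *\<^sub>R ?d x) \<le> 4 * pi * \<bar>x\<bar> * norm (X n - w)"
          using norm_triangle_ineq4[of "wave (- (X n * x)) - wave (- (w * x))" "(X n - w) *\<^sub>R ?d x"]
          by linarith
        then have "cmod (?q (X n) x) \<le> 4 * pi * \<bar>x\<bar>"
          using nz by (simp add: divide_simps mult_ac)
        then have "cmod (f x * ?q (X n) x) \<le> cmod (f x) * (4 * pi * \<bar>x\<bar>)"
          unfolding norm_mult by (rule mult_left_mono) simp
        then show "norm (f x * ?q (X n) x) \<le> 4 * pi * cmod (of_real x * f x)"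
          by (simp add: norm_mult mult_ac)
      qed
    qed simp
    then show "((\<lambda>y. (fourier f y - fourier f w - (y - w) *\<^sub>R fourier D w) /\<^sub>R norm (y - w)) \<circ> X) \<longlonglongrightarrow> 0"
      by (simp only: o_def q) simp
  qed
  then show ?thesis
    unfolding has_vector_derivative_def has_derivative_at_within D_def[symmetric]
    by (simp add: bounded_linear_scaleR_left)
qed

text \<open>The summability factor is scaled such that its transform is the normal density of standard
  deviation \<open>s\<close>.\<close>

definition gaussian_cutoff :: "real \<Rightarrow> real \<Rightarrow> real" where
  "gaussian_cutoff s w = exp (- 2 * pi\<^sup>2 * s\<^sup>2 * w\<^sup>2)"

lemma gaussian_cutoff_measurable [measurable (raw)]:
  assumes "f \<in> borel_measurable M"
  shows "(\<lambda>x. gaussian_cutoff s (f x)) \<in> borel_measurable M"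
  using assms unfolding gaussian_cutoff_def by measurable

lemma gaussian_cutoff_eq_density:
  assumes "0 < s"
  shows "gaussian_cutoff s w = sqrt (2 * pi) * std_normal_density (2 * pi * s * w)"
  unfolding gaussian_cutoff_def std_normal_density_def by (simp add: power_mult_distrib)

lemma integrable_gaussian_cutoff:
  assumes "0 < s"
  shows "integrable lborel (gaussian_cutoff s)"
proof -
  have "integrable lborel (\<lambda>w. std_normal_density (0 + (2 * pi * s) * w))"
    using assms by (intro lborel_integrable_real_affine) auto
  then show ?thesis
    unfolding gaussian_cutoff_eq_density[OF assms, abs_def] by simp
qed

text \<open>This is the characteristic function of the standard normal distribution after a linear
  substitution.\<close>

lemma gaussian_cutoff_transform:
  assumes s: "0 < s"
  shows "(LBINT w. of_real (gaussian_cutoff s w) * wave (w * y)) = of_real (normal_density 0 s y)"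
proof -
  have "of_real (exp (- ((y / s)\<^sup>2) / 2)) = char std_normal_distribution (y / s)"
    by (simp add: char_std_normal_distribution)
  also have "\<dots> = (LBINT x. std_normal_density x *\<^sub>R iexp (y / s * x))"
    unfolding char_def by (subst integral_density) (auto simp: normal_density_nonneg)
  also have "\<dots> = \<bar>2 * pi * s\<bar> *\<^sub>R (LBINT w. std_normal_density (0 + (2 * pi * s) * w) *\<^sub>R iexp (y / s * (0 + (2 * pi * s) * w)))"
    by (rule lborel_integral_real_affine) (use s in auto)
  also have "(\<lambda>w. std_normal_density (0 + (2 * pi * s) * w) *\<^sub>R iexp (y / s * (0 + (2 * pi * s) * w)))
      = (\<lambda>w. (1 / sqrt (2 * pi)) *\<^sub>R (of_real (gaussian_cutoff s w) * wave (w * y)))"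
  proof
    fix w
    have "y / s * (0 + (2 * pi * s) * w) = 2 * pi * (w * y)"
      using s by simp
    then have "iexp (y / s * (0 + (2 * pi * s) * w)) = wave (w * y)"
      by (simp only: wave_iexp)
    then show "std_normal_density (0 + (2 * pi * s) * w) *\<^sub>R iexp (y / s * (0 + (2 * pi * s) * w))
      = (1 / sqrt (2 * pi)) *\<^sub>R (of_real (gaussian_cutoff s w) * wave (w * y))"
      by (simp add: gaussian_cutoff_eq_density[OF s] scaleR_conv_of_real del: of_real_exp)
  qed
  also have "(LBINT w. (1 / sqrt (2 * pi)) *\<^sub>R (of_real (gaussian_cutoff s w) * wave (w * y)))
      = (1 / sqrt (2 * pi)) *\<^sub>R (LBINT w. of_real (gaussian_cutoff s w) * wave (w * y))"
    by (rule integral_scaleR_right)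
  finally have "of_real (exp (- ((y / s)\<^sup>2) / 2))
      = of_real (2 * pi * s / sqrt (2 * pi)) * (LBINT w. of_real (gaussian_cutoff s w) * wave (w * y))"
    using s by (simp add: scaleR_conv_of_real del: of_real_exp)
  moreover have "2 * pi * s / sqrt (2 * pi) = sqrt (2 * pi * s\<^sup>2)"
    using s by (simp add: real_sqrt_mult real_div_sqrt field_simps)
  ultimately have "of_real (exp (- ((y / s)\<^sup>2) / 2))
      = of_real (sqrt (2 * pi * s\<^sup>2)) * (LBINT w. of_real (gaussian_cutoff s w) * wave (w * y))"
    by (simp only:)
  moreover have "complex_of_real (sqrt (2 * pi * s\<^sup>2)) \<noteq> 0"
    using s by simp
  ultimately have "(LBINT w. of_real (gaussian_cutoff s w) * wave (w * y))
      = of_real (exp (- ((y / s)\<^sup>2) / 2)) / of_real (sqrt (2 * pi * s\<^sup>2))"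
    by (metis nonzero_mult_div_cancel_left)
  also have "\<dots> = of_real (normal_density 0 s y)"
    by (simp add: normal_density_def power_divide del: of_real_exp flip: of_real_divide)
  finally show ?thesis .
qed

text \<open>Fubini's theorem moves the integral over \<open>w\<close> inside, where it is the transform of the Gaussian
  factor. So the damped inverse transform of \<open>f\<close> is an average of \<open>f\<close>.\<close>

lemma gaussian_summation:
  assumes f: "integrable lebesgue f" and s: "0 < s"
  shows "(LBINT w. fourier f w * (of_real (gaussian_cutoff s w) * wave (w * x)))
       = (LINT y|lebesgue. f y * of_real (normal_density 0 s (x - y)))"
proof -
  interpret L: sigma_finite_measure "lebesgue :: real measure"
    by (rule sigma_finite_lebesgue)
  interpret P: pair_sigma_finite "lebesgue :: real measure" "lborel :: real measure" ..
  let ?h = "\<lambda>y w. f y * (of_real (gaussian_cutoff s w) * wave (w * (x - y)))"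
  have [measurable]: "f \<in> borel_measurable lebesgue"
    using f by auto
  have g: "integrable lborel (\<lambda>w. complex_of_real (gaussian_cutoff s w) * wave (w * c))" for c
  proof (rule Bochner_Integration.integrable_bound[OF integrable_gaussian_cutoff[OF s]])
    show "(\<lambda>w. complex_of_real (gaussian_cutoff s w) * wave (w * c)) \<in> borel_measurable lborel"
      by measurable
  qed (simp add: norm_mult)
  have "(\<lambda>x. x) \<in> measurable lebesgue (borel :: real measure)"
    by (rule borel_measurable_imp_lebesgue) simp
  from measurable_compose[OF measurable_fst this]
  have [measurable]: "fst \<in> borel_measurable ((lebesgue :: real measure) \<Otimes>\<^sub>M (lborel :: real measure))" .
  have m: "case_prod ?h \<in> borel_measurable (lebesgue \<Otimes>\<^sub>M lborel)"
    by measurable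
  have "integrable (lebesgue \<Otimes>\<^sub>M lborel) (case_prod ?h)"
  proof (rule P.Fubini_integrable[OF m])
    have "(\<lambda>y. LBINT w. norm (case (y, w) of (y, w) \<Rightarrow> ?h y w)) = (\<lambda>y. cmod (f y) * (LBINT w. norm (gaussian_cutoff s w)))"
      by (simp add: norm_mult)
    then show "integrable lebesgue (\<lambda>y. LBINT w. norm (case (y, w) of (y, w) \<Rightarrow> ?h y w))"
      using f by simp
    show "AE y in lebesgue. integrable lborel (\<lambda>w. case (y, w) of (y, w) \<Rightarrow> ?h y w)"
      using g by (auto intro!: always_eventually)
  qed
  from P.Fubini_integral[OF this]
  have "(LBINT w. (LINT y|lebesgue. ?h y w)) = (LINT y|lebesgue. (LBINT w. ?h y w))" .
  also have "(\<lambda>y. LBINT w. ?h y w) = (\<lambda>y. f y * of_real (normal_density 0 s (x - y)))"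
    by (simp add: gaussian_cutoff_transform[OF s])
  also have "(\<lambda>w. LINT y|lebesgue. ?h y w) = (\<lambda>w. fourier f w * (of_real (gaussian_cutoff s w) * wave (w * x)))"
  proof
    fix w
    have "?h y w = f y * wave (- (w * y)) * (of_real (gaussian_cutoff s w) * wave (w * x))" for y
      using wave_add[of "w * x" "- (w * y)"] by (simp add: algebra_simps)
    then have "(LINT y|lebesgue. ?h y w) = (LINT y|lebesgue. f y * wave (- (w * y)) * (of_real (gaussian_cutoff s w) * wave (w * x)))"
      by presburger
    then show "(LINT y|lebesgue. ?h y w) = fourier f w * (of_real (gaussian_cutoff s w) * wave (w * x))"
      unfolding fourier_wave by (simp only: integral_mult_left_zero)
  qed
  finally show ?thesis .
qed

definition narrow_width :: "nat \<Rightarrow> real" where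
  "narrow_width n = 1 / real (Suc n)"

lemma narrow_width_pos [simp]: "0 < narrow_width n"
  and narrow_width_Suc_le: "narrow_width (Suc n) \<le> narrow_width n"
  by (simp_all add: narrow_width_def frac_le)

lemma narrow_width_tendsto_0: "narrow_width \<longlonglongrightarrow> 0"
  using LIMSEQ_inverse_real_of_nat unfolding narrow_width_def by (simp add: inverse_eq_divide)

abbreviation smooth :: "nat \<Rightarrow> (real \<Rightarrow> complex) \<Rightarrow> real \<Rightarrow> complex" where
  "smooth n f x \<equiv> (LBINT y. f y * of_real (normal_density 0 (narrow_width n) (x - y)))"

abbreviation damped_inverse :: "real \<Rightarrow> (real \<Rightarrow> complex) \<Rightarrow> real \<Rightarrow> complex" where
  "damped_inverse s f x \<equiv> (LBINT w. fourier f w * (of_real (gaussian_cutoff s w) * wave (w * x)))"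

lemma normal_density_swap: "normal_density 0 s (x - y) = normal_density 0 s (y - x)"
  by (simp add: normal_density_def power2_commute)

lemma normal_density_kernel:
  assumes "0 < s"
  shows "integrable lborel (\<lambda>y. normal_density 0 s (x - y))" "(LBINT y. normal_density 0 s (x - y)) = 1"
proof -
  have "normal_density 0 s (x - y) = normal_density x s y" for y
    by (simp add: normal_density_def power2_commute)
  then show "integrable lborel (\<lambda>y. normal_density 0 s (x - y))" "(LBINT y. normal_density 0 s (x - y)) = 1"
    using assms by simp_all
qed

lemma smooth_bounded:
  fixes v :: "real \<Rightarrow> complex"
  assumes v [measurable]: "v \<in> borel_measurable borel" and K: "\<And>x. cmod (v x) \<le> K"
  shows smooth_integrable: "integrable lborel (\<lambda>y. v y * of_real (normal_density 0 (narrow_width n) (x - y)))"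
    and smooth_norm_le: "(LBINT y. cmod (v y) * normal_density 0 (narrow_width n) (x - y)) \<le> K"
    and smooth_le: "cmod (smooth n v x) \<le> K"
proof -
  let ?k = "\<lambda>y. normal_density 0 (narrow_width n) (x - y)"
  have k: "integrable lborel ?k" "(LBINT y. ?k y) = 1"
    using normal_density_kernel[of "narrow_width n" x] by simp_all
  have K0: "0 \<le> K"
    using K[of 0] norm_ge_zero order.trans by blast
  show int: "integrable lborel (\<lambda>y. v y * of_real (?k y))"
  proof (rule Bochner_Integration.integrable_bound)
    show "integrable lborel (\<lambda>y. K * ?k y)"
      using k by simp
  qed (use K K0 in \<open>auto simp: norm_mult abs_mult normal_density_nonneg intro!: mult_right_mono\<close>)
  have "(LBINT y. cmod (v y) * ?k y) \<le> (LBINT y. K * ?k y)"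
    by (rule integral_mono') (use k K K0 in \<open>auto simp: normal_density_nonneg intro!: mult_right_mono\<close>)
  then show le: "(LBINT y. cmod (v y) * ?k y) \<le> K"
    using k by simp
  have "cmod (smooth n v x) \<le> (LBINT y. cmod (v y * of_real (?k y)))"
    by (rule integral_norm_bound)
  also have "\<dots> = (LBINT y. cmod (v y) * ?k y)"
    by (simp add: norm_mult normal_density_nonneg)
  finally show "cmod (smooth n v x) \<le> K"
    using le by linarith
qed

text \<open>After the substitution \<open>y = x - z / (n + 1)\<close> the density no longer depends on \<open>n\<close>, and dominated
  convergence applies.\<close>

lemma smooth_tendsto:
  fixes v :: "real \<Rightarrow> complex"
  assumes v [measurable]: "v \<in> borel_measurable borel" and K: "\<And>x. cmod (v x) \<le> K" and x: "isCont v x"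
  shows "(\<lambda>n. smooth n v x) \<longlonglongrightarrow> v x"
proof -
  have "smooth n v x
      = (LBINT z. std_normal_density z *\<^sub>R v (x - narrow_width n * z))" for n
  proof -
    define s where "s = narrow_width n"
    have s: "0 < s"
      by (simp add: s_def)
    have "(LBINT y. v y * of_real (normal_density 0 s (x - y)))
        = \<bar>- s\<bar> *\<^sub>R (LBINT z. v (x + - s * z) * of_real (normal_density 0 s (x - (x + - s * z))))"
      by (rule lborel_integral_real_affine) (use s in simp)
    also have "\<dots> = (LBINT z. \<bar>- s\<bar> *\<^sub>R (v (x + - s * z) * of_real (normal_density 0 s (x - (x + - s * z)))))"
      by (rule integral_scaleR_right[symmetric])
    also have "\<dots> = (LBINT z. std_normal_density z *\<^sub>R v (x - s * z))"
    proof (rule Bochner_Integration.integral_cong[OF refl])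
      fix z
      have "s * normal_density 0 s (s * z) = std_normal_density z"
        using s by (simp add: normal_density_def real_sqrt_mult power_mult_distrib)
      then show "\<bar>- s\<bar> *\<^sub>R (v (x + - s * z) * of_real (normal_density 0 s (x - (x + - s * z))))
          = std_normal_density z *\<^sub>R v (x - s * z)"
        using s by (simp add: scaleR_conv_of_real mult_ac flip: of_real_mult)
    qed
    finally show ?thesis
      by (simp add: s_def)
  qed
  moreover have "(\<lambda>n. LBINT z. std_normal_density z *\<^sub>R v (x - narrow_width n * z)) \<longlonglongrightarrow> (LBINT z. std_normal_density z *\<^sub>R v x)"
  proof (rule integral_dominated_convergence[where w = "\<lambda>z. std_normal_density z * K"])
    show "integrable lborel (\<lambda>z. std_normal_density z * K)"
      by simp
    show "AE z in lborel. (\<lambda>n. std_normal_density z *\<^sub>R v (x - narrow_width n * z)) \<longlonglongrightarrow> std_normal_density z *\<^sub>R v x"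
    proof (intro always_eventually allI tendsto_intros)
      fix z
      have "(\<lambda>n. x - narrow_width n * z) \<longlonglongrightarrow> x - 0 * z"
        by (intro tendsto_intros narrow_width_tendsto_0)
      then show "(\<lambda>n. v (x - narrow_width n * z)) \<longlonglongrightarrow> v x"
        using isCont_tendsto_compose[OF x] by simp
    qed
  qed (use K in \<open>auto intro!: mult_left_mono simp: normal_density_nonneg\<close>)
  moreover have "(LBINT z. std_normal_density z *\<^sub>R v x) = v x"
    by simp
  ultimately show ?thesis
    by simp
qed

lemma gaussian_cutoff_le_1: "gaussian_cutoff s w \<le> 1" and gaussian_cutoff_pos: "0 < gaussian_cutoff s w"
  by (simp_all add: gaussian_cutoff_def)

lemma gaussian_cutoff_tendsto_1: "(\<lambda>n. gaussian_cutoff (narrow_width n) w) \<longlonglongrightarrow> 1"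
proof -
  have "(\<lambda>n. exp (- 2 * pi\<^sup>2 * (narrow_width n)\<^sup>2 * w\<^sup>2)) \<longlonglongrightarrow> exp (- 2 * pi\<^sup>2 * 0\<^sup>2 * w\<^sup>2)"
    by (intro tendsto_intros narrow_width_tendsto_0)
  then show ?thesis
    unfolding gaussian_cutoff_def by simp
qed

text \<open>With the Gaussian factor inserted, Fubini's theorem turns the energy of the transform into the
  inner product of \<open>f\<close> with a smoothed \<open>f\<close>. As the factor increases to \<open>1\<close>, the left-hand side converges
  monotonically and the right-hand side by dominated convergence. In particular the transform is
  square integrable, which is not clear beforehand.\<close>

lemma plancherel:
  assumes f: "integrable lborel f" and cont: "continuous_on UNIV f" and K: "\<And>x. cmod (f x) \<le> K"
  shows "energy (fourier f) = energy f"
proof -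
  have fm [measurable]: "f \<in> borel_measurable borel"
    using cont by (intro borel_measurable_continuous_onI)
  have fl: "integrable lebesgue f"
    using f by (simp add: integrable_lebesgue_iff)
  have Fm [measurable]: "fourier f \<in> borel_measurable borel"
    by (rule measurable_fourier[OF fl])
  have K0: "0 \<le> K"
    using K[of 0] norm_ge_zero order.trans by blast
  define B where "B = (LINT x|lebesgue. cmod (f x))"
  have B: "cmod (fourier f w) \<le> B" for w
    unfolding B_def by (rule norm_fourier_le)
  have B0: "0 \<le> B"
    using B[of 0] norm_ge_zero order.trans by blast
  have f2: "integrable lborel (\<lambda>x. (cmod (f x))\<^sup>2)"
  proof (rule Bochner_Integration.integrable_bound)
    show "integrable lborel (\<lambda>x. K * cmod (f x))"
      using f by simp
    show "AE x in lborel. norm ((cmod (f x))\<^sup>2) \<le> norm (K * cmod (f x))"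
      using K K0 by (auto simp: power2_eq_square intro!: mult_right_mono)
  qed measurable
  let ?s = narrow_width
  let ?g = "\<lambda>n. gaussian_cutoff (?s n)"
  have gi: "integrable lborel (?g n)" for n
    by (rule integrable_gaussian_cutoff) simp
  have int: "integrable lborel (\<lambda>w. (cmod (fourier f w))\<^sup>2 * ?g n w)" for n
  proof (rule Bochner_Integration.integrable_bound)
    show "integrable lborel (\<lambda>w. B\<^sup>2 * ?g n w)"
      using gi by simp
    show "AE w in lborel. norm ((cmod (fourier f w))\<^sup>2 * ?g n w) \<le> norm (B\<^sup>2 * ?g n w)"
      using B B0 gaussian_cutoff_pos[of "?s n"]
      by (auto simp: abs_mult less_imp_le intro!: mult_right_mono power_mono)
  qed measurable
  have damped: "of_real (LBINT w. (cmod (fourier f w))\<^sup>2 * ?g n w)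
      = (LBINT x. cnj (f x) * smooth n f x)" for n
  proof -
    let ?h = "\<lambda>w x. fourier f w * of_real (?g n w) * (cnj (f x) * wave (w * x))"
    have m: "case_prod ?h \<in> borel_measurable (lborel \<Otimes>\<^sub>M lborel)"
      by measurable
    have fw: "integrable lborel (\<lambda>x. cnj (f x) * wave (w * x))" for w
    proof (rule Bochner_Integration.integrable_bound[OF f])
      show "(\<lambda>x. cnj (f x) * wave (w * x)) \<in> borel_measurable lborel"
        by measurable
    qed (simp add: norm_mult)
    have I: "integrable (lborel \<Otimes>\<^sub>M lborel) (case_prod ?h)"
    proof (rule lborel_pair.Fubini_integrable[OF m])
      show "AE w in lborel. integrable lborel (\<lambda>x. case (w, x) of (w, x) \<Rightarrow> ?h w x)"
        using fw by (auto intro!: always_eventually)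
      have "(\<lambda>w. LBINT x. norm (case (w, x) of (w, x) \<Rightarrow> ?h w x))
          = (\<lambda>w. cmod (fourier f w) * \<bar>?g n w\<bar> * (LBINT x. cmod (f x)))"
        by (simp add: norm_mult)
      moreover have "integrable lborel (\<lambda>w. cmod (fourier f w) * \<bar>?g n w\<bar>)"
      proof (rule Bochner_Integration.integrable_bound)
        show "integrable lborel (\<lambda>w. B * ?g n w)"
          using gi by simp
        show "AE w in lborel. norm (cmod (fourier f w) * \<bar>?g n w\<bar>) \<le> norm (B * ?g n w)"
          using B B0 by (auto simp: abs_mult intro!: mult_right_mono)
      qed measurable
      ultimately show "integrable lborel (\<lambda>w. LBINT x. norm (case (w, x) of (w, x) \<Rightarrow> ?h w x))"
        by simp
    qed
    have cnjF: "(LBINT x. cnj (f x) * wave (w * x)) = cnj (fourier f w)" for w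
    proof -
      have "fourier f w = (LBINT x. f x * wave (- (w * x)))"
        unfolding fourier_wave by (rule integral_lebesgue_eq) measurable
      then have "cnj (fourier f w) = (LBINT x. cnj (f x * wave (- (w * x))))"
        by (simp only: Bochner_Integration.integral_cnj)
      then show ?thesis
        by (simp add: cnj_wave)
    qed
    have "of_real (LBINT w. (cmod (fourier f w))\<^sup>2 * ?g n w) = (LBINT w. complex_of_real ((cmod (fourier f w))\<^sup>2 * ?g n w))"
      by (rule integral_complex_of_real[symmetric])
    also have "\<dots> = (LBINT w. LBINT x. ?h w x)"
    proof (rule Bochner_Integration.integral_cong[OF refl])
      fix w
      have "(LBINT x. ?h w x) = fourier f w * of_real (?g n w) * cnj (fourier f w)"
        by (simp only: integral_mult_right_zero cnjF)
      also have "\<dots> = of_real ((cmod (fourier f w))\<^sup>2 * ?g n w)"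
        by (simp only: complex_norm_square of_real_mult mult_ac)
      finally show "complex_of_real ((cmod (fourier f w))\<^sup>2 * ?g n w) = (LBINT x. ?h w x)"
        by (rule sym)
    qed
    also have "\<dots> = (LBINT x. LBINT w. ?h w x)"
      by (rule lborel_pair.Fubini_integral[OF I, symmetric])
    also have "\<dots> = (LBINT x. cnj (f x) * damped_inverse (?s n) f x)"
    proof (rule Bochner_Integration.integral_cong[OF refl])
      fix x
      have "(LBINT w. ?h w x) = (LBINT w. cnj (f x) * (fourier f w * (of_real (?g n w) * wave (w * x))))"
        by (simp only: mult_ac)
      then show "(LBINT w. ?h w x) = cnj (f x) * damped_inverse (?s n) f x"
        by (simp only: integral_mult_right_zero)
    qed
    also have "\<dots> = (LBINT x. cnj (f x) * smooth n f x)"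
    proof (rule Bochner_Integration.integral_cong[OF refl])
      fix x
      have "(LINT y|lebesgue. f y * of_real (normal_density 0 (?s n) (x - y)))
          = smooth n f x"
        by (rule integral_lebesgue_eq) measurable
      then show "cnj (f x) * damped_inverse (?s n) f x
          = cnj (f x) * smooth n f x"
        using gaussian_summation[OF fl, of "?s n" x] by simp
    qed
    finally show ?thesis .
  qed
  have avg_bound: "cmod (smooth n f x) \<le> K" for n x
    by (rule smooth_le[OF fm K])
  have "(\<lambda>n. LBINT x. cnj (f x) * smooth n f x)
      \<longlonglongrightarrow> (LBINT x. cnj (f x) * f x)"
  proof (rule integral_dominated_convergence[where w = "\<lambda>x. cmod (f x) * K"])
    show "integrable lborel (\<lambda>x. cmod (f x) * K)"
      using f by simp
    show "AE x in lborel. (\<lambda>n. cnj (f x) * smooth n f x) \<longlonglongrightarrow> cnj (f x) * f x"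
    proof (intro always_eventually allI tendsto_mult_left)
      fix x
      show "(\<lambda>n. LBINT y. f y * of_real (normal_density 0 (?s n) (x - y))) \<longlonglongrightarrow> f x"
        using cont by (intro smooth_tendsto[OF fm K]) (simp add: continuous_on_eq_continuous_at)
    qed
  qed (use avg_bound in \<open>auto simp: norm_mult intro!: mult_left_mono\<close>)
  moreover have "(LBINT x. cnj (f x) * f x) = of_real (LBINT x. (cmod (f x))\<^sup>2)"
    unfolding integral_complex_of_real[symmetric]
    by (rule Bochner_Integration.integral_cong) (simp_all add: complex_norm_square mult.commute del: of_real_power)
  ultimately have lim: "(\<lambda>n. LBINT w. (cmod (fourier f w))\<^sup>2 * ?g n w) \<longlonglongrightarrow> (LBINT x. (cmod (f x))\<^sup>2)"
    unfolding damped[symmetric] by (simp add: tendsto_of_real_iff)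
  have "(\<lambda>n. \<integral>\<^sup>+w. ennreal ((cmod (fourier f w))\<^sup>2 * ?g n w) \<partial>lborel) \<longlonglongrightarrow> (\<integral>\<^sup>+w. sq_norm (fourier f w) \<partial>lborel)"
  proof (rule nn_integral_LIMSEQ)
    show "incseq (\<lambda>n w. ennreal ((cmod (fourier f w))\<^sup>2 * ?g n w))"
    proof (intro incseq_SucI le_funI ennreal_leI mult_left_mono)
      fix n w
      have "(?s (Suc n))\<^sup>2 \<le> (?s n)\<^sup>2"
        by (intro power_mono narrow_width_Suc_le) (simp add: less_imp_le)
      then have "2 * pi\<^sup>2 * (?s (Suc n))\<^sup>2 * w\<^sup>2 \<le> 2 * pi\<^sup>2 * (?s n)\<^sup>2 * w\<^sup>2"
        by (intro mult_right_mono mult_left_mono) auto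
      then show "?g n w \<le> ?g (Suc n) w"
        unfolding gaussian_cutoff_def by simp
    qed simp
    show "(\<lambda>n. ennreal ((cmod (fourier f w))\<^sup>2 * ?g n w)) \<longlonglongrightarrow> sq_norm (fourier f w)" for w
      using tendsto_mult_left[OF gaussian_cutoff_tendsto_1[of w], of "(cmod (fourier f w))\<^sup>2"]
      by (intro tendsto_ennrealI) simp
  qed measurable
  moreover have "(\<integral>\<^sup>+w. ennreal ((cmod (fourier f w))\<^sup>2 * ?g n w) \<partial>lborel) = ennreal (LBINT w. (cmod (fourier f w))\<^sup>2 * ?g n w)" for n
    using gaussian_cutoff_pos[of "?s n"] by (intro nn_integral_eq_integral int) (auto simp: less_imp_le)
  ultimately have "(\<lambda>n. ennreal (LBINT w. (cmod (fourier f w))\<^sup>2 * ?g n w)) \<longlonglongrightarrow> (\<integral>\<^sup>+w. sq_norm (fourier f w) \<partial>lborel)"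
    by simp
  moreover have "(\<lambda>n. ennreal (LBINT w. (cmod (fourier f w))\<^sup>2 * ?g n w)) \<longlonglongrightarrow> ennreal (LBINT x. (cmod (f x))\<^sup>2)"
    by (intro tendsto_ennrealI lim)
  ultimately have "(\<integral>\<^sup>+w. sq_norm (fourier f w) \<partial>lborel) = ennreal (LBINT x. (cmod (f x))\<^sup>2)"
    using LIMSEQ_unique by blast
  also have "\<dots> = energy f"
    by (rule nn_integral_eq_integral[symmetric, OF f2]) simp
  finally show ?thesis .
qed

text \<open>The sets over which \<open>f\<close> integrates to \<open>0\<close> form a Dynkin system, and intervals are stable under
  intersection.\<close>

lemma AE_zero_if_interval_integrals_zero:
  fixes f :: "real \<Rightarrow> complex"
  assumes f: "integrable lebesgue f"
    and zero: "\<And>a b. (LINT x|lebesgue. indicat_real {a..b} x *\<^sub>R f x) = 0"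
  shows "AE x in lebesgue. f x = 0"
proof (rule sigma_finite_measure.density_zero[OF sigma_finite_lebesgue f])
  have int: "integrable lebesgue (\<lambda>x. indicat_real A x *\<^sub>R f x)" if "A \<in> sets lebesgue" for A
    using f that by (rule integrable_mult_indicator[rotated])
  have total: "(LINT x|lebesgue. f x) = 0"
  proof -
    have "(\<lambda>n. LINT x|lebesgue. indicat_real {- real n..real n} x *\<^sub>R f x) \<longlonglongrightarrow> (LINT x|lebesgue. f x)"
    proof (rule integral_dominated_convergence[where w = "\<lambda>x. cmod (f x)"])
      show "AE x in lebesgue. (\<lambda>n. indicat_real {- real n..real n} x *\<^sub>R f x) \<longlonglongrightarrow> f x"
      proof (rule always_eventually, rule allI, rule tendsto_eventually)
        fix x
        obtain N where N: "\<bar>x\<bar> \<le> real N"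
          using real_arch_simple by blast
        show "\<forall>\<^sub>F n in sequentially. indicat_real {- real n..real n} x *\<^sub>R f x = f x"
          using eventually_ge_at_top[of N] by eventually_elim (use N in \<open>auto simp: indicator_def\<close>)
      qed
      show "\<And>n. (\<lambda>x. indicat_real {- real n..real n} x *\<^sub>R f x) \<in> borel_measurable lebesgue"
        by (intro borel_measurable_integrable int) auto
    qed (use f in \<open>auto simp: indicator_def\<close>)
    then show ?thesis
      unfolding zero using LIMSEQ_unique tendsto_const by blast
  qed
  let ?G = "range (\<lambda>(a, b). {a..b :: real})"
  have stable: "Int_stable ?G"
    by (force simp: Int_stable_def)
  have sub: "?G \<subseteq> Pow UNIV"
    by simp
  have gen: "sigma_sets UNIV ?G = sets borel"
    unfolding borel_eq_atLeastAtMost by (simp add: image_def)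
  have borel: "(LINT x|lebesgue. indicat_real A x *\<^sub>R f x) = 0" if "A \<in> sigma_sets UNIV ?G" for A
    using stable sub that
  proof (induction rule: sigma_sets_induct_disjoint)
    case (basic A)
    then show ?case using zero by auto
  next
    case empty
    then show ?case by simp
  next
    case (compl A)
    then have A: "A \<in> sets lebesgue"
      by (simp add: gen)
    have "(LINT x|lebesgue. indicat_real (UNIV - A) x *\<^sub>R f x) = (LINT x|lebesgue. f x - indicat_real A x *\<^sub>R f x)"
      by (rule Bochner_Integration.integral_cong) (auto simp: indicator_def)
    also have "\<dots> = 0"
      using compl total f int[OF A] by simp
    finally show ?case .
  next
    case (union A)
    then have "A i \<in> sets lebesgue" for i
      by (auto simp: gen)
    then have "set_lebesgue_integral lebesgue (\<Union>i. A i) f = (\<Sum>i. set_lebesgue_integral lebesgue (A i) f)"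
      using union int by (intro lebesgue_integral_countable_add) (auto simp: disjoint_family_on_def set_integrable_def)
    then show ?case
      using union by (simp add: set_lebesgue_integral_def)
  qed
  fix A :: "real set"
  assume "A \<in> sets lebesgue"
  then obtain C T where C: "fsigma C" "T \<in> null_sets lebesgue" "C \<union> T = A" "disjnt C T"
    by (rule lebesgue_set_almost_fsigma)
  have "C \<in> sets borel"
    using C(1) by (auto elim!: fsigma.cases)
  moreover have "(LINT x|lebesgue. indicat_real A x *\<^sub>R f x) = (LINT x|lebesgue. indicat_real C x *\<^sub>R f x)"
  proof (rule integral_cong_AE)
    show "(\<lambda>x. indicat_real A x *\<^sub>R f x) \<in> borel_measurable lebesgue" "(\<lambda>x. indicat_real C x *\<^sub>R f x) \<in> borel_measurable lebesgue"
      using int[of A] int[of C] \<open>A \<in> sets lebesgue\<close> \<open>C \<in> sets borel\<close>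
      by (auto intro!: borel_measurable_integrable)
    have "AE x in lebesgue. x \<notin> T"
      using C(2) by (rule AE_not_in)
    then show "AE x in lebesgue. indicat_real A x *\<^sub>R f x = indicat_real C x *\<^sub>R f x"
      by eventually_elim (use C(3) in \<open>auto simp: indicator_def\<close>)
  qed
  ultimately show "set_lebesgue_integral lebesgue A f = 0"
    unfolding set_lebesgue_integral_def using borel[of C] by (simp add: gen)
qed

lemma isCont_indicator_interval:
  assumes "x \<noteq> a" "x \<noteq> b"
  shows "isCont (indicat_real {a..b :: real}) x"
proof -
  have "x \<notin> frontier {a..b}"
    using assms by (auto simp: frontier_def split: if_splits)
  then show ?thesis
    using isCont_indicator[of x "{a..b}"] by blast
qed

text \<open>The normal density is even, so smoothing can be moved from the test function \<open>v\<close> to \<open>f\<close>. The smoothed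
  \<open>f\<close> is its damped inverse transform.\<close>

lemma integral_smooth_eq_damped_inverse:
  fixes v :: "real \<Rightarrow> complex"
  assumes f: "integrable lebesgue f" and v [measurable]: "v \<in> borel_measurable borel" and K: "\<And>x. cmod (v x) \<le> K"
  shows "(LINT y|lebesgue. f y * smooth n v y) = (LBINT x. v x * damped_inverse (narrow_width n) f x)"
proof -
  interpret L: sigma_finite_measure "lebesgue :: real measure"
    by (rule sigma_finite_lebesgue)
  interpret P: pair_sigma_finite "lebesgue :: real measure" "lborel :: real measure" ..
  let ?k = "\<lambda>y. normal_density 0 (narrow_width n) y"
  let ?h = "\<lambda>y x. f y * (v x * of_real (?k (y - x)))"
  have [measurable]: "f \<in> borel_measurable lebesgue"
    using f by auto
  have norm_meas: "(\<lambda>y. LBINT x. cmod (v x) * ?k (y - x)) \<in> borel_measurable lborel"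
    by measurable
  have "(\<lambda>x. x) \<in> measurable lebesgue (borel :: real measure)"
    by (rule borel_measurable_imp_lebesgue) simp
  from measurable_compose[OF measurable_fst this]
  have fst [measurable]: "fst \<in> borel_measurable ((lebesgue :: real measure) \<Otimes>\<^sub>M (lborel :: real measure))" .
  have m: "case_prod ?h \<in> borel_measurable (lebesgue \<Otimes>\<^sub>M lborel)"
    by measurable
  have "integrable (lebesgue \<Otimes>\<^sub>M lborel) (case_prod ?h)"
  proof (rule P.Fubini_integrable[OF m])
    show "AE y in lebesgue. integrable lborel (\<lambda>x. case (y, x) of (y, x) \<Rightarrow> ?h y x)"
      using smooth_integrable[OF v K] by auto
    have e: "(LBINT x. norm (case (y, x) of (y, x) \<Rightarrow> ?h y x)) = cmod (f y) * (LBINT x. cmod (v x) * ?k (y - x))" for y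
      by (simp add: norm_mult normal_density_nonneg)
    have ge: "0 \<le> (LBINT x. cmod (v x) * ?k (y - x))" for y
      by (intro Bochner_Integration.integral_nonneg) (auto simp: normal_density_nonneg)
    show "integrable lebesgue (\<lambda>y. LBINT x. norm (case (y, x) of (y, x) \<Rightarrow> ?h y x))"
      unfolding e
    proof (rule Bochner_Integration.integrable_bound)
      show "integrable lebesgue (\<lambda>y. cmod (f y) * K)"
        using f by simp
      show "(\<lambda>y. cmod (f y) * (LBINT x. cmod (v x) * ?k (y - x))) \<in> borel_measurable lebesgue"
        using f borel_measurable_imp_lebesgue[of "\<lambda>y. LBINT x. cmod (v x) * ?k (y - x)"] norm_meas
        by (intro borel_measurable_times) auto
      show "AE y in lebesgue. norm (cmod (f y) * (LBINT x. cmod (v x) * ?k (y - x))) \<le> norm (cmod (f y) * K)"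
      proof (rule always_eventually, rule allI)
        fix y
        show "norm (cmod (f y) * (LBINT x. cmod (v x) * ?k (y - x))) \<le> norm (cmod (f y) * K)"
          using ge[of y] smooth_norm_le[OF v K, of n y] by (simp add: abs_mult mult_left_mono)
      qed
    qed
  qed
  from P.Fubini_integral[OF this]
  have "(LBINT x. (LINT y|lebesgue. ?h y x)) = (LINT y|lebesgue. (LBINT x. ?h y x))" .
  also have "(\<lambda>y. LBINT x. ?h y x) = (\<lambda>y. f y * smooth n v y)"
    by (simp only: integral_mult_right_zero)
  also have "(\<lambda>x. LINT y|lebesgue. ?h y x) = (\<lambda>x. v x * damped_inverse (narrow_width n) f x)"
  proof
    fix x
    have "(LINT y|lebesgue. ?h y x) = (LINT y|lebesgue. v x * (f y * of_real (?k (x - y))))"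
      by (simp only: mult_ac normal_density_swap[of _ x])
    also have "\<dots> = v x * (LINT y|lebesgue. f y * of_real (?k (x - y)))"
      by (simp only: integral_mult_right_zero)
    finally show "(LINT y|lebesgue. ?h y x) = v x * damped_inverse (narrow_width n) f x"
      using gaussian_summation[OF f, of "narrow_width n" x] by simp
  qed
  finally show ?thesis by simp
qed

text \<open>An integrable function with integrable transform is tested against the indicators of intervals.
  Smoothing the indicator and letting the width tend to \<open>0\<close> identifies its integrals with those of
  the inverse transform.\<close>

theorem fourier_inversion:
  assumes f: "integrable lebesgue f" and Ff: "integrable lborel (fourier f)"
  shows "AE x in lebesgue. f x = fourier (fourier f) (- x)"
proof -
  have Fm [measurable]: "fourier f \<in> borel_measurable borel"
    by (rule measurable_fourier[OF f])
  have Fl: "integrable lebesgue (fourier f)"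
    using Ff by (simp add: integrable_lebesgue_iff)
  define g where "g x = fourier (fourier f) (- x)" for x
  have contg: "continuous_on UNIV g"
    unfolding g_def by (intro continuous_on_compose2[OF continuous_fourier[OF Fl]] continuous_intros) auto
  have gm [measurable]: "g \<in> borel_measurable borel"
    using contg by (intro borel_measurable_continuous_onI)
  have g_eq: "g x = (LBINT w. fourier f w * wave (w * x))" for x
  proof -
    have "g x = (LINT w|lebesgue. fourier f w * wave (w * x))"
      unfolding g_def fourier_wave[of "fourier f"] by (simp add: mult.commute)
    then show ?thesis
      by (simp add: integral_lebesgue_eq)
  qed
  define B where "B = (LBINT w. cmod (fourier f w))"
  let ?s = narrow_width
  have intervals: "(LINT x|lebesgue. indicat_real {a..b} x *\<^sub>R f x) = (LBINT x. indicat_real {a..b} x *\<^sub>R g x)" for a b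
  proof -
    let ?v = "\<lambda>x. complex_of_real (indicat_real {a..b} x)"
    have vm: "?v \<in> borel_measurable borel"
      by measurable
    have v1: "cmod (?v x) \<le> 1" for x
      by (simp add: indicator_def)
    have "(\<lambda>n. LINT y|lebesgue. f y * smooth n ?v y) \<longlonglongrightarrow> (LINT y|lebesgue. f y * ?v y)"
    proof (rule integral_dominated_convergence[where w = "\<lambda>y. cmod (f y)"])
      \<comment> \<open>The smoothed indicator converges except at the two jumps.\<close>
      have "finite {a, b}" by simp
      then have "AE y in lebesgue. y \<notin> {a, b}"
        by (intro AE_not_in) (simp add: negligible_finite flip: negligible_iff_null_sets)
      then show "AE y in lebesgue. (\<lambda>n. f y * smooth n ?v y) \<longlonglongrightarrow> f y * ?v y"
      proof eventually_elim
        case (elim y)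
        have "isCont ?v y"
          by (intro continuous_of_real isCont_indicator_interval) (use elim in auto)
        then show ?case
          by (intro tendsto_mult_left smooth_tendsto[OF vm v1])
      qed
      have *: "(\<lambda>y. f y * h y) \<in> borel_measurable lebesgue" if "h \<in> borel_measurable borel" for h
        using borel_measurable_times[OF borel_measurable_integrable[OF f] borel_measurable_imp_lebesgue[OF that]] .
      show "(\<lambda>y. f y * ?v y) \<in> borel_measurable lebesgue"
        by (rule *[OF vm])
      have "smooth n ?v \<in> borel_measurable lborel" for n
        by measurable
      then show "(\<lambda>y. f y * smooth n ?v y) \<in> borel_measurable lebesgue" for n
        by (intro *) simp
      show "integrable lebesgue (\<lambda>y. cmod (f y))"
        using f by simp
      show "AE y in lebesgue. norm (f y * smooth n ?v y) \<le> cmod (f y)" for n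
        unfolding norm_mult by (intro always_eventually allI mult_left_le smooth_le[OF vm v1] norm_ge_zero)
    qed
    moreover have "(\<lambda>n. LBINT x. ?v x * damped_inverse (?s n) f x) \<longlonglongrightarrow> (LBINT x. ?v x * g x)"
    proof (rule integral_dominated_convergence[where w = "\<lambda>x. indicat_real {a..b} x * B"])
      show "integrable lborel (\<lambda>x. indicat_real {a..b} x * B)"
        by (intro integrable_mult_left integrable_real_indicator) (auto simp: emeasure_lborel_Icc_eq)
      show "AE x in lborel. (\<lambda>n. ?v x * damped_inverse (?s n) f x) \<longlonglongrightarrow> ?v x * g x"
      proof (intro always_eventually allI tendsto_mult_left)
        fix x
        show "(\<lambda>n. LBINT w. fourier f w * (of_real (gaussian_cutoff (?s n) w) * wave (w * x))) \<longlonglongrightarrow> g x"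
          unfolding g_eq
        proof (rule integral_dominated_convergence[where w = "\<lambda>w. cmod (fourier f w)"])
          show "AE w in lborel. (\<lambda>n. fourier f w * (of_real (gaussian_cutoff (?s n) w) * wave (w * x))) \<longlonglongrightarrow> fourier f w * wave (w * x)"
          proof (intro always_eventually allI tendsto_mult_left)
            fix w
            have "(\<lambda>n. complex_of_real (gaussian_cutoff (?s n) w)) \<longlonglongrightarrow> of_real 1"
              by (intro tendsto_of_real gaussian_cutoff_tendsto_1)
            from tendsto_mult_right[OF this, of "wave (w * x)"]
            show "(\<lambda>n. of_real (gaussian_cutoff (?s n) w) * wave (w * x)) \<longlonglongrightarrow> wave (w * x)"
              by simp
          qed
        qed (use Ff gaussian_cutoff_le_1 gaussian_cutoff_pos in \<open>auto simp: norm_mult less_imp_le intro!: mult_left_le\<close>)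
      qed
      show "AE x in lborel. norm (?v x * damped_inverse (?s n) f x) \<le> indicat_real {a..b} x * B" for n
      proof (intro always_eventually allI)
        fix x
        have "cmod (damped_inverse (?s n) f x) \<le> B"
          unfolding B_def
        proof (rule order.trans[OF integral_norm_bound integral_mono'])
          show "integrable lborel (\<lambda>w. cmod (fourier f w))"
            using Ff by simp
        qed (use gaussian_cutoff_le_1 gaussian_cutoff_pos in \<open>auto simp: norm_mult less_imp_le intro!: mult_left_le\<close>)
        then show "norm (?v x * damped_inverse (?s n) f x) \<le> indicat_real {a..b} x * B"
          by (simp add: norm_mult mult_left_mono)
      qed
    qed measurable
    ultimately have "(LINT y|lebesgue. f y * ?v y) = (LBINT x. ?v x * g x)"
      unfolding integral_smooth_eq_damped_inverse[OF f vm v1] by (rule LIMSEQ_unique)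
    then show ?thesis
      by (simp add: scaleR_conv_of_real mult.commute)
  qed
  \<comment> \<open>So far \<open>g\<close> is only known to be locally integrable, so the comparison is made on bounded intervals.\<close>
  have local: "AE x in lebesgue. x \<in> {- real N..real N} \<longrightarrow> f x = g x" for N
  proof -
    let ?I = "{- real N..real N}"
    let ?d = "\<lambda>x. indicat_real ?I x *\<^sub>R f x - indicat_real ?I x *\<^sub>R g x"
    have if1: "integrable lebesgue (\<lambda>x. indicat_real {a..b} x *\<^sub>R f x)" for a b
      by (intro integrable_mult_indicator f) simp
    have ig1: "integrable lebesgue (\<lambda>x. indicat_real {a..b} x *\<^sub>R g x)" for a b
    proof -
      have "integrable lborel (\<lambda>x. indicat_real {a..b} x *\<^sub>R g x)"
        by (rule borel_integrable_compact) (use contg in \<open>auto intro: continuous_on_subset\<close>)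
      then show ?thesis
        by (subst integrable_lebesgue_iff) auto
    qed
    have "AE x in lebesgue. ?d x = 0"
    proof (rule AE_zero_if_interval_integrals_zero)
      show "integrable lebesgue ?d"
        by (intro Bochner_Integration.integrable_diff if1 ig1)
      fix a b
      let ?a = "max a (- real N)" and ?b = "min b (real N)"
      have "(LINT x|lebesgue. indicat_real {a..b} x *\<^sub>R ?d x)
          = (LINT x|lebesgue. indicat_real {?a..?b} x *\<^sub>R f x - indicat_real {?a..?b} x *\<^sub>R g x)"
        by (rule Bochner_Integration.integral_cong) (auto simp: indicator_def)
      also have "\<dots> = (LINT x|lebesgue. indicat_real {?a..?b} x *\<^sub>R f x) - (LINT x|lebesgue. indicat_real {?a..?b} x *\<^sub>R g x)"
        by (intro Bochner_Integration.integral_diff if1 ig1)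
      also have "(LINT x|lebesgue. indicat_real {?a..?b} x *\<^sub>R g x) = (LBINT x. indicat_real {?a..?b} x *\<^sub>R g x)"
        by (rule integral_lebesgue_eq) measurable
      finally show "(LINT x|lebesgue. indicat_real {a..b} x *\<^sub>R ?d x) = 0"
        by (simp add: intervals)
    qed
    then show ?thesis
      by eventually_elim (auto simp: indicator_def split: if_splits)
  qed
  then have "AE x in lebesgue. \<forall>N. x \<in> {- real N..real N} \<longrightarrow> f x = g x"
    unfolding AE_all_countable by blast
  then show ?thesis
  proof eventually_elim
    case (elim x)
    obtain N where "\<bar>x\<bar> \<le> real N"
      using real_arch_simple by blast
    then have "x \<in> {- real N..real N}"
      by (simp add: abs_le_iff)
    then have "f x = g x"
      using elim by blast
    then show ?case
      by (simp only: g_def)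
  qed
qed

section \<open>Periodization\<close>

lemma nn_integral_periodize:
  fixes f :: "real \<Rightarrow> ennreal"
  assumes f [measurable]: "f \<in> borel_measurable borel" and p: "0 < p"
  shows "(\<integral>\<^sup>+x. f x \<partial>lborel) = (\<Sum>\<^sub>\<infinity>k. \<integral>\<^sup>+x\<in>{0..<p}. f (x + of_int k * p) \<partial>lborel)"
proof -
  have "(\<integral>\<^sup>+x. f x \<partial>lborel) = (\<integral>\<^sup>+x. (\<integral>\<^sup>+k. f x * indicator {of_int k * p..<of_int (k + 1) * p} x \<partial>count_space UNIV) \<partial>lborel)"
  proof (rule nn_integral_cong)
    fix x
    let ?k = "\<lfloor>x / p\<rfloor>"
    have "x \<in> {of_int k * p..<of_int (k + 1) * p} \<longleftrightarrow> k = ?k" for k :: int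
    proof -
      have "x \<in> {of_int k * p..<of_int (k + 1) * p} \<longleftrightarrow> of_int k \<le> x / p \<and> x / p < of_int k + 1"
        using p by (simp add: pos_le_divide_eq pos_divide_less_eq)
      also have "\<dots> \<longleftrightarrow> k = ?k"
        using floor_eq_iff[of "x / p" k] by (simp add: eq_commute)
      finally show ?thesis .
    qed
    then have "f x * indicator {of_int k * p..<of_int (k + 1) * p} x = f x * indicator {?k} k" for k :: int
      by (simp only: indicator_def singleton_iff)
    then show "f x = (\<integral>\<^sup>+k. f x * indicator {of_int k * p..<of_int (k + 1) * p} x \<partial>count_space UNIV)"
      by (simp add: nn_integral_cmult)
  qed
  also have "\<dots> = (\<integral>\<^sup>+k. (\<integral>\<^sup>+x. f x * indicator {of_int k * p..<of_int (k + 1) * p} x \<partial>lborel) \<partial>count_space UNIV)"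
    by (rule nn_integral_count_space_nn_integral) auto
  also have "\<dots> = (\<integral>\<^sup>+k. (\<integral>\<^sup>+x\<in>{0..<p}. f (x + of_int k * p) \<partial>lborel) \<partial>count_space UNIV)"
  proof (rule nn_integral_cong)
    fix k :: int
    have "(\<integral>\<^sup>+x. f x * indicator {of_int k * p..<of_int (k + 1) * p} x \<partial>lborel)
        = ennreal \<bar>1\<bar> * (\<integral>\<^sup>+x. f (of_int k * p + 1 * x) * indicator {of_int k * p..<of_int (k + 1) * p} (of_int k * p + 1 * x) \<partial>lborel)"
      by (rule nn_integral_real_affine) auto
    also have "\<dots> = (\<integral>\<^sup>+x\<in>{0..<p}. f (x + of_int k * p) \<partial>lborel)"
      by (auto intro!: nn_integral_cong simp: indicator_def algebra_simps)
    finally show "(\<integral>\<^sup>+x. f x * indicator {of_int k * p..<of_int (k + 1) * p} x \<partial>lborel)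
        = (\<integral>\<^sup>+x\<in>{0..<p}. f (x + of_int k * p) \<partial>lborel)" .
  qed
  finally show ?thesis
    by (simp add: infsum_ennreal_eq_nn_integral)
qed

lemma nn_integral_infsum:
  fixes f :: "'i :: countable \<Rightarrow> 'a \<Rightarrow> ennreal"
  assumes "\<And>k. f k \<in> borel_measurable M"
  shows "(\<integral>\<^sup>+x. (\<Sum>\<^sub>\<infinity>k. f k x) \<partial>M) = (\<Sum>\<^sub>\<infinity>k. \<integral>\<^sup>+x. f k x \<partial>M)"
  using nn_integral_count_space_nn_integral[of UNIV f M] assms
  by (simp add: infsum_ennreal_eq_nn_integral)

lemma borel_measurable_infsum:
  fixes f :: "'i :: countable \<Rightarrow> 'a \<Rightarrow> ennreal"
  assumes "\<And>k. f k \<in> borel_measurable M"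
  shows "(\<lambda>x. \<Sum>\<^sub>\<infinity>k. f k x) \<in> borel_measurable M"
proof -
  interpret sigma_finite_measure "count_space (UNIV :: 'i set)"
    by (rule sigma_finite_measure_count_space)
  have "(\<lambda>(x, k). f k x) \<in> borel_measurable (M \<Otimes>\<^sub>M count_space UNIV)"
    unfolding case_prod_beta
  proof (rule measurable_compose_countable)
    show "(\<lambda>z. f k (fst z)) \<in> borel_measurable (M \<Otimes>\<^sub>M count_space UNIV)" for k
      using assms by (rule measurable_compose[OF measurable_fst])
  qed measurable
  then have "(\<lambda>x. \<integral>\<^sup>+k. f k x \<partial>count_space UNIV) \<in> borel_measurable M"
    by (rule borel_measurable_nn_integral)
  then show ?thesis
    by (simp add: infsum_ennreal_eq_nn_integral)
qed

section \<open>The Parseval identity for continuous periodic functions\<close>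

lemma wave_int_eq_1: "wave (of_int k) = 1"
proof -
  have "wave (of_int k) = cis (2 * pi * of_int k)"
    by (simp add: wave_iexp cis_conv_exp)
  then show ?thesis
    by (simp add: cis_multiple_2pi)
qed

definition harmonic :: "real \<Rightarrow> int \<Rightarrow> real \<Rightarrow> complex" where
  "harmonic h m x = wave (x * (of_int m / h))"

lemma continuous_on_harmonic [continuous_intros]: "continuous_on S (harmonic h m)"
  unfolding harmonic_def by (intro continuous_intros)

lemma norm_harmonic [simp]: "cmod (harmonic h m x) = 1"
  by (simp add: harmonic_def)

lemma harmonic_0 [simp]: "harmonic h 0 = (\<lambda>_. 1)"
  by (simp add: harmonic_def fun_eq_iff)

lemma harmonic_mult: "harmonic h m x * harmonic h n x = harmonic h (m + n) x"
  by (simp add: harmonic_def add_divide_distrib distrib_left wave_add)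

lemma cnj_harmonic: "cnj (harmonic h m x) = harmonic h (- m) x"
  by (simp add: harmonic_def cnj_wave)

lemma harmonic_plus_period: "0 < h \<Longrightarrow> harmonic h m (x + of_int k * h) = harmonic h m x"
proof -
  assume "0 < h"
  then have "(x + of_int k * h) * (of_int m / h) = x * (of_int m / h) + of_int (m * k)"
    by (simp add: field_simps)
  then show ?thesis
    unfolding harmonic_def by (simp only: wave_add wave_int_eq_1 mult_1_right)
qed

lemma integral_harmonic:
  assumes h: "0 < h"
  shows "integral {0..h} (harmonic h m) = (if m = 0 then of_real h else 0)"
proof (cases "m = 0")
  case True
  then show ?thesis
    using h by (simp add: scaleR_conv_of_real)
next
  case False
  \<comment> \<open>The harmonic is \<open>exp (c x)\<close>, with periodic antiderivative \<open>exp (c x) / c\<close>.\<close>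
  define c where "c = 2 * of_real pi * \<i> * of_real (of_int m / h)"
  have c: "c \<noteq> 0"
    using False h by (simp add: c_def)
  have "((\<lambda>x. harmonic h m x / c) has_vector_derivative harmonic h m x) (at x within {0..h})" for x
  proof -
    have "((\<lambda>t. wave (t * (of_int m / h)) / c) has_vector_derivative
        (2 * of_real pi * \<i> * of_real (of_int m / h) * wave (x * (of_int m / h))) / c) (at x within {0..h})"
      by (intro has_vector_derivative_divide wave_has_vector_derivative)
    then show ?thesis
      using c unfolding c_def[symmetric] harmonic_def[abs_def] by simp
  qed
  then have "(harmonic h m has_integral (harmonic h m h / c - harmonic h m 0 / c)) {0..h}"
    using h by (intro fundamental_theorem_of_calculus) auto
  moreover have "harmonic h m h = harmonic h m 0"
    using harmonic_plus_period[OF h, of m 0 1] by simp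
  ultimately show ?thesis
    using False by (simp add: integral_unique)
qed

definition trig_poly :: "real \<Rightarrow> int set \<Rightarrow> (int \<Rightarrow> complex) \<Rightarrow> real \<Rightarrow> complex" where
  "trig_poly h S p x = (\<Sum>m\<in>S. p m * harmonic h m x)"

lemma continuous_on_trig_poly [continuous_intros]: "continuous_on A (trig_poly h S p)"
  unfolding trig_poly_def by (intro continuous_intros)

definition fourier_coeff :: "real \<Rightarrow> (real \<Rightarrow> complex) \<Rightarrow> int \<Rightarrow> complex" where
  "fourier_coeff h H m = integral {0..h} (\<lambda>x. H x * harmonic h (- m) x)"

text \<open>Completing the square. For \<open>H = 0\<close> this is the orthogonality of the harmonics, for the Fourier
  partial sum it is Bessel's inequality, and in general it says that no trigonometric polynomial with
  frequencies in \<open>S\<close> is closer to \<open>H\<close> than the partial sum. Over the complex numbers the cross terms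
  need not be split into real and imaginary parts.\<close>

lemma mean_square_distance:
  assumes h: "0 < h" and H: "continuous_on {0..h} H" and S: "finite S"
  shows "of_real (integral {0..h} (\<lambda>x. (cmod (H x - trig_poly h S p x))\<^sup>2))
       = of_real (integral {0..h} (\<lambda>x. (cmod (H x))\<^sup>2))
         - of_real (1 / h) * (\<Sum>m\<in>S. of_real ((cmod (fourier_coeff h H m))\<^sup>2))
         + of_real (1 / h) * (\<Sum>m\<in>S. complex_of_real ((cmod (fourier_coeff h H m - of_real h * p m))\<^sup>2))"
proof -
  let ?P = "trig_poly h S p" and ?a = "fourier_coeff h H"
  note [continuous_intros] = H
  have real: "of_real (integral {0..h} (\<lambda>x. (cmod (F x))\<^sup>2)) = integral {0..h} (\<lambda>x. F x * cnj (F x))"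
    if "continuous_on {0..h} F" for F
  proof -
    have "(\<lambda>x. (cmod (F x))\<^sup>2) integrable_on {0..h}"
      using that by (intro integrable_continuous_interval continuous_intros)
    from has_integral_of_real[OF integrable_integral[OF this]]
    have "((\<lambda>x. complex_of_real ((cmod (F x))\<^sup>2)) has_integral of_real (integral {0..h} (\<lambda>x. (cmod (F x))\<^sup>2))) {0..h}"
      by (simp add: o_def)
    then show ?thesis
      unfolding complex_norm_square[of "F _"] by (simp add: integral_unique complex_norm_square del: of_real_power)
  qed
  have cross: "integral {0..h} (\<lambda>x. H x * cnj (?P x)) = (\<Sum>m\<in>S. cnj (p m) * ?a m)"
  proof -
    have "(\<lambda>x. H x * cnj (?P x)) = (\<lambda>x. \<Sum>m\<in>S. cnj (p m) * (H x * harmonic h (- m) x))"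
      by (simp add: trig_poly_def cnj_sum cnj_harmonic sum_distrib_left mult_ac fun_eq_iff)
    moreover have "(\<lambda>x. cnj (p m) * (H x * harmonic h (- m) x)) integrable_on {0..h}" for m
      by (intro integrable_continuous_interval continuous_intros)
    ultimately show ?thesis
      by (simp add: integral_sum[OF S] fourier_coeff_def)
  qed
  have cross': "integral {0..h} (\<lambda>x. ?P x * cnj (H x)) = (\<Sum>m\<in>S. p m * cnj (?a m))"
  proof -
    have "integral {0..h} (\<lambda>x. ?P x * cnj (H x)) = integral {0..h} (\<lambda>x. cnj (H x * cnj (?P x)))"
      by (simp add: mult.commute)
    also have "\<dots> = cnj (integral {0..h} (\<lambda>x. H x * cnj (?P x)))"
      by (rule Henstock_Kurzweil_Integration.integral_cnj[symmetric])
    finally show ?thesis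
      by (simp add: cross cnj_sum)
  qed
  have diag: "integral {0..h} (\<lambda>x. ?P x * cnj (?P x)) = of_real h * (\<Sum>m\<in>S. p m * cnj (p m))"
  proof -
    have "(\<lambda>x. ?P x * cnj (?P x)) = (\<lambda>x. \<Sum>m\<in>S. \<Sum>n\<in>S. p m * cnj (p n) * harmonic h (m - n) x)"
    proof
      fix x
      have "p m * harmonic h m x * (cnj (p n) * harmonic h (- n) x) = p m * cnj (p n) * harmonic h (m - n) x" for m n
        using harmonic_mult[of h m x "- n"] by (simp add: mult_ac)
      then show "?P x * cnj (?P x) = (\<Sum>m\<in>S. \<Sum>n\<in>S. p m * cnj (p n) * harmonic h (m - n) x)"
        by (simp only: trig_poly_def cnj_sum complex_cnj_mult cnj_harmonic sum_product)
    qed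
    moreover have "(\<lambda>x. p m * cnj (p n) * harmonic h (m - n) x) integrable_on {0..h}"
      "(\<lambda>x. \<Sum>n\<in>S. p m * cnj (p n) * harmonic h (m - n) x) integrable_on {0..h}" for m n
      by (intro integrable_continuous_interval continuous_intros)+
    ultimately have "integral {0..h} (\<lambda>x. ?P x * cnj (?P x))
        = (\<Sum>m\<in>S. \<Sum>n\<in>S. p m * cnj (p n) * integral {0..h} (harmonic h (m - n)))"
      by (simp add: integral_sum[OF S])
    also have "\<dots> = (\<Sum>m\<in>S. \<Sum>n\<in>S. if n = m then of_real h * (p m * cnj (p m)) else 0)"
      by (intro sum.cong refl) (auto simp: integral_harmonic[OF h])
    also have "\<dots> = of_real h * (\<Sum>m\<in>S. p m * cnj (p m))"
      using S by (simp add: sum_distrib_left)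
    finally show ?thesis .
  qed
  have "integral {0..h} (\<lambda>x. (H x - ?P x) * cnj (H x - ?P x))
      = integral {0..h} (\<lambda>x. (H x * cnj (H x) - H x * cnj (?P x)) - (?P x * cnj (H x) - ?P x * cnj (?P x)))"
    by (simp add: algebra_simps)
  also have "\<dots> = integral {0..h} (\<lambda>x. H x * cnj (H x)) - integral {0..h} (\<lambda>x. H x * cnj (?P x))
      - (integral {0..h} (\<lambda>x. ?P x * cnj (H x)) - integral {0..h} (\<lambda>x. ?P x * cnj (?P x)))"
    by (subst Henstock_Kurzweil_Integration.integral_diff;
        (intro integrable_continuous_interval continuous_intros)?)+ (rule refl)
  also have "\<dots> = integral {0..h} (\<lambda>x. H x * cnj (H x))
      - (\<Sum>m\<in>S. cnj (p m) * ?a m + p m * cnj (?a m) - of_real h * (p m * cnj (p m)))"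
    by (simp add: cross cross' diag sum.distrib sum_subtractf sum_distrib_left)
  also have "(\<Sum>m\<in>S. cnj (p m) * ?a m + p m * cnj (?a m) - of_real h * (p m * cnj (p m)))
      = (\<Sum>m\<in>S. of_real (1 / h) * (?a m * cnj (?a m))
            - of_real (1 / h) * ((?a m - of_real h * p m) * cnj (?a m - of_real h * p m)))"
    using h by (intro sum.cong refl) (simp add: field_simps)
  finally show ?thesis
    unfolding real[OF H] real[OF continuous_on_diff[OF H continuous_on_trig_poly]]
    by (simp add: complex_norm_square sum_subtractf sum_distrib_left del: of_real_power)
qed

lemma integral_trig_poly_square:
  assumes h: "0 < h" and S: "finite S"
  shows "integral {0..h} (\<lambda>x. (cmod (trig_poly h S p x))\<^sup>2) = h * (\<Sum>m\<in>S. (cmod (p m))\<^sup>2)"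
proof -
  have "complex_of_real (integral {0..h} (\<lambda>x. (cmod (0 - trig_poly h S p x))\<^sup>2))
     = of_real (1 / h) * (\<Sum>m\<in>S. complex_of_real ((cmod (of_real h * p m))\<^sup>2))"
    using mean_square_distance[OF h continuous_on_const S, of 0 p] by (simp add: fourier_coeff_def)
  also have "\<dots> = of_real (h * (\<Sum>m\<in>S. (cmod (p m))\<^sup>2))"
    using h by (simp add: norm_mult power_mult_distrib power2_eq_square sum_distrib_left mult_ac)
  finally show ?thesis
    unfolding of_real_eq_iff by simp
qed

lemma trig_poly_add:
  assumes "finite S" "finite T"
  shows "\<exists>q. \<forall>x. trig_poly h S p x + trig_poly h T r x = trig_poly h (S \<union> T) q x"
proof (intro exI allI)
  fix x
  have "trig_poly h S p x = (\<Sum>m\<in>S \<union> T. (if m \<in> S then p m else 0) * harmonic h m x)"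
    unfolding trig_poly_def by (intro sum.mono_neutral_cong_left) (use assms in auto)
  moreover have "trig_poly h T r x = (\<Sum>m\<in>S \<union> T. (if m \<in> T then r m else 0) * harmonic h m x)"
    unfolding trig_poly_def by (intro sum.mono_neutral_cong_left) (use assms in auto)
  ultimately show "trig_poly h S p x + trig_poly h T r x
      = trig_poly h (S \<union> T) (\<lambda>m. (if m \<in> S then p m else 0) + (if m \<in> T then r m else 0)) x"
    unfolding trig_poly_def by (simp add: algebra_simps flip: sum.distrib)
qed

definition is_trig_poly :: "real \<Rightarrow> (real \<Rightarrow> complex) \<Rightarrow> bool" where
  "is_trig_poly h f \<longleftrightarrow> (\<exists>S p. finite S \<and> f = trig_poly h S p)"

lemma is_trig_poly_harmonic: "is_trig_poly h (\<lambda>x. c * harmonic h m x)"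
  unfolding is_trig_poly_def
  by (intro exI[of _ "{m}"] exI[of _ "\<lambda>_. c"]) (simp add: trig_poly_def fun_eq_iff)

lemma is_trig_poly_add:
  assumes "is_trig_poly h f" "is_trig_poly h g"
  shows "is_trig_poly h (\<lambda>x. f x + g x)"
proof -
  obtain S p T r where *: "finite S" "f = trig_poly h S p" "finite T" "g = trig_poly h T r"
    using assms unfolding is_trig_poly_def by blast
  obtain q where "\<forall>x. trig_poly h S p x + trig_poly h T r x = trig_poly h (S \<union> T) q x"
    using trig_poly_add[OF *(1,3)] by blast
  then show ?thesis
    unfolding is_trig_poly_def using *
    by (intro exI[of _ "S \<union> T"] exI[of _ q]) (simp add: fun_eq_iff)
qed

lemma is_trig_poly_sum:
  "finite A \<Longrightarrow> (\<And>a. a \<in> A \<Longrightarrow> is_trig_poly h (f a)) \<Longrightarrow> is_trig_poly h (\<lambda>x. \<Sum>a\<in>A. f a x)"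
proof (induction A rule: finite_induct)
  case empty
  show ?case
    using is_trig_poly_harmonic[of h 0 0] by simp
next
  case (insert a A)
  then show ?case
    using is_trig_poly_add[of h "f a" "\<lambda>x. \<Sum>a\<in>A. f a x"] by simp
qed

lemma is_trig_poly_mult:
  assumes "is_trig_poly h f" "is_trig_poly h g"
  shows "is_trig_poly h (\<lambda>x. f x * g x)"
proof -
  obtain S p T r where *: "finite S" "f = trig_poly h S p" "finite T" "g = trig_poly h T r"
    using assms unfolding is_trig_poly_def by blast
  have "f x * g x = (\<Sum>m\<in>S. \<Sum>n\<in>T. (p m * r n) * harmonic h (m + n) x)" for x
    unfolding * trig_poly_def sum_product harmonic_mult[symmetric] by (simp add: mult_ac)
  moreover have "is_trig_poly h (\<lambda>x. \<Sum>m\<in>S. \<Sum>n\<in>T. (p m * r n) * harmonic h (m + n) x)"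
    by (intro is_trig_poly_sum * is_trig_poly_harmonic)
  ultimately show ?thesis
    by presburger
qed

lemma is_trig_poly_polynomial:
  assumes "real_polynomial_function q"
  shows "is_trig_poly h (\<lambda>x. of_real (q (harmonic h 1 x)))"
  using assms
proof (induction q rule: real_polynomial_function.induct)
  case (linear f)
  define a b where "a = complex_of_real (f 1)" and "b = complex_of_real (f \<i>)"
  have eq: "complex_of_real (f z) = (a - \<i> * b) / 2 * z + (a + \<i> * b) / 2 * cnj z" for z
  proof -
    have "z = Re z *\<^sub>R 1 + Im z *\<^sub>R \<i>"
      by (simp add: complex_eq_iff)
    then have "f z = f (Re z *\<^sub>R 1 + Im z *\<^sub>R \<i>)"
      by (rule arg_cong)
    then have "f z = Re z * f 1 + Im z * f \<i>"
      using linear_add[OF bounded_linear.linear[OF linear]] linear_scale[OF bounded_linear.linear[OF linear]] by simp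
    then show ?thesis
      by (simp add: a_def b_def complex_eq_iff field_simps)
  qed
  have "is_trig_poly h (\<lambda>x. (a - \<i> * b) / 2 * harmonic h 1 x + (a + \<i> * b) / 2 * harmonic h (- 1) x)"
    by (intro is_trig_poly_add is_trig_poly_harmonic)
  then show ?case
    by (simp only: eq cnj_harmonic)
next
  case (const c)
  show ?case
    using is_trig_poly_harmonic[of h "of_real c" 0] by simp
next
  case (add f g)
  then show ?case
    using is_trig_poly_add by simp
next
  case (mult f g)
  then show ?case
    using is_trig_poly_mult by simp
qed

text \<open>Wrapping the interval around the unit circle makes \<open>H\<close> a continuous function on the circle, as the
  circle is a compact quotient of the interval. There the Stone--Weierstrass theorem applies, and
  real polynomials in a point of the circle are trigonometric polynomials.\<close>

lemma trig_poly_uniformly_dense: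
  assumes h: "0 < h" and H: "continuous_on {0..h} H" "H 0 = H h" and e: "0 < e"
  shows "\<exists>f. is_trig_poly h f \<and> (\<forall>x\<in>{0..h}. cmod (H x - f x) < e)"
proof -
  define E where "E = harmonic h 1"
  have E_cis: "E x = cis (2 * pi * x / h)" for x
    by (simp add: E_def harmonic_def wave_iexp cis_conv_exp mult_ac)
  have E_sphere: "E ` {0..h} = sphere 0 1"
  proof
    show "sphere 0 1 \<subseteq> E ` {0..h}"
    proof
      fix z :: complex
      assume "z \<in> sphere 0 1"
      then have "z = cis (Arg2pi z)"
        using Arg2pi_eq[of z] by (simp add: cis_conv_exp)
      moreover have "E (h * Arg2pi z / (2 * pi)) = cis (Arg2pi z)"
        using h by (simp add: E_cis)
      moreover have "h * Arg2pi z / (2 * pi) \<in> {0..h}"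
        using h Arg2pi[of z] by (simp add: divide_simps)
      ultimately show "z \<in> E ` {0..h}"
        by (metis image_eqI)
    qed
  qed (auto simp: E_cis)
  \<comment> \<open>\<open>F\<close> is the function on the circle with \<open>F \<circ> E = H\<close>. At \<open>h\<close> this uses \<open>H 0 = H h\<close>.\<close>
  define F where "F z = H (h * Arg2pi z / (2 * pi))" for z
  have FE: "F (E x) = H x" if x: "x \<in> {0..h}" for x
  proof (cases "x = h")
    case True
    then have "E x = 1"
      using h by (simp add: E_cis)
    then show ?thesis
      using H(2) True Arg2pi_of_real[of 1] by (simp add: F_def)
  next
    case False
    then have "Arg2pi (E x) = 2 * pi * x / h"
      using x h by (intro Arg2pi_unique[of 1]) (auto simp: E_cis cis_conv_exp divide_simps)
    then show ?thesis
      using h by (simp add: F_def)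
  qed
  have "continuous_on (sphere 0 1) F"
    unfolding continuous_on_closed_vimage[OF closed_sphere]
  proof (intro allI impI)
    fix B :: "complex set"
    assume B: "closed B"
    have "F -` B \<inter> sphere 0 1 = E ` (H -` B \<inter> {0..h})"
      using FE unfolding E_sphere[symmetric] by auto
    moreover have "compact (H -` B \<inter> {0..h})"
      using H(1) B continuous_on_closed_vimage[of "{0..h}" H]
      by (metis closed_atLeastAtMost compact_Icc compact_Int_closed inf.right_idem inf_commute)
    then have "compact (E ` (H -` B \<inter> {0..h}))"
      by (rule compact_continuous_image[rotated]) (simp add: E_def continuous_on_harmonic)
    ultimately show "closed (F -` B \<inter> sphere 0 1)"
      by (simp add: compact_imp_closed)
  qed
  then have "continuous_on (sphere 0 1) (\<lambda>z. Re (F z))" "continuous_on (sphere 0 1) (\<lambda>z. Im (F z))"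
    by (auto intro: continuous_intros)
  then obtain q1 q2 where q: "real_polynomial_function q1" "\<And>z. z \<in> sphere 0 1 \<Longrightarrow> \<bar>Re (F z) - q1 z\<bar> < e / 2"
      "real_polynomial_function q2" "\<And>z. z \<in> sphere 0 1 \<Longrightarrow> \<bar>Im (F z) - q2 z\<bar> < e / 2"
    using Stone_Weierstrass_real_polynomial_function[OF compact_sphere] e by (metis half_gt_zero)
  define f where "f x = complex_of_real (q1 (E x)) + \<i> * of_real (q2 (E x))" for x
  show ?thesis
  proof (intro exI conjI ballI)
    have "is_trig_poly h (\<lambda>x. \<i>)"
      using is_trig_poly_harmonic[of h \<i> 0] by simp
    then show "is_trig_poly h f"
      unfolding f_def E_def using q
      by (intro is_trig_poly_add is_trig_poly_mult is_trig_poly_polynomial)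
    fix x
    assume x: "x \<in> {0..h}"
    then have Ex: "E x \<in> sphere 0 1"
      using E_sphere by blast
    have "cmod (H x - f x) \<le> \<bar>Re (H x - f x)\<bar> + \<bar>Im (H x - f x)\<bar>"
      by (rule cmod_le)
    also have "\<dots> < e"
      using q(2,4)[OF Ex] FE[OF x] by (simp add: f_def)
    finally show "cmod (H x - f x) < e" .
  qed
qed

text \<open>One inequality is Bessel's. For the other, the deficit of a partial sum of the series is at most
  the mean square distance from \<open>H\<close> to any trigonometric polynomial with the same frequencies.\<close>

theorem parseval:
  assumes h: "0 < h" and H: "continuous_on {0..h} H" "H 0 = H h"
  shows "(\<Sum>\<^sub>\<infinity>m. sq_norm (fourier_coeff h H m)) = ennreal (h * integral {0..h} (\<lambda>x. (cmod (H x))\<^sup>2))"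
proof (rule antisym)
  let ?a = "\<lambda>m. (cmod (fourier_coeff h H m))\<^sup>2" and ?I = "integral {0..h} (\<lambda>x. (cmod (H x))\<^sup>2)"
  have dist: "integral {0..h} (\<lambda>x. (cmod (H x - trig_poly h S p x))\<^sup>2)
      = ?I - 1 / h * sum ?a S + 1 / h * (\<Sum>m\<in>S. (cmod (fourier_coeff h H m - of_real h * p m))\<^sup>2)" if "finite S" for S p
    using mean_square_distance[OF h H(1) that, of p] unfolding of_real_sum[symmetric] of_real_mult[symmetric] of_real_diff[symmetric] of_real_add[symmetric] of_real_eq_iff .
  have int: "(\<lambda>x. (cmod (H x - trig_poly h S p x))\<^sup>2) integrable_on {0..h}" for S p
    by (intro integrable_continuous_interval continuous_intros H)
  have I0: "0 \<le> ?I"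
    using H(1) by (intro integral_nonneg integrable_continuous_interval continuous_intros) auto
  show "(\<Sum>\<^sub>\<infinity>m. ennreal (?a m)) \<le> ennreal (h * ?I)"
    unfolding nonneg_infsum_complete[OF zero_le]
  proof (intro SUP_least)
    fix S :: "int set"
    assume "S \<in> {F. finite F \<and> F \<subseteq> UNIV}"
    then have S: "finite S" by simp
    have "0 \<le> integral {0..h} (\<lambda>x. (cmod (H x - trig_poly h S (\<lambda>m. fourier_coeff h H m / of_real h) x))\<^sup>2)"
      by (intro Henstock_Kurzweil_Integration.integral_nonneg int) auto
    then have "sum ?a S \<le> h * ?I"
      unfolding dist[OF S] using h by (simp add: field_simps)
    then show "(\<Sum>m\<in>S. ennreal (?a m)) \<le> ennreal (h * ?I)"
      by (simp add: ennreal_leI)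
  qed
  show "ennreal (h * ?I) \<le> (\<Sum>\<^sub>\<infinity>m. ennreal (?a m))"
  proof (rule ennreal_le_epsilon)
    fix e :: real
    assume e: "0 < e"
    obtain S p where S: "finite S" and close: "\<forall>x\<in>{0..h}. cmod (H x - trig_poly h S p x) < sqrt e / h"
      using trig_poly_uniformly_dense[OF h H, of "sqrt e / h"] e h unfolding is_trig_poly_def by auto
    have "?I - 1 / h * sum ?a S \<le> integral {0..h} (\<lambda>x. (cmod (H x - trig_poly h S p x))\<^sup>2)"
      unfolding dist[OF S] using h by (simp add: sum_nonneg)
    also have "\<dots> \<le> integral {0..h} (\<lambda>x. (sqrt e / h)\<^sup>2)"
      using close by (intro integral_le int power_mono) (auto simp: less_imp_le)
    also have "\<dots> = e / h"
      using h e by (simp add: power_divide power2_eq_square)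
    finally have "h * (?I - 1 / h * sum ?a S) \<le> h * (e / h)"
      using h by (intro mult_left_mono) auto
    then have "h * ?I \<le> sum ?a S + e"
      using h by (simp add: right_diff_distrib)
    then have "ennreal (h * ?I) \<le> ennreal (sum ?a S) + ennreal e"
      using e by (simp add: ennreal_leI sum_nonneg flip: ennreal_plus)
    also have "ennreal (sum ?a S) \<le> (\<Sum>\<^sub>\<infinity>m. ennreal (?a m))"
      unfolding nonneg_infsum_complete[OF zero_le] using S
      by (intro SUP_upper2[of S]) (auto simp: sum_nonneg)
    finally show "ennreal (h * ?I) \<le> (\<Sum>\<^sub>\<infinity>m. ennreal (?a m)) + ennreal e"
      by (simp add: add_right_mono)
  qed
qed

section \<open>Sampling inequalities\<close>

text \<open>This integrates the derivative of \<open>u \<cdot> \<bar>F\<bar>\<^sup>2\<close> for a real weight \<open>u\<close>. A solution of the Riccati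
  equation \<open>u' + u\<^sup>2 = - \<omega>\<^sup>2\<close> turns this into Wirtinger's inequality with a boundary term; a linear
  weight gives a Sobolev bound for the boundary value.\<close>

lemma weighted_energy:
  fixes F D :: "real \<Rightarrow> complex" and u u' :: "real \<Rightarrow> real"
  assumes ab: "a \<le> b"
    and F: "\<And>x. (F has_vector_derivative D x) (at x)" and D: "continuous_on UNIV D"
    and u: "\<And>x. x \<in> {a..b} \<Longrightarrow> (u has_vector_derivative u' x) (at x within {a..b})"
    and u': "continuous_on {a..b} u'"
  shows "u b * (cmod (F b))\<^sup>2 - u a * (cmod (F a))\<^sup>2
       \<le> integral {a..b} (\<lambda>x. (u' x + (u x)\<^sup>2) * (cmod (F x))\<^sup>2 + (cmod (D x))\<^sup>2)"
proof -
  have contF: "continuous_on {a..b} F"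
    using F by (intro continuous_at_imp_continuous_on ballI has_vector_derivative_continuous)
  have contu: "continuous_on {a..b} u"
    unfolding continuous_on_eq_continuous_within
    using u by (intro ballI has_vector_derivative_continuous)
  have contD: "continuous_on {a..b} D"
    using D continuous_on_subset by blast
  let ?q' = "\<lambda>x. u x * (F x \<bullet> D x + D x \<bullet> F x) + u' x * (F x \<bullet> F x)"
  have "((\<lambda>x. u x * (F x \<bullet> F x)) has_vector_derivative ?q' x) (at x within {a..b})" if "x \<in> {a..b}" for x
    by (intro has_vector_derivative_mult u that bounded_bilinear.has_vector_derivative[OF bounded_bilinear_inner]
        has_vector_derivative_at_within[OF F])
  then have "(?q' has_integral (u b * (F b \<bullet> F b) - u a * (F a \<bullet> F a))) {a..b}"
    using ab by (intro fundamental_theorem_of_calculus) auto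
  then have "u b * (cmod (F b))\<^sup>2 - u a * (cmod (F a))\<^sup>2 = integral {a..b} ?q'"
    by (simp add: integral_unique power2_norm_eq_inner)
  also have "\<dots> \<le> integral {a..b} (\<lambda>x. (u' x + (u x)\<^sup>2) * (cmod (F x))\<^sup>2 + (cmod (D x))\<^sup>2)"
  proof (rule integral_le)
    show "?q' integrable_on {a..b}"
      "(\<lambda>x. (u' x + (u x)\<^sup>2) * (cmod (F x))\<^sup>2 + (cmod (D x))\<^sup>2) integrable_on {a..b}"
      by (intro integrable_continuous_interval continuous_intros contF contu contD u')+
    fix x
    have "0 \<le> (cmod (u x *\<^sub>R F x - D x))\<^sup>2"
      by simp
    also have "\<dots> = (u x)\<^sup>2 * (cmod (F x))\<^sup>2 + (cmod (D x))\<^sup>2 - u x * (F x \<bullet> D x + D x \<bullet> F x)"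
      unfolding power2_norm_eq_inner
      by (simp add: inner_diff_left inner_diff_right power2_eq_square algebra_simps)
    finally show "?q' x \<le> (u' x + (u x)\<^sup>2) * (cmod (F x))\<^sup>2 + (cmod (D x))\<^sup>2"
      by (simp add: power2_norm_eq_inner algebra_simps)
  qed
  finally show ?thesis .
qed

text \<open>The weight \<open>\<omega> tan (\<omega> (t + a - x))\<close> solves the Riccati equation, vanishes at the far end of the
  interval and is finite at the sampling point because \<open>\<omega> a < \<pi> / 2\<close>.\<close>

lemma one_sided_wirtinger:
  fixes F D :: "real \<Rightarrow> complex"
  assumes F: "\<And>x. (F has_vector_derivative D x) (at x)" and D: "continuous_on UNIV D"
    and a: "0 < a" and \<omega>: "0 < \<omega>" "\<omega> * a < pi / 2"
  shows "\<omega>\<^sup>2 * integral {t..t + a} (\<lambda>x. (cmod (F x))\<^sup>2)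
       \<le> integral {t..t + a} (\<lambda>x. (cmod (D x))\<^sup>2) + \<omega> * tan (\<omega> * a) * (cmod (F t))\<^sup>2"
proof -
  define u where "u x = \<omega> * tan (\<omega> * (t + a - x))" for x
  define u' where "u' x = - \<omega>\<^sup>2 * (1 + (tan (\<omega> * (t + a - x)))\<^sup>2)" for x
  have arg: "0 < cos (\<omega> * (t + a - x))" if "x \<in> {t..t + a}" for x
  proof (rule cos_gt_zero_pi)
    have "\<omega> * (t + a - x) \<le> \<omega> * a"
      using \<omega> that by (intro mult_left_mono) auto
    then show "\<omega> * (t + a - x) < pi / 2"
      using \<omega> by linarith
    have "0 \<le> \<omega> * (t + a - x)"
      using \<omega> that by (intro mult_nonneg_nonneg) auto
    then show "- (pi / 2) < \<omega> * (t + a - x)"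
      using pi_gt_zero by linarith
  qed
  have cosnz: "\<forall>x\<in>{t..t + a}. cos (\<omega> * (t + a - x)) \<noteq> 0"
    using arg by fastforce
  have ric: "u' x + (u x)\<^sup>2 = - \<omega>\<^sup>2" for x
    by (simp add: u_def u'_def power_mult_distrib algebra_simps)
  have contF: "continuous_on {t..t + a} F"
    using F by (intro continuous_at_imp_continuous_on ballI has_vector_derivative_continuous)
  have contD: "continuous_on {t..t + a} D"
    using D continuous_on_subset by blast
  have "u (t + a) * (cmod (F (t + a)))\<^sup>2 - u t * (cmod (F t))\<^sup>2
      \<le> integral {t..t + a} (\<lambda>x. (u' x + (u x)\<^sup>2) * (cmod (F x))\<^sup>2 + (cmod (D x))\<^sup>2)"
  proof (rule weighted_energy[OF _ F D])
    show "(u has_vector_derivative u' x) (at x within {t..t + a})" if "x \<in> {t..t + a}" for x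
    proof -
      have "u' x = \<omega> * (inverse ((cos (\<omega> * (t + a - x)))\<^sup>2) * - \<omega>)"
        unfolding u'_def using tan_sec[of "\<omega> * (t + a - x)"] arg[OF that]
        by (simp add: power_inverse power2_eq_square[of \<omega>])
      moreover have "(u has_real_derivative \<omega> * (inverse ((cos (\<omega> * (t + a - x)))\<^sup>2) * - \<omega>)) (at x)"
        unfolding u_def
      proof (intro DERIV_cmult DERIV_chain2[where f = tan])
        show "(tan has_real_derivative inverse ((cos (\<omega> * (t + a - x)))\<^sup>2)) (at (\<omega> * (t + a - x)))"
          using arg[OF that] by (intro DERIV_tan) simp
        show "((\<lambda>x. \<omega> * (t + a - x)) has_real_derivative - \<omega>) (at x)"
          by (auto intro!: derivative_eq_intros)
      qed
      ultimately have "(u has_real_derivative u' x) (at x)"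
        by simp
      then show ?thesis
        by (simp add: has_real_derivative_iff_has_vector_derivative has_vector_derivative_at_within)
    qed
    show "continuous_on {t..t + a} u'"
    proof -
      have "continuous_on {t..t + a} (\<lambda>x. \<omega> * (t + a - x))"
        by (intro continuous_intros)
      from Transcendental.continuous_on_tan[OF this cosnz] show ?thesis
        unfolding u'_def
        by (rule continuous_on_mult[OF continuous_on_const continuous_on_add[OF continuous_on_const continuous_on_power]])
    qed
  qed (use a in auto)
  also have "(\<lambda>x. (u' x + (u x)\<^sup>2) * (cmod (F x))\<^sup>2 + (cmod (D x))\<^sup>2)
      = (\<lambda>x. (cmod (D x))\<^sup>2 - \<omega>\<^sup>2 * (cmod (F x))\<^sup>2)"
    by (simp add: ric)
  also have "integral {t..t + a} \<dots>
      = integral {t..t + a} (\<lambda>x. (cmod (D x))\<^sup>2) - \<omega>\<^sup>2 * integral {t..t + a} (\<lambda>x. (cmod (F x))\<^sup>2)"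
    by (subst Henstock_Kurzweil_Integration.integral_diff)
       (auto intro!: integrable_continuous_interval continuous_intros contF contD)
  finally show ?thesis
    by (simp add: u_def)
qed

lemma one_sided_sobolev:
  fixes F D :: "real \<Rightarrow> complex"
  assumes F: "\<And>x. (F has_vector_derivative D x) (at x)" and D: "continuous_on UNIV D" and a: "0 < a"
  shows "a * (cmod (F t))\<^sup>2
       \<le> (1 + a\<^sup>2) * integral {t..t + a} (\<lambda>x. (cmod (F x))\<^sup>2) + integral {t..t + a} (\<lambda>x. (cmod (D x))\<^sup>2)"
proof -
  define u where "u x = x - (t + a)" for x
  have contF: "continuous_on {t..t + a} F"
    using F by (intro continuous_at_imp_continuous_on ballI has_vector_derivative_continuous)
  have contD: "continuous_on {t..t + a} D"
    using D continuous_on_subset by blast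
  have "u (t + a) * (cmod (F (t + a)))\<^sup>2 - u t * (cmod (F t))\<^sup>2
      \<le> integral {t..t + a} (\<lambda>x. (1 + (u x)\<^sup>2) * (cmod (F x))\<^sup>2 + (cmod (D x))\<^sup>2)"
    by (rule weighted_energy[OF _ F D])
       (use a in \<open>auto simp: u_def intro!: derivative_eq_intros\<close>)
  also have "\<dots> \<le> integral {t..t + a} (\<lambda>x. (1 + a\<^sup>2) * (cmod (F x))\<^sup>2 + (cmod (D x))\<^sup>2)"
  proof (rule integral_le)
    fix x
    assume "x \<in> {t..t + a}"
    then have "(u x)\<^sup>2 \<le> a\<^sup>2"
      by (intro power2_le_iff_abs_le[THEN iffD2]) (use a in \<open>auto simp: u_def\<close>)
    then show "(1 + (u x)\<^sup>2) * (cmod (F x))\<^sup>2 + (cmod (D x))\<^sup>2 \<le> (1 + a\<^sup>2) * (cmod (F x))\<^sup>2 + (cmod (D x))\<^sup>2"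
      by (intro add_right_mono mult_right_mono) auto
  qed (auto intro!: integrable_continuous_interval continuous_intros contF contD simp: u_def)
  also have "\<dots> = (1 + a\<^sup>2) * integral {t..t + a} (\<lambda>x. (cmod (F x))\<^sup>2) + integral {t..t + a} (\<lambda>x. (cmod (D x))\<^sup>2)"
    by (subst Henstock_Kurzweil_Integration.integral_add)
       (auto intro!: integrable_continuous_interval continuous_intros contF contD)
  finally show ?thesis
    by (simp add: u_def)
qed

lemma integral_symmetric_interval:
  fixes g :: "real \<Rightarrow> real"
  assumes "continuous_on UNIV g" "0 < a"
  shows "integral {t - a..t + a} g = integral {t..t + a} g + integral {- t..- t + a} (\<lambda>x. g (- x))"
proof -
  have "integral {t - a..t + a} g = integral {t - a..t} g + integral {t..t + a} g"
    using assms by (intro Henstock_Kurzweil_Integration.integral_combine[symmetric] integrable_continuous_interval)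
      (auto intro: continuous_on_subset)
  moreover have "integral {- t..- (t - a)} (\<lambda>x. g (- x)) = integral {t - a..t} g"
    by (rule Henstock_Kurzweil_Integration.integral_reflect_real)
  ultimately show ?thesis
    by (simp add: algebra_simps)
qed

lemma two_sided_sampling:
  fixes F D :: "real \<Rightarrow> complex"
  assumes F: "\<And>x. (F has_vector_derivative D x) (at x)" and D: "continuous_on UNIV D" and a: "0 < a"
  shows two_sided_wirtinger: "0 < \<omega> \<Longrightarrow> \<omega> * a < pi / 2 \<Longrightarrow>
       \<omega>\<^sup>2 * integral {t - a..t + a} (\<lambda>x. (cmod (F x))\<^sup>2)
       \<le> integral {t - a..t + a} (\<lambda>x. (cmod (D x))\<^sup>2) + 2 * \<omega> * tan (\<omega> * a) * (cmod (F t))\<^sup>2"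
    and two_sided_sobolev: "2 * a * (cmod (F t))\<^sup>2
       \<le> (1 + a\<^sup>2) * integral {t - a..t + a} (\<lambda>x. (cmod (F x))\<^sup>2) + integral {t - a..t + a} (\<lambda>x. (cmod (D x))\<^sup>2)"
proof -
  have contF: "continuous_on UNIV F"
    using F by (intro continuous_at_imp_continuous_on ballI has_vector_derivative_continuous)
  have F': "((\<lambda>x. F (- x)) has_vector_derivative - D (- x)) (at x)" for x
  proof -
    have "((\<lambda>x. - x) has_vector_derivative (- 1 :: real)) (at x)"
      by (auto intro!: derivative_eq_intros)
    from vector_diff_chain_at[OF this F] show ?thesis
      by (simp add: o_def)
  qed
  have D': "continuous_on UNIV (\<lambda>x. - D (- x))"
    by (intro continuous_intros continuous_on_compose2[OF D]) auto
  have sF: "integral {t - a..t + a} (\<lambda>x. (cmod (F x))\<^sup>2)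
      = integral {t..t + a} (\<lambda>x. (cmod (F x))\<^sup>2) + integral {- t..- t + a} (\<lambda>x. (cmod (F (- x)))\<^sup>2)"
    by (rule integral_symmetric_interval) (intro continuous_intros contF a)+
  have sD: "integral {t - a..t + a} (\<lambda>x. (cmod (D x))\<^sup>2)
      = integral {t..t + a} (\<lambda>x. (cmod (D x))\<^sup>2) + integral {- t..- t + a} (\<lambda>x. (cmod (D (- x)))\<^sup>2)"
    by (rule integral_symmetric_interval) (intro continuous_intros D a)+
  show "\<omega>\<^sup>2 * integral {t - a..t + a} (\<lambda>x. (cmod (F x))\<^sup>2)
       \<le> integral {t - a..t + a} (\<lambda>x. (cmod (D x))\<^sup>2) + 2 * \<omega> * tan (\<omega> * a) * (cmod (F t))\<^sup>2"
    if "0 < \<omega>" "\<omega> * a < pi / 2"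
    using one_sided_wirtinger[OF F D a that, of t] one_sided_wirtinger[OF F' D' a that, of "- t"]
    unfolding sF sD by (simp add: algebra_simps)
  show "2 * a * (cmod (F t))\<^sup>2
       \<le> (1 + a\<^sup>2) * integral {t - a..t + a} (\<lambda>x. (cmod (F x))\<^sup>2) + integral {t - a..t + a} (\<lambda>x. (cmod (D x))\<^sup>2)"
    using one_sided_sobolev[OF F D a, of t] one_sided_sobolev[OF F' D' a, of "- t"]
    unfolding sF sD by (simp add: algebra_simps)
qed

lemma nn_integral_interval:
  fixes g :: "real \<Rightarrow> real"
  assumes g: "continuous_on UNIV g" "\<And>x. 0 \<le> g x" and p: "0 < p"
  shows "(\<integral>\<^sup>+x\<in>{0..<p}. ennreal (g (c + x)) \<partial>lborel) = ennreal (integral {c..c + p} g)"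
proof -
  have [measurable]: "g \<in> borel_measurable borel"
    by (intro borel_measurable_continuous_onI g)
  have "(g has_integral integral {c..c + p} g) {c..c + p}"
    by (intro integrable_integral integrable_continuous_interval continuous_on_subset[OF g(1)]) auto
  then have "ennreal (integral {c..c + p} g) = (\<integral>\<^sup>+x. ennreal (g x) * indicator {c..c + p} x \<partial>lborel)"
    using g(2) by (intro nn_integral_has_integral_lebesgue'[symmetric]) auto
  also have "\<dots> = ennreal \<bar>1\<bar> * (\<integral>\<^sup>+x. ennreal (g (c + 1 * x)) * indicator {c..c + p} (c + 1 * x) \<partial>lborel)"
    by (rule nn_integral_real_affine) auto
  also have "\<dots> = (\<integral>\<^sup>+x. ennreal (g (c + x)) * indicator {c..c + p} (c + x) \<partial>lborel)"
    by simp
  also have "\<dots> = (\<integral>\<^sup>+x. ennreal (g (c + x)) * indicator {0..<p} x \<partial>lborel)"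
  proof (rule nn_integral_cong_AE)
    have "AE x in lborel. x \<noteq> p"
      by (rule AE_lborel_singleton)
    then show "AE x in lborel. ennreal (g (c + x)) * indicator {c..c + p} (c + x) = ennreal (g (c + x)) * indicator {0..<p} x"
      by eventually_elim (auto simp: indicator_def)
  qed
  finally show ?thesis by simp
qed

lemma nn_integral_tiles:
  fixes g :: "real \<Rightarrow> real"
  assumes g: "continuous_on UNIV g" "\<And>x. 0 \<le> g x" and a: "0 < a"
  shows "(\<integral>\<^sup>+x. ennreal (g x) \<partial>lborel)
       = (\<Sum>\<^sub>\<infinity>k. ennreal (integral {x0 + of_int k * (2 * a) - a..x0 + of_int k * (2 * a) + a} g))"
proof -
  have [measurable]: "g \<in> borel_measurable borel"
    by (intro borel_measurable_continuous_onI g)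
  have "(\<integral>\<^sup>+x. ennreal (g x) \<partial>lborel) = ennreal \<bar>1\<bar> * (\<integral>\<^sup>+x. ennreal (g ((x0 - a) + 1 * x)) \<partial>lborel)"
    by (rule nn_integral_real_affine) auto
  also have "\<dots> = (\<integral>\<^sup>+x. ennreal (g ((x0 - a) + x)) \<partial>lborel)"
    by simp
  also have "\<dots> = (\<Sum>\<^sub>\<infinity>k. \<integral>\<^sup>+x\<in>{0..<2 * a}. ennreal (g ((x0 - a) + (x + of_int k * (2 * a)))) \<partial>lborel)"
    by (rule nn_integral_periodize) (use a in auto)
  also have "\<dots> = (\<Sum>\<^sub>\<infinity>k. ennreal (integral {x0 + of_int k * (2 * a) - a..x0 + of_int k * (2 * a) + a} g))"
  proof (rule infsum_cong)
    fix k :: int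
    have "(\<integral>\<^sup>+x\<in>{0..<2 * a}. ennreal (g ((x0 + of_int k * (2 * a) - a) + x)) \<partial>lborel)
        = ennreal (integral {x0 + of_int k * (2 * a) - a..x0 + of_int k * (2 * a) - a + 2 * a} g)"
      by (rule nn_integral_interval[OF g]) (use a in simp)
    then show "(\<integral>\<^sup>+x\<in>{0..<2 * a}. ennreal (g ((x0 - a) + (x + of_int k * (2 * a)))) \<partial>lborel)
        = ennreal (integral {x0 + of_int k * (2 * a) - a..x0 + of_int k * (2 * a) + a} g)"
      by (simp add: algebra_simps)
  qed
  finally show ?thesis .
qed

lemma ennreal_combination_le:
  assumes "u * x \<le> v * y + z" "0 \<le> u" "0 \<le> v" "0 \<le> x" "0 \<le> y" "0 \<le> z"
  shows "ennreal u * ennreal x \<le> ennreal v * ennreal y + ennreal z"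
  using ennreal_leI[OF assms(1)] assms(2-) by (simp add: ennreal_mult ennreal_plus)

text \<open>The intervals of length \<open>2 a\<close> around the sampling points tile the line.\<close>

theorem sampling_inequalities:
  fixes F D :: "real \<Rightarrow> complex"
  assumes F: "\<And>x. (F has_vector_derivative D x) (at x)" and D: "continuous_on UNIV D" and a: "0 < a"
  shows sampling_lower: "0 < \<omega> \<Longrightarrow> \<omega> * a < pi / 2 \<Longrightarrow>
       ennreal (\<omega>\<^sup>2) * energy F
       \<le> ennreal (2 * \<omega> * tan (\<omega> * a)) * (\<Sum>\<^sub>\<infinity>k. sq_norm (F (x0 + of_int k * (2 * a))))
         + energy D"
    and sampling_upper: "ennreal (2 * a) * (\<Sum>\<^sub>\<infinity>k. sq_norm (F (x0 + of_int k * (2 * a))))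
       \<le> ennreal (1 + a\<^sup>2) * energy F
         + energy D"
proof -
  have contF: "continuous_on UNIV F"
    using F by (intro continuous_at_imp_continuous_on ballI has_vector_derivative_continuous)
  have NF: "energy F
      = (\<Sum>\<^sub>\<infinity>k. ennreal (integral {x0 + of_int k * (2 * a) - a..x0 + of_int k * (2 * a) + a} (\<lambda>x. (cmod (F x))\<^sup>2)))"
    by (rule nn_integral_tiles) (auto intro!: continuous_intros contF a)
  have ND: "energy D
      = (\<Sum>\<^sub>\<infinity>k. ennreal (integral {x0 + of_int k * (2 * a) - a..x0 + of_int k * (2 * a) + a} (\<lambda>x. (cmod (D x))\<^sup>2)))"
    by (rule nn_integral_tiles) (auto intro!: continuous_intros D a)
  have nonneg: "0 \<le> integral {s..t} (\<lambda>x. (cmod (F x))\<^sup>2)" "0 \<le> integral {s..t} (\<lambda>x. (cmod (D x))\<^sup>2)" for s t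
    by (intro Henstock_Kurzweil_Integration.integral_nonneg integrable_continuous_interval continuous_intros
        continuous_on_subset[OF contF] continuous_on_subset[OF D]; simp)+
  show "ennreal (\<omega>\<^sup>2) * energy F
       \<le> ennreal (2 * \<omega> * tan (\<omega> * a)) * (\<Sum>\<^sub>\<infinity>k. sq_norm (F (x0 + of_int k * (2 * a))))
         + energy D"
    if \<omega>: "0 < \<omega>" "\<omega> * a < pi / 2"
  proof -
    have "0 < \<omega> * a"
      using \<omega> a by simp
    then have "0 < tan (\<omega> * a)"
      using \<omega> by (intro tan_gt_zero) auto
    moreover have "\<omega>\<^sup>2 * integral {t - a..t + a} (\<lambda>x. (cmod (F x))\<^sup>2)
       \<le> 2 * \<omega> * tan (\<omega> * a) * (cmod (F t))\<^sup>2 + integral {t - a..t + a} (\<lambda>x. (cmod (D x))\<^sup>2)" for t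
      using two_sided_wirtinger[OF F D a \<omega>, of t] by linarith
    ultimately show ?thesis
      unfolding NF ND infsum_ennreal_cmult[symmetric, OF countableI_type] infsum_ennreal_add[symmetric]
      using nonneg \<omega>
      by (intro infsum_mono summable_on_ennreal_fun ennreal_combination_le) auto
  qed
  show "ennreal (2 * a) * (\<Sum>\<^sub>\<infinity>k. sq_norm (F (x0 + of_int k * (2 * a))))
       \<le> ennreal (1 + a\<^sup>2) * energy F
         + energy D"
    unfolding NF ND infsum_ennreal_cmult[symmetric, OF countableI_type] infsum_ennreal_add[symmetric]
    using two_sided_sobolev[OF F D a] nonneg a
    by (intro infsum_mono summable_on_ennreal_fun ennreal_combination_le) auto
qed

section \<open>Sampling in shift-invariant spaces with a Gaussian-dominated generator\<close>

lemma integrable_moment: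
  "integrable lborel (\<lambda>x::real. \<bar>x\<bar> ^ k * exp (- x\<^sup>2 / 2))"
proof -
  have "integrable lborel (\<lambda>x. sqrt (2 * pi) * (std_normal_density x * \<bar>x\<bar> ^ k))"
    by (intro integrable_mult_right integrable_std_normal_moment_abs)
  moreover have "sqrt (2 * pi) * (std_normal_density x * \<bar>x\<bar> ^ k) = \<bar>x\<bar> ^ k * exp (- x\<^sup>2 / 2)" for x :: real
    by (simp add: std_normal_density_def)
  ultimately show ?thesis
    by (simp only:)
qed

lemma abs_le_exp_half_square: "\<bar>x\<bar> * exp (- x\<^sup>2 / 2) \<le> (1::real)"
proof -
  have "0 \<le> (\<bar>x\<bar> - 1)\<^sup>2"
    by simp
  then have "\<bar>x\<bar> \<le> 1 + x\<^sup>2 / 2"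
    by (simp add: power2_eq_square algebra_simps flip: abs_mult)
  also have "\<dots> \<le> exp (x\<^sup>2 / 2)"
    by (rule exp_ge_add_one_self)
  finally show ?thesis
    by (simp add: exp_minus divide_simps)
qed

lemma norm_trig_poly_le: "cmod (trig_poly b L p x) \<le> (\<Sum>l\<in>L. cmod (p l))"
  unfolding trig_poly_def by (rule order.trans[OF norm_sum]) (simp add: norm_mult)

lemma trig_poly_periodic:
  "0 < b \<Longrightarrow> trig_poly b L p (x + of_int k * b) = trig_poly b L p x"
  unfolding trig_poly_def by (simp only: harmonic_plus_period)

lemma nn_integral_trig_poly:
  assumes "0 < b" "finite L"
  shows "(\<integral>\<^sup>+w\<in>{0..<b}. sq_norm (trig_poly b L p w) \<partial>lborel) = ennreal (b * (\<Sum>l\<in>L. (cmod (p l))\<^sup>2))"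
  using nn_integral_interval[of "\<lambda>w. (cmod (trig_poly b L p w))\<^sup>2" b 0] assms
    integral_trig_poly_square[OF assms, of p]
  by (simp add: continuous_on_norm continuous_on_power continuous_on_trig_poly)

text \<open>The polynomial is periodic, so only the weight is periodized.\<close>

lemma nn_integral_weighted_trig_poly:
  assumes b: "0 < b" and v [measurable]: "v \<in> borel_measurable borel"
  shows "(\<integral>\<^sup>+w. v w * sq_norm (trig_poly b L p w) \<partial>lborel)
       = (\<integral>\<^sup>+w\<in>{0..<b}. (\<Sum>\<^sub>\<infinity>l. v (w + of_int l * b)) * sq_norm (trig_poly b L p w) \<partial>lborel)"
proof -
  let ?T = "\<lambda>w. sq_norm (trig_poly b L p w)"
  have [measurable]: "trig_poly b L p \<in> borel_measurable borel"
    by (intro borel_measurable_continuous_onI continuous_intros)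
  have "(\<integral>\<^sup>+w. v w * ?T w \<partial>lborel) = (\<Sum>\<^sub>\<infinity>k. \<integral>\<^sup>+w\<in>{0..<b}. (v (w + of_int k * b) * ?T (w + of_int k * b)) \<partial>lborel)"
    by (rule nn_integral_periodize[OF _ b]) measurable
  also have "\<dots> = (\<integral>\<^sup>+w. (\<Sum>\<^sub>\<infinity>k. (v (w + of_int k * b) * ?T (w + of_int k * b)) * indicator {0..<b} w) \<partial>lborel)"
    by (rule nn_integral_infsum[symmetric]) measurable
  also have "\<dots> = (\<integral>\<^sup>+w\<in>{0..<b}. (\<Sum>\<^sub>\<infinity>l. v (w + of_int l * b)) * ?T w \<partial>lborel)"
  proof (rule nn_integral_cong)
    fix w
    have "(\<Sum>\<^sub>\<infinity>k. (v (w + of_int k * b) * ?T (w + of_int k * b)) * indicator {0..<b} w)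
        = (\<Sum>\<^sub>\<infinity>k. (?T w * indicator {0..<b} w) * v (w + of_int k * b))"
      unfolding trig_poly_periodic[OF b] by (simp add: mult_ac)
    also have "\<dots> = (?T w * indicator {0..<b} w) * (\<Sum>\<^sub>\<infinity>k. v (w + of_int k * b))"
      by (rule infsum_ennreal_cmult) simp
    finally show "(\<Sum>\<^sub>\<infinity>k. (v (w + of_int k * b) * ?T (w + of_int k * b)) * indicator {0..<b} w)
        = (\<Sum>\<^sub>\<infinity>l. v (w + of_int l * b)) * ?T w * indicator {0..<b} w"
      by (simp add: mult_ac)
  qed
  finally show ?thesis .
qed

text \<open>The generator is given by its Fourier transform \<open>u\<close>: its value at \<open>x\<close> is \<open>fourier u (- x)\<close>.\<close>

locale gaussian_window =
  fixes u :: "real \<Rightarrow> complex" and c :: real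
  assumes cont_u: "continuous_on UNIV u"
    and decreasing: "gaussian_decreasing c (\<lambda>x. (cmod (u x))\<^sup>2)"
    and c_ge_1: "1 \<le> c"
begin

abbreviation G :: "real \<Rightarrow> real" where "G x \<equiv> (cmod (u x))\<^sup>2"

lemma measurable_u [measurable]: "u \<in> borel_measurable borel"
  by (intro borel_measurable_continuous_onI cont_u)

lemma G_pos: "0 < G x"
  by (rule gaussian_decreasingD(1)[OF decreasing])

lemma norm_u_le: "cmod (u x) \<le> cmod (u 0) * exp (- x\<^sup>2 / 2)"
proof (rule power2_le_imp_le)
  have "G x \<le> exp (- c * x\<^sup>2) * G 0"
    by (rule gaussian_decreasing_le[OF decreasing])
  also have "\<dots> \<le> exp (- x\<^sup>2) * G 0"
    using c_ge_1 by (intro mult_right_mono) (auto simp: mult_le_cancel_right1)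
  also have "\<dots> = (cmod (u 0) * exp (- x\<^sup>2 / 2))\<^sup>2"
    by (simp add: power_mult_distrib flip: exp_double)
  finally show "G x \<le> (cmod (u 0) * exp (- x\<^sup>2 / 2))\<^sup>2" .
qed simp

text \<open>These are the hypotheses under which Plancherel's identity applies to the transform of such a
  product and to the derivative of that transform.\<close>

lemma modulated:
  assumes C: "continuous_on UNIV C" and P: "\<And>x. cmod (C x) \<le> P"
  defines "f \<equiv> \<lambda>x. u x * C x"
  shows modulated_cont: "continuous_on UNIV f"
    and modulated_integrable: "integrable lborel f"
    and modulated_moment: "integrable lborel (\<lambda>x. of_real x * f x)"
    and modulated_bound: "cmod (f x) \<le> cmod (u 0) * P"
    and modulated_moment_bound: "cmod (of_real x * f x) \<le> cmod (u 0) * P"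
proof -
  have P0: "0 \<le> P"
    using P[of 0] norm_ge_zero order.trans by blast
  have [measurable]: "C \<in> borel_measurable borel"
    by (intro borel_measurable_continuous_onI C)
  show cf: "continuous_on UNIV f"
    unfolding f_def by (intro continuous_intros cont_u C)
  then have [measurable]: "f \<in> borel_measurable borel"
    by (rule borel_measurable_continuous_onI)
  have le: "cmod (f x) \<le> cmod (u 0) * P * exp (- x\<^sup>2 / 2)" for x
  proof -
    have "cmod (f x) \<le> (cmod (u 0) * exp (- x\<^sup>2 / 2)) * P"
      unfolding f_def norm_mult using P0 by (intro mult_mono norm_u_le P) auto
    then show ?thesis
      by (simp add: mult_ac)
  qed
  show "cmod (f x) \<le> cmod (u 0) * P"
    using le[of x] P0 mult_left_le[of "exp (- x\<^sup>2 / 2)" "cmod (u 0) * P"] by auto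
  have le1: "cmod (of_real x * f x) \<le> cmod (u 0) * P * (\<bar>x\<bar> * exp (- x\<^sup>2 / 2))" for x
    using mult_left_mono[OF le[of x], of "\<bar>x\<bar>"] by (simp add: norm_mult mult_ac)
  show "cmod (of_real x * f x) \<le> cmod (u 0) * P"
    using le1[of x] P0 mult_left_le[OF abs_le_exp_half_square[of x], of "cmod (u 0) * P"] by auto
  show "integrable lborel f"
  proof (rule Bochner_Integration.integrable_bound)
    show "integrable lborel (\<lambda>x. cmod (u 0) * P * (\<bar>x\<bar> ^ 0 * exp (- x\<^sup>2 / 2)))"
      by (intro integrable_mult_right integrable_moment)
  qed (use le P0 in auto)
  show "integrable lborel (\<lambda>x. of_real x * f x)"
  proof (rule Bochner_Integration.integrable_bound)
    show "integrable lborel (\<lambda>x. cmod (u 0) * P * (\<bar>x\<bar> ^ 1 * exp (- x\<^sup>2 / 2)))"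
      by (intro integrable_mult_right integrable_moment)
  qed (use le1 P0 in auto)
qed

lemma integrable_u: "integrable lborel u"
  using modulated_integrable[of "\<lambda>_. 1" 1] by simp

lemma integrable_lebesgue_u: "integrable lebesgue u"
  using integrable_u by (simp add: integrable_lebesgue_iff)

abbreviation combination :: "real \<Rightarrow> int set \<Rightarrow> (int \<Rightarrow> complex) \<Rightarrow> real \<Rightarrow> complex" where
  "combination b L p \<equiv> fourier (\<lambda>w. u w * trig_poly b L p w)"

text \<open>A combination of translates of the generator is, on the Fourier side, \<open>u\<close> times a trigonometric
  polynomial.\<close>

lemma fourier_modulated_trig_poly:
  assumes L: "finite L"
  shows "combination b L p y = (\<Sum>l\<in>L. p l * fourier u (y - of_int l / b))"
proof -
  have int: "integrable lebesgue (\<lambda>w. u w * wave (- ((y - of_int l / b) * w)))" for l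
    by (rule integrable_mult_wave[OF integrable_lebesgue_u]) measurable
  have "u w * trig_poly b L p w * wave (- (y * w)) = (\<Sum>l\<in>L. p l * (u w * wave (- ((y - of_int l / b) * w))))" for w
  proof -
    have "harmonic b l w * wave (- (y * w)) = wave (- ((y - of_int l / b) * w))" for l
      unfolding harmonic_def wave_add[symmetric] by (simp add: algebra_simps)
    then show ?thesis
      unfolding trig_poly_def sum_distrib_left sum_distrib_right
      by (intro sum.cong refl) (simp add: mult.assoc mult.left_commute)
  qed
  then have "combination b L p y
      = (LINT w|lebesgue. (\<Sum>l\<in>L. p l * (u w * wave (- ((y - of_int l / b) * w)))))"
    unfolding fourier_wave by simp
  also have "\<dots> = (\<Sum>l\<in>L. LINT w|lebesgue. p l * (u w * wave (- ((y - of_int l / b) * w))))"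
    by (rule Bochner_Integration.integral_sum) (intro integrable_mult_right int)
  also have "\<dots> = (\<Sum>l\<in>L. p l * fourier u (y - of_int l / b))"
    unfolding fourier_wave by (simp only: integral_mult_right_zero)
  finally show ?thesis .
qed

lemma lattice_sum_ge:
  assumes "0 < b" "w \<in> {0..<b}"
  shows "ennreal (G b) \<le> lattice_sum b G w"
proof -
  have "w\<^sup>2 \<le> b\<^sup>2"
    using assms by (intro power_mono) auto
  have "G b \<le> exp (- c * (b\<^sup>2 - w\<^sup>2)) * G w"
    using assms by (intro gaussian_decreasingD(2)[OF decreasing]) auto
  also have "\<dots> \<le> 1 * G w"
    using c_ge_1 \<open>w\<^sup>2 \<le> b\<^sup>2\<close> by (intro mult_right_mono) (auto simp: mult_nonneg_nonneg)
  finally have "ennreal (G b) \<le> ennreal (G (w + of_int 0 * b))"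
    by (simp add: ennreal_leI)
  also have "\<dots> \<le> lattice_sum b G w"
    by (rule term_le_infsum_ennreal) simp
  finally show ?thesis .
qed

abbreviation sampling_bounds :: "real \<Rightarrow> real \<Rightarrow> real \<Rightarrow> real \<Rightarrow> bool" where
  "sampling_bounds A B b \<alpha> \<equiv> (\<forall>L p x0. finite L \<longrightarrow>
     ennreal (A * (\<Sum>l\<in>L. (cmod (p l))\<^sup>2)) \<le> (\<Sum>\<^sub>\<infinity>k. sq_norm (combination b L p (x0 + of_int k * \<alpha>))) \<and>
     (\<Sum>\<^sub>\<infinity>k. sq_norm (combination b L p (x0 + of_int k * \<alpha>))) \<le> ennreal (B * (\<Sum>l\<in>L. (cmod (p l))\<^sup>2)))"

text \<open>The energy of the derivative of a combination is at most \<open>4 \<pi>\<^sup>2 M\<close> times the energy of the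
  combination, because the trigonometric polynomial is constant on cosets. Wirtinger's inequality then
  gives the lower bound as long as the sampling step is below \<open>1 / (2 \<surd>M)\<close>; the upper bound is the Sobolev
  bound for the samples.\<close>

theorem sampling_frame_bounds:
  assumes b: "0 < b" and \<alpha>: "0 < \<alpha>" and M: "0 \<le> M" "2 * \<alpha> * sqrt M < 1"
    and mean: "\<And>w. lattice_sum b (\<lambda>x. x\<^sup>2 * G x) w
        \<le> ennreal M * lattice_sum b G w"
  shows "\<exists>A B. 0 < A \<and> 0 < B \<and> sampling_bounds A B b \<alpha>"
proof -
  define W where "W = enn2real (lattice_mass b)"
  have W: "lattice_mass b = ennreal W" "0 \<le> W"
    using lattice_weight_sum_finite[OF b] by (simp_all add: W_def)
  define a where "a = \<alpha> / 2"
  have a: "0 < a" "2 * a = \<alpha>"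
    using \<alpha> by (simp_all add: a_def)
  \<comment> \<open>Any \<open>\<omega>\<close> strictly between the two bounds will do: below \<open>\<pi> / \<alpha>\<close> for Wirtinger's inequality, above
     \<open>2 \<pi> \<surd>M\<close> to absorb the energy of the derivative.\<close>
  define \<omega> where "\<omega> = (2 * pi * sqrt M + pi / \<alpha>) / 2"
  have gap: "2 * pi * sqrt M < pi / \<alpha>"
    using M(2) \<alpha> mult_strict_left_mono[OF M(2), of "pi / \<alpha>"] by (simp add: field_simps)
  have \<omega>: "0 < \<omega>" "2 * pi * sqrt M < \<omega>" "\<omega> < pi / \<alpha>"
  proof -
    have *: "0 < (r + q) / 2 \<and> r < (r + q) / 2 \<and> (r + q) / 2 < q" if "0 \<le> r" "r < q" for r q :: real
      using that by auto
    show "0 < \<omega>" "2 * pi * sqrt M < \<omega>" "\<omega> < pi / \<alpha>"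
      using *[OF _ gap] M(1) by (simp_all only: \<omega>_def) simp_all
  qed
  have \<omega>a: "\<omega> * a < pi / 2"
    using \<omega>(3) \<alpha> by (simp add: a_def field_simps)
  have \<omega>M: "4 * pi\<^sup>2 * M < \<omega>\<^sup>2"
  proof -
    have "(2 * pi * sqrt M)\<^sup>2 < \<omega>\<^sup>2"
      using \<omega>(2) M(1) by (intro power_strict_mono) auto
    then show ?thesis
      using M(1) by (simp add: power_mult_distrib)
  qed
  define T where "T = 2 * \<omega> * tan (\<omega> * a)"
  have T: "0 < T"
    unfolding T_def using \<omega>(1) \<omega>a a(1) by (intro mult_pos_pos tan_gt_zero) auto
  define A where "A = (\<omega>\<^sup>2 - 4 * pi\<^sup>2 * M) * (G b * b) / T"
  \<comment> \<open>The summand \<open>1\<close> only makes \<open>B\<close> visibly positive.\<close>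
  define B where "B = (1 + a\<^sup>2 + 4 * pi\<^sup>2 * M) * (G 0 * W * b) / \<alpha> + 1"
  have A: "0 < A"
    unfolding A_def using \<omega>M T G_pos[of b] b by (intro divide_pos_pos mult_pos_pos) auto
  have B: "0 < B"
    unfolding B_def using M(1) W(2) b \<alpha> by (intro add_nonneg_pos divide_nonneg_pos mult_nonneg_nonneg) auto
  have "ennreal (A * (\<Sum>l\<in>L. (cmod (p l))\<^sup>2))
       \<le> (\<Sum>\<^sub>\<infinity>k. sq_norm (combination b L p (x0 + of_int k * \<alpha>))) \<and>
     (\<Sum>\<^sub>\<infinity>k. sq_norm (combination b L p (x0 + of_int k * \<alpha>)))
       \<le> ennreal (B * (\<Sum>l\<in>L. (cmod (p l))\<^sup>2))" if L: "finite L" for L p x0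
  proof -
    define f where "f w = u w * trig_poly b L p w" for w
    define P where "P = (\<Sum>l\<in>L. (cmod (p l))\<^sup>2)"
    define S where "S = (\<Sum>\<^sub>\<infinity>k. sq_norm (fourier f (x0 + of_int k * \<alpha>)))"
    define N where "N = energy (fourier f)"
    have P: "0 \<le> P"
      unfolding P_def by (intro sum_nonneg) auto
    note mod = modulated[OF continuous_on_trig_poly[of UNIV b L p] norm_trig_poly_le[of b L p], folded f_def]
    have [measurable]: "f \<in> borel_measurable borel"
      by (intro borel_measurable_continuous_onI mod(1))
    have [measurable]: "trig_poly b L p \<in> borel_measurable borel"
      by (intro borel_measurable_continuous_onI continuous_intros)
    define d where "d x = - 2 * of_real pi * \<i> * of_real x * f x" for x
    have d_eq: "d = (\<lambda>x. (- 2 * of_real pi * \<i>) * (of_real x * f x))"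
      by (simp add: d_def fun_eq_iff)
    have d_int: "integrable lborel d"
      unfolding d_eq by (intro integrable_mult_right mod(3))
    have d_cont: "continuous_on UNIV d"
      unfolding d_def by (intro continuous_intros mod(1))
    have d_bound: "cmod (d x) \<le> 2 * pi * (cmod (u 0) * (\<Sum>l\<in>L. cmod (p l)))" for x
    proof -
      have "cmod (- 2 * of_real pi * \<i>) = 2 * pi"
        by (simp add: norm_mult)
      then show ?thesis
        unfolding d_eq norm_mult[of "- 2 * of_real pi * \<i>"] using mod(5)[of x]
        by (simp only:) (intro mult_left_mono; simp)
    qed
    have f_leb: "integrable lebesgue f" and d_leb: "integrable lebesgue d"
      and xf_leb: "integrable lebesgue (\<lambda>x. of_real x * f x)"
      using mod(2,3) d_int borel_measurable_continuous_onI[OF d_cont] by (simp_all add: integrable_lebesgue_iff)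
    have deriv: "(fourier f has_vector_derivative fourier d x) (at x)" for x
      unfolding d_def by (rule fourier_has_vector_derivative[OF f_leb xf_leb])
    have d_four: "continuous_on UNIV (fourier d)"
      by (rule continuous_fourier[OF d_leb])
    have "N = (\<integral>\<^sup>+w. sq_norm (f w) \<partial>lborel)"
      unfolding N_def by (rule plancherel[OF mod(2,1,4)])
    also have "\<dots> = (\<integral>\<^sup>+w. ennreal (G w) * sq_norm (trig_poly b L p w) \<partial>lborel)"
      by (simp add: f_def norm_mult power_mult_distrib ennreal_mult)
    also have "\<dots> = (\<integral>\<^sup>+w\<in>{0..<b}. lattice_sum b G w * sq_norm (trig_poly b L p w) \<partial>lborel)"
      by (rule nn_integral_weighted_trig_poly[OF b]) measurable
    finally have N_per: "N = (\<integral>\<^sup>+w\<in>{0..<b}. lattice_sum b G w * sq_norm (trig_poly b L p w) \<partial>lborel)" .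
    have "ennreal (G b * (b * P)) = ennreal (G b) * (\<integral>\<^sup>+w\<in>{0..<b}. sq_norm (trig_poly b L p w) \<partial>lborel)"
      unfolding nn_integral_trig_poly[OF b L] P_def[symmetric] using b P by (simp add: ennreal_mult)
    also have "\<dots> = (\<integral>\<^sup>+w\<in>{0..<b}. ennreal (G b) * sq_norm (trig_poly b L p w) \<partial>lborel)"
      by (subst nn_integral_cmult[symmetric]) (auto simp: mult.assoc)
    also have "\<dots> \<le> N"
      unfolding N_per using lattice_sum_ge[OF b]
      by (intro nn_integral_mono) (auto simp: indicator_def intro!: mult_right_mono)
    finally have N_ge: "ennreal (G b * (b * P)) \<le> N" .
    have "N \<le> (\<integral>\<^sup>+w\<in>{0..<b}. ennreal (G 0 * W) * sq_norm (trig_poly b L p w) \<partial>lborel)"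
    proof -
      have "lattice_sum b G w \<le> ennreal (G 0 * W)" for w
        using lattice_sum_le[OF decreasing c_ge_1 b, of w] W by (simp add: ennreal_mult)
      then show ?thesis
        unfolding N_per by (intro nn_integral_mono mult_right_mono) auto
    qed
    also have "\<dots> = ennreal (G 0 * W) * (\<integral>\<^sup>+w\<in>{0..<b}. sq_norm (trig_poly b L p w) \<partial>lborel)"
      by (subst nn_integral_cmult[symmetric]) (auto simp: mult.assoc)
    also have "\<dots> = ennreal (G 0 * W * (b * P))"
      unfolding nn_integral_trig_poly[OF b L] P_def[symmetric] using b P W(2) by (simp add: ennreal_mult)
    finally have N_le: "N \<le> ennreal (G 0 * W * (b * P))" .
    have E_le: "energy (fourier d) \<le> ennreal (4 * pi\<^sup>2 * M) * N"
    proof -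
      have "(\<integral>\<^sup>+w. ennreal (w\<^sup>2 * G w) * sq_norm (trig_poly b L p w) \<partial>lborel)
          = (\<integral>\<^sup>+w\<in>{0..<b}. lattice_sum b (\<lambda>x. x\<^sup>2 * G x) w * sq_norm (trig_poly b L p w) \<partial>lborel)"
        by (rule nn_integral_weighted_trig_poly[OF b]) measurable
      also have "\<dots> \<le> (\<integral>\<^sup>+w. ennreal M * (lattice_sum b G w * sq_norm (trig_poly b L p w) * indicator {0..<b} w) \<partial>lborel)"
        unfolding mult.assoc[symmetric] by (intro nn_integral_mono mult_right_mono mean) auto
      also have "\<dots> = ennreal M * N"
      proof -
        have "(\<lambda>w. ennreal (G (w + of_int l * b))) \<in> borel_measurable lborel" for l
          by measurable
        then have "(\<lambda>w. \<Sum>\<^sub>\<infinity>l. ennreal (G (w + of_int l * b))) \<in> borel_measurable borel"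
          using borel_measurable_infsum[of "\<lambda>l w. ennreal (G (w + of_int l * b))" borel] by simp
        note [measurable] = this
        have "(\<lambda>w. lattice_sum b G w * sq_norm (trig_poly b L p w) * indicator {0..<b} w) \<in> borel_measurable lborel"
          by measurable
        then show ?thesis
          unfolding N_per by (rule nn_integral_cmult)
      qed
      finally have "(\<integral>\<^sup>+w. ennreal (w\<^sup>2 * G w) * sq_norm (trig_poly b L p w) \<partial>lborel) \<le> ennreal M * N" .
      then have "ennreal (4 * pi\<^sup>2) * (\<integral>\<^sup>+w. ennreal (w\<^sup>2 * G w) * sq_norm (trig_poly b L p w) \<partial>lborel) \<le> ennreal (4 * pi\<^sup>2) * (ennreal M * N)"
        by (rule mult_left_mono) simp
      moreover have "energy (fourier d)
          = ennreal (4 * pi\<^sup>2) * (\<integral>\<^sup>+w. ennreal (w\<^sup>2 * G w) * sq_norm (trig_poly b L p w) \<partial>lborel)"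
      proof -
        have "energy (fourier d) = (\<integral>\<^sup>+w. sq_norm (d w) \<partial>lborel)"
          by (rule plancherel[OF d_int d_cont d_bound])
        also have "\<dots> = (\<integral>\<^sup>+w. ennreal (4 * pi\<^sup>2) * (ennreal (w\<^sup>2 * G w) * sq_norm (trig_poly b L p w)) \<partial>lborel)"
          by (rule nn_integral_cong) (simp add: d_def f_def norm_mult power_mult_distrib mult.assoc flip: ennreal_mult)
        also have "\<dots> = ennreal (4 * pi\<^sup>2) * (\<integral>\<^sup>+w. ennreal (w\<^sup>2 * G w) * sq_norm (trig_poly b L p w) \<partial>lborel)"
          by (rule nn_integral_cmult) measurable
        finally show ?thesis .
      qed
      ultimately show ?thesis
        using M(1) by (simp add: ennreal_mult mult.assoc)
    qed
    obtain n where n: "N = ennreal n" "0 \<le> n"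
      using N_le by (cases N) (auto simp: top_unique)
    have n_ge: "G b * (b * P) \<le> n" and n_le: "n \<le> G 0 * W * (b * P)"
      using N_ge N_le n b P W(2) by (simp_all add: ennreal_le_iff)
    have "ennreal (2 * a) * S \<le> ennreal (1 + a\<^sup>2) * N + energy (fourier d)"
      using sampling_upper[OF deriv d_four a(1), of x0] by (simp only: S_def N_def a(2))
    also have "\<dots> \<le> ennreal (1 + a\<^sup>2) * N + ennreal (4 * pi\<^sup>2 * M) * N"
      by (intro add_left_mono E_le)
    also have "\<dots> = ennreal ((1 + a\<^sup>2 + 4 * pi\<^sup>2 * M) * n)"
      using n M(1) by (simp add: distrib_right flip: ennreal_mult ennreal_plus)
    finally have up: "ennreal \<alpha> * S \<le> ennreal ((1 + a\<^sup>2 + 4 * pi\<^sup>2 * M) * n)"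
      by (simp only: a(2))
    then have "S \<noteq> \<top>"
      using \<alpha> by (auto simp: ennreal_mult_top top_unique)
    then obtain s where s: "S = ennreal s" "0 \<le> s"
      by (cases S) auto
    have "\<alpha> * s \<le> (1 + a\<^sup>2 + 4 * pi\<^sup>2 * M) * n"
      using up s \<alpha> n M(1) by (simp add: ennreal_le_iff flip: ennreal_mult)
    also have "\<dots> \<le> (1 + a\<^sup>2 + 4 * pi\<^sup>2 * M) * (G 0 * W * (b * P))"
      using n_le M(1) by (intro mult_left_mono) auto
    finally have "s \<le> (1 + a\<^sup>2 + 4 * pi\<^sup>2 * M) * (G 0 * W * b) / \<alpha> * P"
      using \<alpha> by (simp add: field_simps)
    also have "\<dots> \<le> B * P"
      unfolding B_def using P by (intro mult_right_mono) auto
    finally have upper: "s \<le> B * P" .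
    have "ennreal (\<omega>\<^sup>2) * N \<le> ennreal T * S + energy (fourier d)"
      using sampling_lower[OF deriv d_four a(1) \<omega>(1) \<omega>a, of x0] by (simp only: S_def N_def a(2) T_def)
    also have "\<dots> \<le> ennreal T * S + ennreal (4 * pi\<^sup>2 * M) * N"
      by (intro add_left_mono E_le)
    finally have "ennreal (\<omega>\<^sup>2 * n) \<le> ennreal (T * s + 4 * pi\<^sup>2 * M * n)"
      using n s T M(1) by (simp add: ennreal_mult ennreal_plus)
    then have "\<omega>\<^sup>2 * n \<le> T * s + 4 * pi\<^sup>2 * M * n"
      using n s T M(1) by (subst (asm) ennreal_le_iff) auto
    then have "(\<omega>\<^sup>2 - 4 * pi\<^sup>2 * M) * n \<le> T * s"
      by (simp add: algebra_simps)
    moreover have "(\<omega>\<^sup>2 - 4 * pi\<^sup>2 * M) * (G b * (b * P)) \<le> (\<omega>\<^sup>2 - 4 * pi\<^sup>2 * M) * n"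
      using n_ge \<omega>M by (intro mult_left_mono) auto
    ultimately have "A * P \<le> s"
      unfolding A_def using T by (simp add: field_simps)
    then have "ennreal (A * P) \<le> S \<and> S \<le> ennreal (B * P)"
      using upper s by (simp add: ennreal_leI)
    then show ?thesis
      unfolding S_def P_def f_def .
  qed
  then show ?thesis
    using A B by blast
qed

end

section \<open>Gabor coefficients\<close>

lemma integral_tiles:
  fixes q :: "real \<Rightarrow> complex"
  assumes q: "continuous_on UNIV q" and h: "0 < h" and ab: "a \<le> b"
  shows "integral {of_int a * h..of_int b * h} q = (\<Sum>l\<in>{a..<b}. integral {0..h} (\<lambda>x. q (x + of_int l * h)))"
  using ab
proof (induction b rule: int_ge_induct)
  case base
  then show ?case by simp
next
  case (step b)
  have insert: "{a..<b + 1} = insert b {a..<b}"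
    using step(1) by auto
  have "integral {of_int a * h..of_int (b + 1) * h} q
      = integral {of_int a * h..of_int b * h} q + integral {of_int b * h..of_int (b + 1) * h} q"
    using h step(1)
    by (intro Henstock_Kurzweil_Integration.integral_combine[symmetric] integrable_continuous_interval continuous_on_subset[OF q])
       (auto intro!: mult_right_mono)
  also have "integral {of_int b * h..of_int (b + 1) * h} q = integral {0..h} (\<lambda>x. q (x + of_int b * h))"
    using integral_shift_Icc_real[of 0 h q "of_int b * h"]
    by (simp add: o_def algebra_simps)
  also have "integral {of_int a * h..of_int b * h} q = (\<Sum>l\<in>{a..<b}. integral {0..h} (\<lambda>x. q (x + of_int l * h)))"
    by (rule step(2))
  finally show ?case
    using insert by (simp add: add.commute)
qed

definition supported_within :: "real \<Rightarrow> (real \<Rightarrow> complex) \<Rightarrow> bool" where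
  "supported_within R f \<longleftrightarrow> continuous_on UNIV f \<and> (\<forall>x. R \<le> \<bar>x\<bar> \<longrightarrow> f x = 0)"

lemma supported_within_integrable:
  assumes "supported_within R f"
  shows "integrable lborel f" and "(LBINT x. f x) = integral {-R..R} f"
proof -
  have cont: "continuous_on {-R..R} f" and f0: "\<And>x. x \<notin> {-R..R} \<Longrightarrow> f x = 0"
    using assms unfolding supported_within_def by (auto intro: continuous_on_subset)
  have "set_integrable lborel {-R..R} f"
    by (rule borel_integrable_atLeastAtMost'[OF cont])
  moreover have eq: "(\<lambda>x. indicat_real {-R..R} x *\<^sub>R f x) = f"
    using f0 by (auto simp: indicator_def fun_eq_iff)
  ultimately show "integrable lborel f"
    unfolding set_integrable_def by simp
  have "set_lebesgue_integral lborel {-R..R} f = integral {-R..R} f"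
    by (rule set_borel_integral_eq_integral(2)[OF \<open>set_integrable lborel {-R..R} f\<close>])
  then show "(LBINT x. f x) = integral {-R..R} f"
    unfolding set_lebesgue_integral_def eq .
qed

lemma supported_within_L2:
  assumes "supported_within R f"
  shows "f \<in> L2"
proof -
  have cont: "continuous_on UNIV f"
    using assms by (simp add: supported_within_def)
  have "supported_within R (\<lambda>x. f x * cnj (f x))"
    using assms unfolding supported_within_def by (auto intro!: continuous_intros)
  from integrable_norm[OF supported_within_integrable(1)[OF this]]
  have "integrable lborel (\<lambda>x. (cmod (f x))\<^sup>2)"
    by (simp add: norm_mult power2_eq_square)
  moreover have "f \<in> borel_measurable borel"
    using cont by (rule borel_measurable_continuous_onI)
  ultimately show ?thesis
    unfolding L2_def by (auto simp: integrable_lebesgue_iff borel_measurable_imp_lebesgue)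
qed

lemma L2_norm_square:
  assumes "f \<in> L2"
  shows "ennreal ((L2_norm f)\<^sup>2) = (\<integral>\<^sup>+x. sq_norm (f x) \<partial>lebesgue)"
    and "(L2_norm f)\<^sup>2 = (LINT x|lebesgue. (cmod (f x))\<^sup>2)"
proof -
  show "(L2_norm f)\<^sup>2 = (LINT x|lebesgue. (cmod (f x))\<^sup>2)"
    unfolding L2_norm_def by (intro real_sqrt_pow2 Bochner_Integration.integral_nonneg) simp
  then show "ennreal ((L2_norm f)\<^sup>2) = (\<integral>\<^sup>+x. sq_norm (f x) \<partial>lebesgue)"
    using assms by (simp add: L2_def nn_integral_eq_integral)
qed

lemma AE_translate_lebesgue:
  fixes P :: "real \<Rightarrow> bool"
  assumes "AE x in lebesgue. P x"
  shows "AE x in lebesgue. P (x - t)"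
proof -
  have "AE x in lborel. P x"
    using assms by (simp add: AE_completion_iff)
  then obtain N where N: "\<And>x. x \<in> space lborel - N \<Longrightarrow> P x" "N \<in> null_sets lborel"
    by (rule AE_E3) blast
  have "AE x in lborel. - t + 1 * x \<notin> N"
    using N(2) by (intro AE_borel_affine) (auto intro: AE_not_in)
  then have "AE x in lborel. P (x - t)"
    by eventually_elim (auto intro!: N(1))
  then show ?thesis
    by (rule AE_completion)
qed

abbreviation gabor_sum :: "(real \<Rightarrow> complex) \<Rightarrow> real \<Rightarrow> real \<Rightarrow> (real \<Rightarrow> complex) \<Rightarrow> ennreal" where
  "gabor_sum g \<alpha> \<beta> f \<equiv>
     (\<Sum>\<^sub>\<infinity>(k, m)\<in>(UNIV :: (int \<times> int) set). sq_norm (L2_inner f (gabor_atom g \<alpha> \<beta> k m)))"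

context gaussian_window
begin

abbreviation V :: "real \<Rightarrow> complex" where "V \<equiv> fourier u"

lemma cont_V: "continuous_on UNIV V"
  by (rule continuous_fourier[OF integrable_lebesgue_u])

lemma measurable_V [measurable]: "V \<in> borel_measurable borel"
  by (rule borel_measurable_continuous_onI[OF cont_V])

text \<open>The character has period \<open>1 / \<beta>\<close>, so it factors out of the periodization of \<open>f\<close> times the window.
  The number \<open>N\<close> of periods covers the support of \<open>f\<close>, which makes the periodization a finite sum.\<close>

lemma gabor_coefficient:
  assumes g: "AE x in lebesgue. g x = V (- x)"
    and g_meas: "g \<in> borel_measurable lebesgue"
    and f: "supported_within (of_int N * (1 / \<beta>)) f" and N: "0 \<le> N" and \<beta>: "0 < \<beta>"
  shows "L2_inner f (gabor_atom g \<alpha> \<beta> k m)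
    = fourier_coeff (1 / \<beta>) (\<lambda>x. \<Sum>l\<in>{-N..<N}. f (x + of_int l * (1 / \<beta>)) * cnj (V (\<alpha> * of_int k - (x + of_int l * (1 / \<beta>))))) m"
proof -
  define h where "h = 1 / \<beta>"
  have h: "0 < h"
    using \<beta> by (simp add: h_def)
  have cont_f: "continuous_on UNIV f"
    using f by (simp add: supported_within_def)
  define q where "q x = f x * cnj (V (\<alpha> * of_int k - x)) * wave (- (\<beta> * of_int m * x))" for x
  have cont_q: "continuous_on UNIV q"
    unfolding q_def by (intro continuous_intros cont_f continuous_on_compose2[OF cont_V]) auto
  have sq: "supported_within (of_int N * h) q"
    using f cont_q by (auto simp: supported_within_def q_def h_def)
  have qm: "q \<in> borel_measurable borel"
    by (rule borel_measurable_continuous_onI[OF cont_q])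
  have fm: "f \<in> borel_measurable borel"
    by (rule borel_measurable_continuous_onI[OF cont_f])
  have atom: "f x * cnj (gabor_atom g \<alpha> \<beta> k m x) = f x * (cnj (g (x - \<alpha> * of_int k)) * wave (- (\<beta> * of_int m * x)))" for x
    unfolding gabor_atom_def wave_def[symmetric] complex_cnj_mult cnj_wave by (simp only: mult_ac)
  have "L2_inner f (gabor_atom g \<alpha> \<beta> k m) = (LINT x|lebesgue. q x)"
    unfolding L2_inner_def
  proof (rule integral_cong_AE)
    have "(\<lambda>x. g (- (\<alpha> * of_int k) + 1 * x)) \<in> borel_measurable lebesgue"
      using borel_measurable_affine[OF g_meas, of 1 "- (\<alpha> * of_int k)"] by simp
    then have "(\<lambda>x. cnj (g (x - \<alpha> * of_int k))) \<in> borel_measurable lebesgue"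
      by (intro cnj_measurable) simp
    moreover have "(\<lambda>x. wave (- (\<beta> * of_int m * x))) \<in> borel_measurable lebesgue"
      by (rule borel_measurable_imp_lebesgue) measurable
    ultimately show "(\<lambda>x. f x * cnj (gabor_atom g \<alpha> \<beta> k m x)) \<in> borel_measurable lebesgue"
      unfolding atom by (intro borel_measurable_times borel_measurable_imp_lebesgue[OF fm])
    show "q \<in> borel_measurable lebesgue"
      by (rule borel_measurable_imp_lebesgue[OF qm])
    show "AE x in lebesgue. f x * cnj (gabor_atom g \<alpha> \<beta> k m x) = q x"
      using AE_translate_lebesgue[OF g, of "\<alpha> * of_int k"]
      by eventually_elim (simp add: atom q_def)
  qed
  also have "\<dots> = (LBINT x. q x)"
    by (rule integral_lebesgue_eq[OF qm])
  also have "\<dots> = integral {- (of_int N * h)..of_int N * h} q"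
    by (rule supported_within_integrable(2)[OF sq])
  also have "\<dots> = integral {of_int (- N) * h..of_int N * h} q"
    by simp
  also have "\<dots> = (\<Sum>l\<in>{-N..<N}. integral {0..h} (\<lambda>x. q (x + of_int l * h)))"
    by (rule integral_tiles[OF cont_q h]) (use N in simp)
  also have "\<dots> = integral {0..h} (\<lambda>x. \<Sum>l\<in>{-N..<N}. q (x + of_int l * h))"
    by (rule Henstock_Kurzweil_Integration.integral_sum[symmetric])
       (auto intro!: integrable_continuous_interval continuous_on_compose2[OF cont_q] continuous_intros)
  also have "\<dots> = fourier_coeff h (\<lambda>x. \<Sum>l\<in>{-N..<N}. f (x + of_int l * h) * cnj (V (\<alpha> * of_int k - (x + of_int l * h)))) m"
    unfolding fourier_coeff_def sum_distrib_right
  proof (rule Henstock_Kurzweil_Integration.integral_cong, rule sum.cong)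
    fix x l
    have "- (\<beta> * of_int m * (x + of_int l * h)) = (x + of_int l * h) * (of_int (- m) / h)"
      by (simp add: h_def)
    then have "wave (- (\<beta> * of_int m * (x + of_int l * h))) = harmonic h (- m) (x + of_int l * h)"
      unfolding harmonic_def by (simp only:)
    also have "\<dots> = harmonic h (- m) x"
      by (rule harmonic_plus_period[OF h])
    finally show "q (x + of_int l * h) = f (x + of_int l * h) * cnj (V (\<alpha> * of_int k - (x + of_int l * h))) * harmonic h (- m) x"
      unfolding q_def by (simp only:)
  qed simp
  finally show ?thesis
    unfolding h_def .
qed

text \<open>Parseval's identity for each translation index. Up to conjugation, the periodization at \<open>x\<close> is the
  value at \<open>\<alpha> k - x\<close> of a combination of translates whose coefficients depend on \<open>x\<close> but not on \<open>k\<close>.\<close>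

lemma gabor_square_sum:
  assumes g: "AE x in lebesgue. g x = V (- x)"
    and g_meas: "g \<in> borel_measurable lebesgue"
    and f: "supported_within (of_int N * (1 / \<beta>)) f" and N: "0 \<le> N" and \<beta>: "0 < \<beta>"
  shows "gabor_sum g \<alpha> \<beta> f
    = ennreal (1 / \<beta>) * (\<integral>\<^sup>+x\<in>{0..<1 / \<beta>}. (\<Sum>\<^sub>\<infinity>k. ennreal ((cmod
        (fourier (\<lambda>w. u w * trig_poly \<beta> {-N..<N} (\<lambda>l. cnj (f (x + of_int l * (1 / \<beta>)))) w) (- x + of_int k * \<alpha>)))\<^sup>2)) \<partial>lborel)"
proof -
  define h where "h = 1 / \<beta>"
  have h: "0 < h"
    using \<beta> by (simp add: h_def)
  have cont_f: "continuous_on UNIV f"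
    using f by (simp add: supported_within_def)
  define Q where "Q k x = (\<Sum>l\<in>{-N..<N}. f (x + of_int l * h) * cnj (V (\<alpha> * of_int k - (x + of_int l * h))))" for k x
  have cont_Q: "continuous_on UNIV (Q k)" for k
    unfolding Q_def
    by (intro continuous_intros continuous_on_compose2[OF cont_f] continuous_on_compose2[OF cont_V]) auto
  have Q_ends: "Q k 0 = Q k h" for k
  proof -
    define r where "r l = f (of_int l * h) * cnj (V (\<alpha> * of_int k - of_int l * h))" for l :: int
    have r0: "r N = 0" "r (- N) = 0"
      using f N h by (auto simp: supported_within_def r_def h_def abs_mult)
    have "Q k h = (\<Sum>l\<in>{-N..<N}. r (l + 1))"
      unfolding Q_def r_def by (intro sum.cong refl) (simp add: algebra_simps)
    also have "\<dots> = (\<Sum>l\<in>{-N + 1..<N + 1}. r l)"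
      by (rule sum.reindex_bij_witness[of _ "\<lambda>l. l - 1" "\<lambda>l. l + 1"]) auto
    also have "\<dots> = (\<Sum>l\<in>{-N..N}. r l)"
    proof (rule sum.mono_neutral_left)
      have "l = - N" if "l \<in> {-N..N} - {-N + 1..<N + 1}" for l
        using that by auto
      then show "\<forall>l\<in>{-N..N} - {-N + 1..<N + 1}. r l = 0"
        using r0 by blast
    qed auto
    also have "\<dots> = (\<Sum>l\<in>{-N..<N}. r l)"
    proof (rule sum.mono_neutral_right)
      have "l = N" if "l \<in> {-N..N} - {-N..<N}" for l
        using that by auto
      then show "\<forall>l\<in>{-N..N} - {-N..<N}. r l = 0"
        using r0 by blast
    qed auto
    finally show ?thesis
      by (simp add: Q_def r_def)
  qed
  have Q_eq: "cmod (Q k x) = cmod (combination \<beta> {-N..<N} (\<lambda>l. cnj (f (x + of_int l * h))) (- x + of_int k * \<alpha>))" for k x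
  proof -
    have "combination \<beta> {-N..<N} (\<lambda>l. cnj (f (x + of_int l * h))) (- x + of_int k * \<alpha>)
        = (\<Sum>l\<in>{-N..<N}. cnj (f (x + of_int l * h)) * V (- x + of_int k * \<alpha> - of_int l / \<beta>))"
      by (rule fourier_modulated_trig_poly) simp
    also have "\<dots> = cnj (Q k x)"
      unfolding Q_def cnj_sum by (intro sum.cong refl) (simp add: h_def algebra_simps)
    finally show ?thesis
      by simp
  qed
  have coeff: "L2_inner f (gabor_atom g \<alpha> \<beta> k m) = fourier_coeff h (Q k) m" for k m
    unfolding Q_def h_def by (rule gabor_coefficient[OF g g_meas f N \<beta>])
  have parseval_Q: "(\<Sum>\<^sub>\<infinity>m. sq_norm (fourier_coeff h (Q k) m))
      = ennreal h * (\<integral>\<^sup>+x\<in>{0..<h}. sq_norm (Q k x) \<partial>lborel)" for k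
  proof -
    have "(\<Sum>\<^sub>\<infinity>m. sq_norm (fourier_coeff h (Q k) m)) = ennreal (h * integral {0..h} (\<lambda>x. (cmod (Q k x))\<^sup>2))"
      by (rule parseval[OF h continuous_on_subset[OF cont_Q] Q_ends]) simp
    also have "\<dots> = ennreal h * ennreal (integral {0..h} (\<lambda>x. (cmod (Q k x))\<^sup>2))"
      using h by (intro ennreal_mult Henstock_Kurzweil_Integration.integral_nonneg integrable_continuous_interval
          continuous_intros continuous_on_subset[OF cont_Q]) auto
    also have "ennreal (integral {0..h} (\<lambda>x. (cmod (Q k x))\<^sup>2)) = (\<integral>\<^sup>+x\<in>{0..<h}. sq_norm (Q k x) \<partial>lborel)"
      using nn_integral_interval[of "\<lambda>x. (cmod (Q k x))\<^sup>2" h 0] h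
      by (simp add: continuous_on_norm continuous_on_power cont_Q)
    finally show ?thesis .
  qed
  have [measurable]: "Q k \<in> borel_measurable borel" for k
    by (rule borel_measurable_continuous_onI[OF cont_Q])
  let ?F = "\<lambda>k m. sq_norm (L2_inner f (gabor_atom g \<alpha> \<beta> k m))"
  have "(\<Sum>\<^sub>\<infinity>(k, m)\<in>(UNIV :: (int \<times> int) set). ?F k m) = (\<Sum>\<^sub>\<infinity>k. \<Sum>\<^sub>\<infinity>m. ?F k m)"
    using nn_integral_fst_count_space[of "\<lambda>(k, m). ?F k m"]
    by (simp add: infsum_ennreal_eq_nn_integral)
  also have "\<dots> = (\<Sum>\<^sub>\<infinity>k. ennreal h * (\<integral>\<^sup>+x\<in>{0..<h}. sq_norm (Q k x) \<partial>lborel))"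
    unfolding coeff parseval_Q ..
  also have "\<dots> = ennreal h * (\<Sum>\<^sub>\<infinity>k. \<integral>\<^sup>+x\<in>{0..<h}. sq_norm (Q k x) \<partial>lborel)"
    by (rule infsum_ennreal_cmult) simp
  also have "(\<Sum>\<^sub>\<infinity>k. \<integral>\<^sup>+x\<in>{0..<h}. sq_norm (Q k x) \<partial>lborel)
      = (\<integral>\<^sup>+x. (\<Sum>\<^sub>\<infinity>k. sq_norm (Q k x) * indicator {0..<h} x) \<partial>lborel)"
    by (rule nn_integral_infsum[symmetric]) measurable
  also have "\<dots> = (\<integral>\<^sup>+x\<in>{0..<h}. (\<Sum>\<^sub>\<infinity>k. sq_norm (Q k x)) \<partial>lborel)"
    by (intro nn_integral_cong) (simp add: mult.commute[of _ "indicator _ _"] infsum_ennreal_cmult[OF countableI_type])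
  finally show ?thesis
    unfolding Q_eq h_def .
qed

text \<open>The bounds for the samples are uniform in the coefficients and the offset, so they can be
  integrated over a period. The square sum of the coefficients integrates to the energy of \<open>f\<close>.\<close>

lemma gabor_bounds_supported:
  assumes g: "AE x in lebesgue. g x = V (- x)"
    and g_meas: "g \<in> borel_measurable lebesgue"
    and \<beta>: "0 < \<beta>"
    and AB: "0 < A" "0 < B"
    and bounds: "sampling_bounds A B \<beta> \<alpha>"
    and f: "supported_within R f"
  shows "ennreal (A / \<beta> * (L2_norm f)\<^sup>2)
          \<le> gabor_sum g \<alpha> \<beta> f \<and>
    gabor_sum g \<alpha> \<beta> f
          \<le> ennreal (B / \<beta> * (L2_norm f)\<^sup>2)"
proof -
  define h where "h = 1 / \<beta>"
  have h: "0 < h"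
    using \<beta> by (simp add: h_def)
  define N where "N = max 0 \<lceil>R / h\<rceil>"
  have N: "0 \<le> N"
    by (simp add: N_def)
  have "R / h \<le> of_int N"
    unfolding N_def by (metis le_of_int_ceiling max.cobounded2 of_int_le_iff order.trans)
  then have "R \<le> of_int N * h"
    using h by (simp add: pos_divide_le_eq)
  then have fN: "supported_within (of_int N * h) f"
    using f unfolding supported_within_def by auto
  have cont_f: "continuous_on UNIV f"
    using f by (simp add: supported_within_def)
  have [measurable]: "f \<in> borel_measurable borel"
    by (rule borel_measurable_continuous_onI[OF cont_f])
  let ?P = "\<lambda>x. \<Sum>l\<in>{-N..<N}. (cmod (cnj (f (x + of_int l * h))))\<^sup>2"
  have norm_f: "ennreal ((L2_norm f)\<^sup>2) = (\<integral>\<^sup>+x\<in>{0..<h}. ennreal (?P x) \<partial>lborel)"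
  proof -
    have "ennreal ((L2_norm f)\<^sup>2) = energy f"
      using L2_norm_square(1)[OF supported_within_L2[OF f]] by (simp add: nn_integral_completion)
    also have "\<dots> = (\<Sum>\<^sub>\<infinity>l. \<integral>\<^sup>+x\<in>{0..<h}. sq_norm (f (x + of_int l * h)) \<partial>lborel)"
      by (rule nn_integral_periodize[OF _ h]) measurable
    also have "\<dots> = (\<Sum>\<^sub>\<infinity>l\<in>{-N..<N}. \<integral>\<^sup>+x\<in>{0..<h}. sq_norm (f (x + of_int l * h)) \<partial>lborel)"
    proof (rule infsum_cong_neutral)
      fix l :: int
      assume "l \<in> UNIV - {-N..<N}"
      then have l: "l < - N \<or> N \<le> l"
        by auto
      have zero: "f (x + of_int l * h) = 0" if x: "x \<in> {0..<h}" for x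
      proof -
        have "of_int N * h \<le> \<bar>x + of_int l * h\<bar>"
        proof (cases "N \<le> l")
          case True
          then have "of_int N * h \<le> of_int l * h"
            using h by (intro mult_right_mono) auto
          then show ?thesis
            using x abs_ge_self[of "x + of_int l * h"] by (simp only: atLeastLessThan_iff) linarith
        next
          case False
          then have "of_int (l + 1) * h \<le> of_int (- N) * h"
            using h l by (intro mult_right_mono) auto
          then have "x + of_int l * h \<le> - (of_int N * h)"
            using x by (simp add: algebra_simps)
          then show ?thesis
            by linarith
        qed
        then show ?thesis
          using fN by (simp add: supported_within_def)
      qed
      have "(\<integral>\<^sup>+x\<in>{0..<h}. sq_norm (f (x + of_int l * h)) \<partial>lborel) = (\<integral>\<^sup>+x. 0 \<partial>(lborel :: real measure))"
        by (rule nn_integral_cong) (auto simp: indicator_def zero)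
      then show "(\<integral>\<^sup>+x\<in>{0..<h}. sq_norm (f (x + of_int l * h)) \<partial>lborel) = 0"
        by simp
    qed auto
    also have "\<dots> = (\<Sum>l\<in>{-N..<N}. \<integral>\<^sup>+x\<in>{0..<h}. sq_norm (f (x + of_int l * h)) \<partial>lborel)"
      by simp
    also have "\<dots> = (\<integral>\<^sup>+x. (\<Sum>l\<in>{-N..<N}. sq_norm (f (x + of_int l * h)) * indicator {0..<h} x) \<partial>lborel)"
      by (rule nn_integral_sum[symmetric]) measurable
    also have "\<dots> = (\<integral>\<^sup>+x\<in>{0..<h}. ennreal (?P x) \<partial>lborel)"
      by (rule nn_integral_cong) (simp add: sum_distrib_right[symmetric])
    finally show ?thesis .
  qed
  let ?S = "\<lambda>x. \<Sum>\<^sub>\<infinity>k. ennreal ((cmod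
        (combination \<beta> {-N..<N} (\<lambda>l. cnj (f (x + of_int l * h))) (- x + of_int k * \<alpha>)))\<^sup>2)"
  have sum_eq: "gabor_sum g \<alpha> \<beta> f
    = ennreal h * (\<integral>\<^sup>+x\<in>{0..<h}. ?S x \<partial>lborel)"
    unfolding h_def by (rule gabor_square_sum[OF g g_meas _ N \<beta>]) (use fN in \<open>simp add: h_def\<close>)
  have P0: "0 \<le> ?P x" for x
    by (intro sum_nonneg) auto
  have pull: "(\<integral>\<^sup>+x\<in>{0..<h}. ennreal (C * ?P x) \<partial>lborel) = ennreal C * ennreal ((L2_norm f)\<^sup>2)" if "0 < C" for C
  proof -
    have "(\<integral>\<^sup>+x\<in>{0..<h}. ennreal (C * ?P x) \<partial>lborel) = (\<integral>\<^sup>+x. ennreal C * (ennreal (?P x) * indicator {0..<h} x) \<partial>lborel)"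
      using that P0 by (intro nn_integral_cong) (simp add: ennreal_mult mult.assoc)
    also have "\<dots> = ennreal C * (\<integral>\<^sup>+x\<in>{0..<h}. ennreal (?P x) \<partial>lborel)"
      by (rule nn_integral_cmult) measurable
    finally show ?thesis
      by (simp only: norm_f)
  qed
  have SP: "ennreal (A * ?P x) \<le> ?S x" "?S x \<le> ennreal (B * ?P x)" for x
    using bounds[rule_format, of "{-N..<N}" "\<lambda>l. cnj (f (x + of_int l * h))" "- x"] by (simp_all only: finite_atLeastLessThan_int)
  have "ennreal (A / \<beta> * (L2_norm f)\<^sup>2) = ennreal h * (ennreal A * ennreal ((L2_norm f)\<^sup>2))"
    using h AB by (simp add: h_def flip: ennreal_mult)
  also have "\<dots> \<le> ennreal h * (\<integral>\<^sup>+x\<in>{0..<h}. ?S x \<partial>lborel)"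
    unfolding pull[OF AB(1), symmetric]
    by (intro mult_left_mono nn_integral_mono mult_right_mono SP(1) zero_le)
  finally have lower: "ennreal (A / \<beta> * (L2_norm f)\<^sup>2) \<le> ennreal h * (\<integral>\<^sup>+x\<in>{0..<h}. ?S x \<partial>lborel)" .
  have "ennreal h * (\<integral>\<^sup>+x\<in>{0..<h}. ?S x \<partial>lborel) \<le> ennreal h * (ennreal B * ennreal ((L2_norm f)\<^sup>2))"
    unfolding pull[OF AB(2), symmetric]
    by (intro mult_left_mono nn_integral_mono mult_right_mono SP(2) zero_le)
  also have "\<dots> = ennreal (B / \<beta> * (L2_norm f)\<^sup>2)"
    using h AB by (simp add: h_def flip: ennreal_mult)
  finally show ?thesis
    unfolding sum_eq using lower by blast
qed

end

section \<open>Extension of the frame inequalities from a dense class\<close>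

abbreviation frame_sum :: "('i \<Rightarrow> real \<Rightarrow> complex) \<Rightarrow> (real \<Rightarrow> complex) \<Rightarrow> ennreal" where
  "frame_sum E f \<equiv> (\<Sum>\<^sub>\<infinity>i. sq_norm (L2_inner f (E i)))"

lemma L2_diff:
  assumes "f \<in> L2" "g \<in> L2"
  shows "(\<lambda>x. f x - g x) \<in> L2"
    and "(L2_norm (\<lambda>x. f x - g x))\<^sup>2 \<le> 2 * (L2_norm f)\<^sup>2 + 2 * (L2_norm g)\<^sup>2"
proof -
  have m: "f \<in> borel_measurable lebesgue" "g \<in> borel_measurable lebesgue"
    and i: "integrable lebesgue (\<lambda>x. (cmod (f x))\<^sup>2)" "integrable lebesgue (\<lambda>x. (cmod (g x))\<^sup>2)"
    using assms by (auto simp: L2_def)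
  have le: "(cmod (f x - g x))\<^sup>2 \<le> 2 * (cmod (f x))\<^sup>2 + 2 * (cmod (g x))\<^sup>2" for x
  proof -
    have "(cmod (f x - g x))\<^sup>2 \<le> (cmod (f x) + cmod (g x))\<^sup>2"
      by (intro power_mono norm_triangle_ineq4) simp
    also have "\<dots> \<le> 2 * (cmod (f x))\<^sup>2 + 2 * (cmod (g x))\<^sup>2"
      using zero_le_power2[of "cmod (f x) - cmod (g x)"] by (simp add: power2_eq_square algebra_simps)
    finally show ?thesis .
  qed
  have i2: "integrable lebesgue (\<lambda>x. 2 * (cmod (f x))\<^sup>2 + 2 * (cmod (g x))\<^sup>2)"
    using i by simp
  have md: "(\<lambda>x. f x - g x) \<in> borel_measurable lebesgue"
    by (intro borel_measurable_diff m)
  have id: "integrable lebesgue (\<lambda>x. (cmod (f x - g x))\<^sup>2)"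
  proof (rule Bochner_Integration.integrable_bound[OF i2])
    show "(\<lambda>x. (cmod (f x - g x))\<^sup>2) \<in> borel_measurable lebesgue"
      using md by measurable
    show "AE x in lebesgue. norm ((cmod (f x - g x))\<^sup>2) \<le> norm (2 * (cmod (f x))\<^sup>2 + 2 * (cmod (g x))\<^sup>2)"
      using le by (auto intro!: always_eventually)
  qed
  show d: "(\<lambda>x. f x - g x) \<in> L2"
    using md id by (simp add: L2_def)
  have "(LINT x|lebesgue. (cmod (f x - g x))\<^sup>2) \<le> (LINT x|lebesgue. 2 * (cmod (f x))\<^sup>2 + 2 * (cmod (g x))\<^sup>2)"
    by (rule integral_mono[OF id i2 le])
  also have "\<dots> = 2 * (LINT x|lebesgue. (cmod (f x))\<^sup>2) + 2 * (LINT x|lebesgue. (cmod (g x))\<^sup>2)"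
    using i by simp
  finally show "(L2_norm (\<lambda>x. f x - g x))\<^sup>2 \<le> 2 * (L2_norm f)\<^sup>2 + 2 * (L2_norm g)\<^sup>2"
    unfolding L2_norm_square(2)[OF d] L2_norm_square(2)[OF assms(1)] L2_norm_square(2)[OF assms(2)] .
qed

lemma L2_norm_triangle_square:
  assumes "f \<in> L2" "g \<in> L2"
  shows "(L2_norm f)\<^sup>2 \<le> 2 * (L2_norm g)\<^sup>2 + 2 * (L2_norm (\<lambda>x. f x - g x))\<^sup>2"
proof -
  have z: "(\<lambda>x. 0) \<in> L2"
    by (simp add: L2_def)
  have n: "(\<lambda>x. g x - f x) \<in> L2"
    by (rule L2_diff(1)[OF assms(2,1)])
  have "L2_norm (\<lambda>x. g x - (g x - f x)) = L2_norm f" "L2_norm (\<lambda>x. g x - f x) = L2_norm (\<lambda>x. f x - g x)"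
    by (simp_all add: L2_norm_def norm_minus_commute)
  then show ?thesis
    using L2_diff(2)[OF assms(2) n] by simp
qed

lemma L2_product:
  assumes f: "f \<in> L2" and e: "e \<in> L2"
  shows integrable_L2_product: "integrable lebesgue (\<lambda>x. f x * cnj (e x))"
    and L2_Cauchy_Schwarz: "(cmod (L2_inner f e))\<^sup>2 \<le> (L2_norm f)\<^sup>2 * (L2_norm e)\<^sup>2"
proof -
  have m: "f \<in> borel_measurable lebesgue" "e \<in> borel_measurable lebesgue"
    and i: "integrable lebesgue (\<lambda>x. (cmod (f x))\<^sup>2)" "integrable lebesgue (\<lambda>x. (cmod (e x))\<^sup>2)"
    using f e by (auto simp: L2_def)
  show int: "integrable lebesgue (\<lambda>x. f x * cnj (e x))"
  proof (rule Bochner_Integration.integrable_bound)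
    show "integrable lebesgue (\<lambda>x. (cmod (f x))\<^sup>2 + (cmod (e x))\<^sup>2)"
      using i by simp
    show "(\<lambda>x. f x * cnj (e x)) \<in> borel_measurable lebesgue"
      by (intro borel_measurable_times cnj_measurable m)
    have "cmod (f x) * cmod (e x) \<le> (cmod (f x))\<^sup>2 + (cmod (e x))\<^sup>2" for x
    proof -
      have "2 * (cmod (f x) * cmod (e x)) \<le> (cmod (f x))\<^sup>2 + (cmod (e x))\<^sup>2"
        using sum_squares_bound[of "cmod (f x)" "cmod (e x)"] by (simp add: mult.assoc)
      moreover have "0 \<le> cmod (f x) * cmod (e x)"
        by simp
      ultimately show ?thesis
        by linarith
    qed
    then show "AE x in lebesgue. norm (f x * cnj (e x)) \<le> norm ((cmod (f x))\<^sup>2 + (cmod (e x))\<^sup>2)"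
      by (auto simp: norm_mult intro!: always_eventually)
  qed
  have "ennreal (cmod (L2_inner f e)) \<le> (\<integral>\<^sup>+x. ennreal (cmod (f x * cnj (e x))) \<partial>lebesgue)"
    unfolding L2_inner_def using integral_norm_bound_ennreal[OF int] by simp
  also have "\<dots> = (\<integral>\<^sup>+x. ennreal (cmod (f x)) * ennreal (cmod (e x)) \<partial>lebesgue)"
    by (simp add: norm_mult ennreal_mult)
  finally have "(ennreal (cmod (L2_inner f e)))\<^sup>2 \<le> (\<integral>\<^sup>+x. ennreal (cmod (f x)) * ennreal (cmod (e x)) \<partial>lebesgue)\<^sup>2"
    by (rule power_mono) simp
  also have "\<dots> \<le> (\<integral>\<^sup>+x. ennreal (cmod (f x)) ^ 2 \<partial>lebesgue) * (\<integral>\<^sup>+x. ennreal (cmod (e x)) ^ 2 \<partial>lebesgue)"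
    by (rule Cauchy_Schwarz_nn_integral) (use m in measurable)
  also have "\<dots> = ennreal ((L2_norm f)\<^sup>2) * ennreal ((L2_norm e)\<^sup>2)"
    by (simp add: L2_norm_square(1)[OF f] L2_norm_square(1)[OF e] ennreal_power)
  finally show "(cmod (L2_inner f e))\<^sup>2 \<le> (L2_norm f)\<^sup>2 * (L2_norm e)\<^sup>2"
    by (simp add: ennreal_power flip: ennreal_mult)
qed

lemma L2_inner_diff_square:
  assumes "f \<in> L2" "g \<in> L2" "e \<in> L2"
  shows "(cmod (L2_inner f e))\<^sup>2 \<le> 2 * (cmod (L2_inner g e))\<^sup>2 + 2 * (cmod (L2_inner (\<lambda>x. f x - g x) e))\<^sup>2"
proof -
  have "L2_inner (\<lambda>x. f x - g x) e = L2_inner f e - L2_inner g e"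
    unfolding L2_inner_def using assms by (simp add: left_diff_distrib integrable_L2_product)
  then have "cmod (L2_inner f e) \<le> cmod (L2_inner g e) + cmod (L2_inner (\<lambda>x. f x - g x) e)"
    by (metis add_diff_cancel_left' add_diff_eq norm_triangle_ineq diff_add_cancel add.commute)
  then have "(cmod (L2_inner f e))\<^sup>2 \<le> (cmod (L2_inner g e) + cmod (L2_inner (\<lambda>x. f x - g x) e))\<^sup>2"
    by (intro power_mono) auto
  also have "\<dots> \<le> 2 * (cmod (L2_inner g e))\<^sup>2 + 2 * (cmod (L2_inner (\<lambda>x. f x - g x) e))\<^sup>2"
    using zero_le_power2[of "cmod (L2_inner g e) - cmod (L2_inner (\<lambda>x. f x - g x) e)"]
    by (simp add: power2_eq_square algebra_simps)
  finally show ?thesis .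
qed

text \<open>A truncation in space and in height at once. It is continuous in both arguments, so it preserves
  continuity and almost everywhere convergence of functions.\<close>

definition cutoff :: "nat \<Rightarrow> real \<Rightarrow> complex \<Rightarrow> complex" where
  "cutoff N x z = of_real (max 0 (min 1 (real N + 1 - \<bar>x\<bar>)) * (real N / max (real N) (cmod z))) * z"

lemma cutoff_eq:
  assumes "1 \<le> N" "\<bar>x\<bar> \<le> real N" "cmod z \<le> real N"
  shows "cutoff N x z = z"
  using assms by (simp add: cutoff_def max_def min_def)

lemma cutoff_outside: "real N + 1 \<le> \<bar>x\<bar> \<Longrightarrow> cutoff N x z = 0"
  by (simp add: cutoff_def)

lemma norm_cutoff_le:
  assumes "1 \<le> N"
  shows "cmod (cutoff N x z) \<le> cmod z" "cmod (cutoff N x z) \<le> real N"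
proof -
  let ?s = "max 0 (min 1 (real N + 1 - \<bar>x\<bar>))" and ?t = "real N / max (real N) (cmod z)"
  have s: "0 \<le> ?s" "?s \<le> 1"
    by auto
  have M: "0 < max (real N) (cmod z)"
    using assms by (simp add: less_max_iff_disj)
  have t: "0 \<le> ?t" "?t \<le> 1" "?t * cmod z \<le> real N"
    using M assms by (auto simp: divide_simps mult_left_mono)
  have n: "cmod (cutoff N x z) = ?s * (?t * cmod z)"
    unfolding cutoff_def norm_mult norm_of_real using s t by (simp add: abs_mult)
  have "?s * (?t * cmod z) \<le> 1 * (?t * cmod z)"
    using s t by (intro mult_right_mono) auto
  then have le: "cmod (cutoff N x z) \<le> ?t * cmod z"
    unfolding n by simp
  also have "?t * cmod z \<le> 1 * cmod z"
    using t by (intro mult_right_mono) auto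
  finally show "cmod (cutoff N x z) \<le> cmod z"
    by simp
  show "cmod (cutoff N x z) \<le> real N"
    using le t(3) by linarith
qed

lemma continuous_cutoff:
  assumes N: "1 \<le> N" and f: "continuous_on UNIV f"
  shows "continuous_on UNIV (\<lambda>x. cutoff N x (f x))"
  unfolding cutoff_def using N
  by (intro continuous_intros f ballI) (auto simp: max_def)

lemma continuous_cutoff_value:
  assumes N: "1 \<le> N"
  shows "continuous_on UNIV (cutoff N x)"
  unfolding cutoff_def[abs_def] using N
  by (intro continuous_intros ballI) (auto simp: max_def)

lemma L2_dominated_approximation:
  fixes F :: "nat \<Rightarrow> real \<Rightarrow> complex"
  assumes Fm: "\<And>n. F n \<in> borel_measurable lebesgue" and fm: "f \<in> borel_measurable lebesgue"
    and w: "integrable lebesgue w" and le: "\<And>n. AE x in lebesgue. (cmod (f x - F n x))\<^sup>2 \<le> w x"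
    and lim: "AE x in lebesgue. (\<lambda>n. F n x) \<longlonglongrightarrow> f x" and e: "0 < e"
  shows "\<exists>n. (L2_norm (\<lambda>x. f x - F n x))\<^sup>2 < e"
proof -
  have "(\<lambda>n. LINT x|lebesgue. (cmod (f x - F n x))\<^sup>2) \<longlonglongrightarrow> (LINT (x::real)|lebesgue. 0)"
  proof (rule integral_dominated_convergence[OF _ _ w])
    show "AE x in lebesgue. (\<lambda>n. (cmod (f x - F n x))\<^sup>2) \<longlonglongrightarrow> 0"
      using lim
    proof eventually_elim
      case (elim x)
      have "(\<lambda>n. (cmod (f x - F n x))\<^sup>2) \<longlonglongrightarrow> (cmod (f x - f x))\<^sup>2"
        by (intro tendsto_intros elim)
      then show ?case by simp
    qed
    show "\<And>n. (\<lambda>x. (cmod (f x - F n x))\<^sup>2) \<in> borel_measurable lebesgue"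
      using fm Fm by measurable
    show "\<And>n. AE x in lebesgue. norm ((cmod (f x - F n x))\<^sup>2) \<le> w x"
      using le by simp
  qed simp
  then have "\<forall>\<^sub>F n in sequentially. (LINT x|lebesgue. (cmod (f x - F n x))\<^sup>2) < e"
    using e by (simp add: order_tendsto_iff)
  then obtain n where "(LINT x|lebesgue. (cmod (f x - F n x))\<^sup>2) < e"
    by (auto simp: eventually_sequentially)
  moreover have "(L2_norm (\<lambda>x. f x - F n x))\<^sup>2 = (LINT x|lebesgue. (cmod (f x - F n x))\<^sup>2)"
    unfolding L2_norm_def by (intro real_sqrt_pow2 Bochner_Integration.integral_nonneg) simp
  ultimately show ?thesis
    by (intro exI[of _ n]) simp
qed

text \<open>The truncations of \<open>f\<close> converge to \<open>f\<close>, dominated by \<open>f\<close> itself. A measurable function is an almost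
  everywhere limit of continuous functions, and after truncation at a fixed level this convergence is
  dominated as well.\<close>

lemma supported_dense:
  assumes f: "f \<in> L2" and e: "0 < e"
  shows "\<exists>R g. supported_within R g \<and> (L2_norm (\<lambda>x. f x - g x))\<^sup>2 < e"
proof -
  have fm: "f \<in> borel_measurable lebesgue" and fi: "integrable lebesgue (\<lambda>x. (cmod (f x))\<^sup>2)"
    using f by (auto simp: L2_def)
  have cm: "(\<lambda>x. cutoff (Suc n) x (f x)) \<in> borel_measurable lebesgue" for n
  proof -
    have [measurable]: "(\<lambda>x. \<bar>x::real\<bar>) \<in> borel_measurable lebesgue"
      by (rule borel_measurable_imp_lebesgue) measurable
    note [measurable] = fm
    show ?thesis
      unfolding cutoff_def by measurable
  qed
  have "\<exists>n. (L2_norm (\<lambda>x. f x - cutoff (Suc n) x (f x)))\<^sup>2 < e / 4"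
  proof (rule L2_dominated_approximation[OF cm fm])
    show "integrable lebesgue (\<lambda>x. 4 * (cmod (f x))\<^sup>2)"
      using fi by simp
    have "(cmod (f x - cutoff (Suc n) x (f x)))\<^sup>2 \<le> (2 * cmod (f x))\<^sup>2" for n x
      using norm_triangle_ineq4[of "f x" "cutoff (Suc n) x (f x)"] norm_cutoff_le(1)[of "Suc n" x "f x"]
      by (intro power_mono) auto
    then show "\<And>n. AE x in lebesgue. (cmod (f x - cutoff (Suc n) x (f x)))\<^sup>2 \<le> 4 * (cmod (f x))\<^sup>2"
      by (auto simp: power_mult_distrib)
    show "AE x in lebesgue. (\<lambda>n. cutoff (Suc n) x (f x)) \<longlonglongrightarrow> f x"
    proof (rule always_eventually, rule allI, rule tendsto_eventually)
      fix x
      obtain K where K: "max \<bar>x\<bar> (cmod (f x)) \<le> real K"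
        using real_arch_simple by blast
      show "\<forall>\<^sub>F n in sequentially. cutoff (Suc n) x (f x) = f x"
        using eventually_ge_at_top[of K]
        by eventually_elim (rule cutoff_eq; use K in simp)
    qed
  qed (use e in simp)
  then obtain n where n: "(L2_norm (\<lambda>x. f x - cutoff (Suc n) x (f x)))\<^sup>2 < e / 4"
    by blast
  let ?N = "Suc n"
  let ?fN = "\<lambda>x. cutoff ?N x (f x)"
  have "f measurable_on UNIV"
    by (rule lebesgue_measurable_imp_measurable_on[OF fm]) simp
  then obtain Z g where Z: "negligible Z" and g: "\<And>k. continuous_on UNIV (g k)"
      and lim: "\<And>x. x \<notin> Z \<Longrightarrow> (\<lambda>k. g k x) \<longlonglongrightarrow> f x"
    unfolding measurable_on_def by auto
  have sg: "supported_within (real ?N + 1) (\<lambda>x. cutoff ?N x (g k x))" for k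
    unfolding supported_within_def using continuous_cutoff[of ?N, OF _ g] cutoff_outside[of ?N] by auto
  have "\<exists>k. (L2_norm (\<lambda>x. ?fN x - cutoff ?N x (g k x)))\<^sup>2 < e / 4"
  proof (rule L2_dominated_approximation[OF _ cm])
    show "(\<lambda>x. cutoff ?N x (g k x)) \<in> borel_measurable lebesgue" for k
      using supported_within_L2[OF sg] by (simp add: L2_def)
    let ?w = "\<lambda>x. (2 * real ?N)\<^sup>2 * indicat_real {-(real ?N + 1)..real ?N + 1} x"
    show "integrable lebesgue ?w"
      by (subst integrable_lebesgue_iff) (auto intro!: integrable_mult_right integrable_real_indicator simp: emeasure_lborel_Icc_eq)
    show "AE x in lebesgue. (cmod (?fN x - cutoff ?N x (g k x)))\<^sup>2 \<le> ?w x" for k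
    proof (rule always_eventually, rule allI)
      fix x
      show "(cmod (?fN x - cutoff ?N x (g k x)))\<^sup>2 \<le> ?w x"
      proof (cases "x \<in> {-(real ?N + 1)..real ?N + 1}")
        case True
        have "cmod (?fN x - cutoff ?N x (g k x)) \<le> 2 * real ?N"
          using norm_triangle_ineq4[of "?fN x" "cutoff ?N x (g k x)"]
            norm_cutoff_le(2)[of ?N x "f x"] norm_cutoff_le(2)[of ?N x "g k x"] by simp
        then have "(cmod (?fN x - cutoff ?N x (g k x)))\<^sup>2 \<le> (2 * real ?N)\<^sup>2"
          by (intro power_mono) auto
        then show ?thesis
          using True by (simp del: of_nat_Suc)
      next
        case False
        then have "real ?N + 1 \<le> \<bar>x\<bar>"
          by (auto simp: abs_le_iff)
        then show ?thesis
          using False by (simp add: cutoff_outside del: of_nat_Suc)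
      qed
    qed
    have "AE x in lebesgue. x \<notin> Z"
      using Z by (intro AE_not_in) (simp add: negligible_iff_null_sets)
    then show "AE x in lebesgue. (\<lambda>k. cutoff ?N x (g k x)) \<longlonglongrightarrow> ?fN x"
    proof eventually_elim
      case (elim x)
      have "isCont (cutoff ?N x) (f x)"
        using continuous_cutoff_value[of ?N x] by (simp add: continuous_on_eq_continuous_at)
      then show ?case
        using lim[OF elim] by (rule isCont_tendsto_compose)
    qed
  qed (use e in simp)
  then obtain k where k: "(L2_norm (\<lambda>x. ?fN x - cutoff ?N x (g k x)))\<^sup>2 < e / 4"
    by blast
  have fN: "?fN \<in> L2"
  proof -
    have "integrable lebesgue (\<lambda>x. (cmod (?fN x))\<^sup>2)"
    proof (rule Bochner_Integration.integrable_bound[OF fi])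
      show "(\<lambda>x. (cmod (?fN x))\<^sup>2) \<in> borel_measurable lebesgue"
        using cm by measurable
      show "AE x in lebesgue. norm ((cmod (?fN x))\<^sup>2) \<le> norm ((cmod (f x))\<^sup>2)"
        using norm_cutoff_le(1)[of ?N] by (auto intro!: always_eventually power_mono)
    qed
    then show ?thesis
      using cm by (simp add: L2_def)
  qed
  let ?g = "\<lambda>x. cutoff ?N x (g k x)"
  have gL: "?g \<in> L2"
    by (rule supported_within_L2[OF sg])
  have "(L2_norm (\<lambda>x. f x - ?g x))\<^sup>2 \<le> 2 * (L2_norm (\<lambda>x. f x - ?fN x))\<^sup>2 + 2 * (L2_norm (\<lambda>x. (f x - ?g x) - (f x - ?fN x)))\<^sup>2"
    by (rule L2_norm_triangle_square) (intro L2_diff(1) f gL fN)+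
  also have "(\<lambda>x. (f x - ?g x) - (f x - ?fN x)) = (\<lambda>x. ?fN x - ?g x)"
    by auto
  finally have "(L2_norm (\<lambda>x. f x - ?g x))\<^sup>2 < e"
    using n k by linarith
  then show ?thesis
    using sg by blast
qed

text \<open>All estimates use \<open>\<bar>a + b\<bar>\<^sup>2 \<le> 2 \<bar>a\<bar>\<^sup>2 + 2 \<bar>b\<bar>\<^sup>2\<close> in place of the triangle inequality. This costs a
  constant factor but avoids square roots of sums of extended reals. The upper bound comes first, for
  finite partial sums; it is then needed to control the error in the lower bound.\<close>

lemma frame_extend:
  fixes E :: "'i :: countable \<Rightarrow> real \<Rightarrow> complex"
  assumes E: "\<And>i. E i \<in> L2" and AB: "0 < A" "0 < B"
    and bounds: "\<And>R f. supported_within R f \<Longrightarrow>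
      ennreal (A * (L2_norm f)\<^sup>2) \<le> frame_sum E f \<and>
      frame_sum E f \<le> ennreal (B * (L2_norm f)\<^sup>2)"
    and f: "f \<in> L2"
  shows "ennreal (A / 4 * (L2_norm f)\<^sup>2) \<le> frame_sum E f \<and>
      frame_sum E f \<le> ennreal (4 * B * (L2_norm f)\<^sup>2)"
proof -
  have upper: "frame_sum E f \<le> ennreal (4 * B * (L2_norm f)\<^sup>2)" if f: "f \<in> L2" for f
    unfolding nonneg_infsum_complete[OF zero_le]
  proof (intro SUP_least)
    fix S :: "'i set"
    assume "S \<in> {F. finite F \<and> F \<subseteq> UNIV}"
    then have S: "finite S" by simp
    define K where "K = 4 * B + 2 * (\<Sum>i\<in>S. (L2_norm (E i))\<^sup>2)"
    have K: "0 < K"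
      unfolding K_def using AB by (intro add_pos_nonneg mult_nonneg_nonneg sum_nonneg) auto
    have "(\<Sum>i\<in>S. (cmod (L2_inner f (E i)))\<^sup>2) \<le> 4 * B * (L2_norm f)\<^sup>2 + \<delta>" if \<delta>: "0 < \<delta>" for \<delta>
    proof -
      obtain R g where g: "supported_within R g" and close: "(L2_norm (\<lambda>x. f x - g x))\<^sup>2 < \<delta> / K"
        using supported_dense[OF f, of "\<delta> / K"] \<delta> K by auto
      have gL: "g \<in> L2"
        by (rule supported_within_L2[OF g])
      let ?d = "(L2_norm (\<lambda>x. f x - g x))\<^sup>2"
      have "ennreal (\<Sum>i\<in>S. (cmod (L2_inner g (E i)))\<^sup>2) \<le> frame_sum E g"
        unfolding nonneg_infsum_complete[OF zero_le] using S
        by (intro SUP_upper2[of S]) (auto simp: sum_nonneg)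
      also have "\<dots> \<le> ennreal (B * (L2_norm g)\<^sup>2)"
        using bounds[OF g] by blast
      finally have Sg: "(\<Sum>i\<in>S. (cmod (L2_inner g (E i)))\<^sup>2) \<le> B * (L2_norm g)\<^sup>2"
        using AB by (simp add: ennreal_le_iff)
      have "(\<Sum>i\<in>S. (cmod (L2_inner f (E i)))\<^sup>2)
          \<le> (\<Sum>i\<in>S. 2 * (cmod (L2_inner g (E i)))\<^sup>2 + 2 * (?d * (L2_norm (E i))\<^sup>2))"
      proof (rule sum_mono)
        fix i
        have "(cmod (L2_inner (\<lambda>x. f x - g x) (E i)))\<^sup>2 \<le> ?d * (L2_norm (E i))\<^sup>2"
          by (rule L2_Cauchy_Schwarz[OF L2_diff(1)[OF f gL] E])
        then show "(cmod (L2_inner f (E i)))\<^sup>2 \<le> 2 * (cmod (L2_inner g (E i)))\<^sup>2 + 2 * (?d * (L2_norm (E i))\<^sup>2)"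
          using L2_inner_diff_square[OF f gL E, of i] by linarith
      qed
      also have "\<dots> = 2 * (\<Sum>i\<in>S. (cmod (L2_inner g (E i)))\<^sup>2) + ?d * (2 * (\<Sum>i\<in>S. (L2_norm (E i))\<^sup>2))"
        by (simp add: sum.distrib sum_distrib_left mult_ac)
      also have "\<dots> \<le> 2 * (B * (L2_norm g)\<^sup>2) + ?d * (2 * (\<Sum>i\<in>S. (L2_norm (E i))\<^sup>2))"
        using Sg by simp
      also have "\<dots> \<le> 2 * (B * (2 * (L2_norm f)\<^sup>2 + 2 * ?d)) + ?d * (2 * (\<Sum>i\<in>S. (L2_norm (E i))\<^sup>2))"
      proof -
        have "L2_norm (\<lambda>x. g x - f x) = L2_norm (\<lambda>x. f x - g x)"
          by (simp add: L2_norm_def norm_minus_commute)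
        then have "(L2_norm g)\<^sup>2 \<le> 2 * (L2_norm f)\<^sup>2 + 2 * ?d"
          using L2_norm_triangle_square[OF gL f] by simp
        then show ?thesis
          using AB by (simp add: mult_left_mono)
      qed
      also have "\<dots> = 4 * B * (L2_norm f)\<^sup>2 + ?d * K"
        by (simp add: K_def algebra_simps)
      also have "\<dots> \<le> 4 * B * (L2_norm f)\<^sup>2 + \<delta>"
        using close K by (simp add: pos_less_divide_eq)
      finally show ?thesis .
    qed
    then have "(\<Sum>i\<in>S. (cmod (L2_inner f (E i)))\<^sup>2) \<le> 4 * B * (L2_norm f)\<^sup>2"
      by (rule field_le_epsilon)
    then show "(\<Sum>i\<in>S. sq_norm (L2_inner f (E i))) \<le> ennreal (4 * B * (L2_norm f)\<^sup>2)"
      by (simp add: ennreal_leI)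
  qed
  obtain s where s: "frame_sum E f = ennreal s" "0 \<le> s"
    using upper[OF f] by (cases "\<Sum>\<^sub>\<infinity>i. sq_norm (L2_inner f (E i))") (auto simp: top_unique)
  \<comment> \<open>The total factor of the squared distance to the approximant below.\<close>
  define K where "K = 16 * B + 2 * A"
  have K: "0 < K"
    using AB by (simp add: K_def)
  have "A * (L2_norm f)\<^sup>2 \<le> 4 * s + \<delta>" if \<delta>: "0 < \<delta>" for \<delta>
  proof -
    obtain R g where g: "supported_within R g" and close: "(L2_norm (\<lambda>x. f x - g x))\<^sup>2 < \<delta> / K"
      using supported_dense[OF f, of "\<delta> / K"] \<delta> K by auto
    have gL: "g \<in> L2"
      by (rule supported_within_L2[OF g])
    have dL: "(\<lambda>x. f x - g x) \<in> L2"
      by (rule L2_diff(1)[OF f gL])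
    let ?d = "(L2_norm (\<lambda>x. f x - g x))\<^sup>2"
    have "L2_norm (\<lambda>x. g x - f x) = L2_norm (\<lambda>x. f x - g x)"
      by (simp add: L2_norm_def norm_minus_commute)
    have inner_minus: "cmod (L2_inner (\<lambda>x. g x - f x) (E i)) = cmod (L2_inner (\<lambda>x. f x - g x) (E i))" for i
    proof -
      have "L2_inner (\<lambda>x. g x - f x) (E i) = (LINT x|lebesgue. - ((f x - g x) * cnj (E i x)))"
        unfolding L2_inner_def by (rule Bochner_Integration.integral_cong) (auto simp: algebra_simps)
      then show ?thesis
        unfolding L2_inner_def by simp
    qed
    have "ennreal (A * (L2_norm g)\<^sup>2) \<le> frame_sum E g"
      using bounds[OF g] by blast
    also have "\<dots> \<le> (\<Sum>\<^sub>\<infinity>i. ennreal 2 * sq_norm (L2_inner f (E i))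
        + ennreal 2 * sq_norm (L2_inner (\<lambda>x. f x - g x) (E i)))"
    proof (intro infsum_mono summable_on_ennreal_fun)
      fix i
      show "sq_norm (L2_inner g (E i)) \<le> ennreal 2 * sq_norm (L2_inner f (E i))
        + ennreal 2 * sq_norm (L2_inner (\<lambda>x. f x - g x) (E i))"
        using ennreal_leI[OF L2_inner_diff_square[OF gL f E, of i]] unfolding inner_minus
        by (simp only: ennreal_plus ennreal_mult zero_le_power2 zero_le_numeral mult_nonneg_nonneg)
    qed
    also have "\<dots> = ennreal 2 * frame_sum E f
        + ennreal 2 * frame_sum E (\<lambda>x. f x - g x)"
      by (simp only: infsum_ennreal_add infsum_ennreal_cmult[OF countableI_type])
    also have "\<dots> \<le> ennreal 2 * ennreal s + ennreal 2 * ennreal (4 * B * ?d)"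
      unfolding s(1) by (intro add_left_mono mult_left_mono upper[OF dL]) simp
    also have "\<dots> = ennreal (2 * s + 2 * (4 * B * ?d))"
    proof -
      have "ennreal 2 * ennreal s = ennreal (2 * s)" "ennreal 2 * ennreal (4 * B * ?d) = ennreal (2 * (4 * B * ?d))"
        by (rule ennreal_mult[symmetric]; use s(2) AB in simp)+
      then show ?thesis
        using s(2) AB by (simp only:) (rule ennreal_plus[symmetric]; simp)
    qed
    finally have "A * (L2_norm g)\<^sup>2 \<le> 2 * s + 2 * (4 * B * ?d)"
      using s(2) AB by (subst (asm) ennreal_le_iff) auto
    moreover have "A * (L2_norm f)\<^sup>2 \<le> A * (2 * (L2_norm g)\<^sup>2 + 2 * ?d)"
      using L2_norm_triangle_square[OF f gL] AB by (intro mult_left_mono) auto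
    ultimately have "A * (L2_norm f)\<^sup>2 \<le> 4 * s + K * ?d"
      by (simp add: K_def algebra_simps)
    also have "\<dots> \<le> 4 * s + \<delta>"
      using close K by (simp add: pos_less_divide_eq mult.commute)
    finally show ?thesis .
  qed
  then have "A * (L2_norm f)\<^sup>2 \<le> 4 * s"
    by (rule field_le_epsilon)
  then have "ennreal (A / 4 * (L2_norm f)\<^sup>2) \<le> ennreal s"
    by (intro ennreal_leI) simp
  then show ?thesis
    using upper[OF f] s(1) by simp
qed

section \<open>The limit of the mean square frequency\<close>

lemma dilate_gaussian_decreasing:
  assumes \<phi>: "type_I \<phi>" and \<gamma>: "0 < \<gamma>"
  shows "gaussian_decreasing (2 * pi / \<gamma>\<^sup>2) (\<lambda>w. (cmod (fourier (dilate \<gamma> \<phi>) w))\<^sup>2)"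
proof -
  note dec = type_I_gaussian_decreasing[OF \<phi>]
  have eq: "(cmod (fourier (dilate \<gamma> \<phi>) w))\<^sup>2 = 1 / \<gamma> * (cmod (fourier \<phi> (w / \<gamma>)))\<^sup>2" for w
    unfolding fourier_dilate[OF \<gamma>] norm_mult power_mult_distrib
    using \<gamma> by (simp add: power_divide norm_divide)
  show ?thesis
    unfolding gaussian_decreasing_def eq
  proof (intro conjI allI impI)
    fix x
    show "0 < 1 / \<gamma> * (cmod (fourier \<phi> (x / \<gamma>)))\<^sup>2"
      using gaussian_decreasingD(1)[OF dec, of "x / \<gamma>"] \<gamma> by (intro mult_pos_pos) auto
  next
    fix x y :: real
    assume "\<bar>y\<bar> \<le> \<bar>x\<bar>"
    then have "\<bar>y / \<gamma>\<bar> \<le> \<bar>x / \<gamma>\<bar>"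
      using \<gamma> by (simp add: divide_right_mono)
    from gaussian_decreasingD(2)[OF dec this]
    have "(cmod (fourier \<phi> (x / \<gamma>)))\<^sup>2 \<le> exp (- (2 * pi) * ((x / \<gamma>)\<^sup>2 - (y / \<gamma>)\<^sup>2)) * (cmod (fourier \<phi> (y / \<gamma>)))\<^sup>2" .
    also have "- (2 * pi) * ((x / \<gamma>)\<^sup>2 - (y / \<gamma>)\<^sup>2) = - (2 * pi / \<gamma>\<^sup>2) * (x\<^sup>2 - y\<^sup>2)"
      using \<gamma> by (simp add: power_divide field_simps)
    finally have "1 / \<gamma> * (cmod (fourier \<phi> (x / \<gamma>)))\<^sup>2
        \<le> 1 / \<gamma> * (exp (- (2 * pi / \<gamma>\<^sup>2) * (x\<^sup>2 - y\<^sup>2)) * (cmod (fourier \<phi> (y / \<gamma>)))\<^sup>2)"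
      using \<gamma> by (intro mult_left_mono) auto
    then show "1 / \<gamma> * (cmod (fourier \<phi> (x / \<gamma>)))\<^sup>2
        \<le> exp (- (2 * pi / \<gamma>\<^sup>2) * (x\<^sup>2 - y\<^sup>2)) * (1 / \<gamma> * (cmod (fourier \<phi> (y / \<gamma>)))\<^sup>2)"
      by (simp add: mult_ac)
  qed
qed

lemma ennreal_quotient_bounds:
  fixes num den :: ennreal
  assumes "den \<noteq> 0" "den \<noteq> \<top>"
  shows "num \<le> a * den \<Longrightarrow> num / den \<le> a" and "a * den \<le> num \<Longrightarrow> a \<le> num / den"
proof -
  have a: "a * den / den = a"
    using assms by (rule mult_divide_eq_ennreal)
  show "num / den \<le> a" if "num \<le> a * den"
    using divide_right_mono_ennreal[OF that, of den] by (simp only: a)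
  show "a \<le> num / den" if "a * den \<le> num"
    using divide_right_mono_ennreal[OF that, of den] by (simp only: a)
qed

text \<open>For \<open>w\<close> just below \<open>b / 2\<close>, every point of the coset of \<open>w\<close> has modulus at least \<open>w\<close>, so the mean
  square is at least \<open>w\<^sup>2\<close>. Such \<open>w\<close> form a set of positive measure, which an essential supremum cannot
  ignore.\<close>

lemma M_const_bounds:
  assumes \<psi>: "integrable lebesgue \<psi>" and G: "gaussian_decreasing c (\<lambda>w. (cmod (fourier \<psi> w))\<^sup>2)"
    and c: "1 \<le> c" and b: "0 < b"
  shows M_const_ge: "ennreal (b\<^sup>2 / 4) \<le> M_const \<psi> (1 / b)"
    and M_const_le: "M_const \<psi> (1 / b) \<le> ennreal (b\<^sup>2 / 4) + ennreal (4 / c) * lattice_mass b"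
proof -
  let ?G = "\<lambda>w. (cmod (fourier \<psi> w))\<^sup>2"
  define num where "num w = lattice_sum b (\<lambda>x. x\<^sup>2 * ?G x) w" for w
  define den where "den w = lattice_sum b ?G w" for w
  let ?M = "restrict_space lebesgue {0..b}"
  have M_eq: "M_const \<psi> (1 / b) = esssup ?M (\<lambda>w. num w / den w)"
    unfolding M_const_def num_def den_def by simp
  have [measurable]: "fourier \<psi> \<in> borel_measurable borel"
    by (rule measurable_fourier[OF \<psi>])
  have "num \<in> borel_measurable borel"
    unfolding num_def by (rule borel_measurable_infsum) measurable
  moreover have "den \<in> borel_measurable borel"
    unfolding den_def by (rule borel_measurable_infsum) measurable
  ultimately have "(\<lambda>w. num w / den w) \<in> borel_measurable borel"
    by (intro borel_measurable_divide_ennreal)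
  then have meas: "(\<lambda>w. num w / den w) \<in> borel_measurable ?M"
    by (intro measurable_restrict_space1 borel_measurable_imp_lebesgue)
  have den_pos: "den w \<noteq> 0" for w
  proof -
    have "0 < ennreal (?G (w + of_int 0 * b))"
      using gaussian_decreasingD(1)[OF G, of w] by simp
    also have "\<dots> \<le> den w"
      unfolding den_def by (rule term_le_infsum_ennreal) simp
    finally show ?thesis by auto
  qed
  have den_fin: "den w \<noteq> \<top>" for w
  proof -
    have "den w \<le> ennreal (?G 0) * lattice_mass b"
      unfolding den_def by (rule lattice_sum_le[OF G c b])
    also have "\<dots> < \<top>"
      using lattice_weight_sum_finite[OF b] by (simp add: ennreal_mult_less_top)
    finally show ?thesis by auto
  qed
  show "M_const \<psi> (1 / b) \<le> ennreal (b\<^sup>2 / 4) + ennreal (4 / c) * lattice_mass b"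
    unfolding M_eq
  proof (rule esssup_I[OF meas], rule always_eventually, rule allI)
    fix w
    show "num w / den w \<le> ennreal (b\<^sup>2 / 4) + ennreal (4 / c) * lattice_mass b"
      using lattice_mean_square_le[OF G c b, of w]
      by (intro ennreal_quotient_bounds(1)[OF den_pos den_fin]) (simp only: num_def den_def)
  qed
  show "ennreal (b\<^sup>2 / 4) \<le> M_const \<psi> (1 / b)"
  proof (rule ccontr)
    assume "\<not> ?thesis"
    then have less: "M_const \<psi> (1 / b) < ennreal (b\<^sup>2 / 4)"
      by simp
    then obtain r where r: "M_const \<psi> (1 / b) = ennreal r" "0 \<le> r" "r < b\<^sup>2 / 4"
      by (cases "M_const \<psi> (1 / b)") (auto simp: ennreal_less_iff)
    have r_lt: "sqrt r < b / 2"
      using r b by (intro real_less_lsqrt) (auto simp: power_divide)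
    have "AE w in ?M. num w / den w \<le> ennreal r"
      using esssup_AE[of "\<lambda>w. num w / den w" ?M] by (simp add: M_eq[symmetric] r(1))
    then have ae: "AE w in lebesgue. w \<in> {0..b} \<longrightarrow> num w / den w \<le> ennreal r"
      by (simp add: AE_restrict_space_iff)
    have ge: "ennreal (w\<^sup>2) \<le> num w / den w" if w: "0 \<le> w" "w \<le> b / 2" for w
    proof (rule ennreal_quotient_bounds(2)[OF den_pos den_fin])
      have "ennreal (w\<^sup>2) * den w = (\<Sum>\<^sub>\<infinity>l. ennreal (w\<^sup>2) * ennreal (?G (w + of_int l * b)))"
        unfolding den_def by (rule infsum_ennreal_cmult[symmetric]) simp
      also have "\<dots> \<le> num w"
        unfolding num_def
      proof (intro infsum_mono summable_on_ennreal_fun)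
        fix l :: int
        have "w \<le> \<bar>w + of_int l * b\<bar>"
        proof (cases "0 \<le> l")
          case True
          then have "0 \<le> of_int l * b"
            using b by simp
          then show ?thesis
            by linarith
        next
          case False
          then have "of_int l * b \<le> (- 1) * b"
            using b by (intro mult_right_mono) auto
          then show ?thesis
            using w by linarith
        qed
        then have "w\<^sup>2 \<le> (w + of_int l * b)\<^sup>2"
          using w by (simp add: abs_le_square_iff[symmetric])
        then show "ennreal (w\<^sup>2) * ennreal (?G (w + of_int l * b)) \<le> ennreal ((w + of_int l * b)\<^sup>2 * ?G (w + of_int l * b))"
          by (simp add: mult_right_mono ennreal_leI flip: ennreal_mult)
      qed
      finally show "ennreal (w\<^sup>2) * den w \<le> num w" .
    qed
    \<comment> \<open>On this interval the quotient is at least \<open>w\<^sup>2 > r\<close>, so the interval would have to be a null set.\<close>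
    have "AE w in lebesgue. w \<notin> {sqrt r<..<b / 2}"
      using ae
    proof eventually_elim
      case (elim w)
      show ?case
      proof
        assume w: "w \<in> {sqrt r<..<b / 2}"
        have w0: "0 \<le> w" "w \<le> b / 2" "w \<le> b"
          using w b real_sqrt_ge_zero[OF r(2)] by (simp_all only: greaterThanLessThan_iff) linarith+
        have "r < w\<^sup>2"
        proof -
          have "(sqrt r)\<^sup>2 < w\<^sup>2"
            by (rule power_strict_mono) (use w r(2) in auto)
          then show ?thesis
            using r(2) by simp
        qed
        moreover have "ennreal (w\<^sup>2) \<le> ennreal r"
        proof (rule order.trans[OF ge[OF w0(1,2)]])
          show "num w / den w \<le> ennreal r"
            using elim w0(1,3) by simp
        qed
        ultimately show False
          using r(2) by simp
      qed
    qed
    then have "AE w in lborel. w \<notin> {sqrt r<..<b / 2}"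
      by (simp only: AE_completion_iff)
    then have "{sqrt r<..<b / 2} \<in> null_sets lborel"
      by (simp add: AE_iff_null_sets)
    then show False
      using r_lt by (auto simp: null_sets_def)
  qed
qed

lemma M_const_dilate_tendsto:
  assumes \<phi>: "type_I \<phi>" and b: "0 < b"
  shows "((\<lambda>\<gamma>. M_const (dilate \<gamma> \<phi>) (1 / b)) \<longlongrightarrow> ennreal (b\<^sup>2 / 4)) (at_right 0)"
proof (rule tendsto_sandwich)
  define W where "W = enn2real (lattice_mass b)"
  have W: "lattice_mass b = ennreal W" "0 \<le> W"
    using lattice_weight_sum_finite[OF b] by (simp_all add: W_def)
  have \<phi>_int: "integrable lebesgue \<phi>"
    using \<phi> by (simp add: type_I_def)
  have small: "\<forall>\<^sub>F \<gamma> in at_right 0. \<gamma> \<in> {0<..<1::real}"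
    by (rule eventually_at_right_real) simp
  have c: "1 \<le> 2 * pi / \<gamma>\<^sup>2" if "\<gamma> \<in> {0<..<1}" for \<gamma> :: real
  proof -
    have "\<gamma>\<^sup>2 \<le> 1"
      using that by (simp add: power_le_one)
    then show ?thesis
      using that pi_gt3 by (simp add: pos_le_divide_eq)
  qed
  show "\<forall>\<^sub>F \<gamma> in at_right 0. ennreal (b\<^sup>2 / 4) \<le> M_const (dilate \<gamma> \<phi>) (1 / b)"
    using small
  proof eventually_elim
    case (elim \<gamma>)
    then show ?case
      using \<phi> \<phi>_int b c[OF elim]
      by (intro M_const_ge[OF integrable_dilate dilate_gaussian_decreasing]) auto
  qed
  show "\<forall>\<^sub>F \<gamma> in at_right 0. M_const (dilate \<gamma> \<phi>) (1 / b) \<le> ennreal (b\<^sup>2 / 4 + 2 * \<gamma>\<^sup>2 / pi * W)"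
    using small
  proof eventually_elim
    case (elim \<gamma>)
    have "M_const (dilate \<gamma> \<phi>) (1 / b) \<le> ennreal (b\<^sup>2 / 4) + ennreal (4 / (2 * pi / \<gamma>\<^sup>2)) * ennreal W"
      unfolding W(1)[symmetric] using \<phi> \<phi>_int b c[OF elim] elim
      by (intro M_const_le[OF integrable_dilate dilate_gaussian_decreasing]) auto
    also have "\<dots> = ennreal (b\<^sup>2 / 4 + 2 * \<gamma>\<^sup>2 / pi * W)"
      using W(2) by (simp flip: ennreal_mult ennreal_plus)
    finally show ?case .
  qed
  show "((\<lambda>\<gamma>. ennreal (b\<^sup>2 / 4 + 2 * \<gamma>\<^sup>2 / pi * W)) \<longlongrightarrow> ennreal (b\<^sup>2 / 4)) (at_right 0)"
  proof (rule tendsto_ennrealI)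
    have "((\<lambda>\<gamma>. b\<^sup>2 / 4 + 2 * \<gamma>\<^sup>2 / pi * W) \<longlongrightarrow> b\<^sup>2 / 4 + 2 * 0\<^sup>2 / pi * W) (at_right 0)"
      by (intro tendsto_intros) auto
    then show "((\<lambda>\<gamma>. b\<^sup>2 / 4 + 2 * \<gamma>\<^sup>2 / pi * W) \<longlongrightarrow> b\<^sup>2 / 4) (at_right 0)"
      by simp
  qed
qed simp

section \<open>Gabor frames\<close>

lemma gabor_atom_L2:
  assumes "g \<in> L2"
  shows "gabor_atom g \<alpha> \<beta> k m \<in> L2"
proof -
  have gm: "g \<in> borel_measurable lebesgue" and gi: "integrable lebesgue (\<lambda>x. (cmod (g x))\<^sup>2)"
    using assms by (auto simp: L2_def)
  have eq: "gabor_atom g \<alpha> \<beta> k m = (\<lambda>x. wave (\<beta> * of_int m * x) * g (- (\<alpha> * of_int k) + 1 *\<^sub>R x))"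
    by (simp add: gabor_atom_def wave_def fun_eq_iff)
  have "(\<lambda>x. wave (\<beta> * of_int m * x)) \<in> borel_measurable lebesgue"
    by (rule borel_measurable_imp_lebesgue) measurable
  then have "gabor_atom g \<alpha> \<beta> k m \<in> borel_measurable lebesgue"
    unfolding eq by (intro borel_measurable_times borel_measurable_affine gm) simp_all
  moreover have "integrable lebesgue (\<lambda>x. (cmod (gabor_atom g \<alpha> \<beta> k m x))\<^sup>2)"
    unfolding eq using lebesgue_integrable_real_affine[OF gi, of 1 "- (\<alpha> * of_int k)"]
    by (simp add: norm_mult)
  ultimately show ?thesis
    by (simp add: L2_def)
qed

theorem gabor_frame_if_mean_square_small:
  assumes g: "integrable lebesgue g" and G: "gaussian_decreasing c (\<lambda>w. (cmod (fourier g w))\<^sup>2)"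
    and c: "1 \<le> c" and \<alpha>: "0 < \<alpha>" and \<beta>: "0 < \<beta>" and M: "0 \<le> M" "2 * \<alpha> * sqrt M < 1"
    and mean: "\<And>w. (\<Sum>\<^sub>\<infinity>l. ennreal ((w + of_int l * \<beta>)\<^sup>2 * (cmod (fourier g (w + of_int l * \<beta>)))\<^sup>2))
        \<le> ennreal M * (\<Sum>\<^sub>\<infinity>l. sq_norm (fourier g (w + of_int l * \<beta>)))"
  shows "gabor_frame g \<alpha> \<beta>"
proof -
  interpret gaussian_window "fourier g" c
    by unfold_locales (intro continuous_fourier g G c)+
  have gm: "g \<in> borel_measurable lebesgue"
    using g by auto
  have inv: "AE x in lebesgue. g x = V (- x)"
    by (rule fourier_inversion[OF g integrable_u])
  have gL: "g \<in> L2"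
  proof -
    have "energy V = energy (fourier g)"
      using modulated_bound[of "\<lambda>_. 1" 1] by (intro plancherel integrable_u cont_u) auto
    also have "\<dots> \<le> (\<integral>\<^sup>+x. ennreal (cmod (fourier g 0)) * ennreal (norm (fourier g x)) \<partial>lborel)"
    proof (rule nn_integral_mono)
      fix x
      have "cmod (fourier g x) * cmod (fourier g x) \<le> cmod (fourier g 0) * cmod (fourier g x)"
        using modulated_bound[of "\<lambda>_. 1" 1 x] by (intro mult_right_mono) auto
      then show "sq_norm (fourier g x) \<le> ennreal (cmod (fourier g 0)) * ennreal (norm (fourier g x))"
        by (simp add: power2_eq_square ennreal_leI flip: ennreal_mult)
    qed
    also have "\<dots> = ennreal (cmod (fourier g 0)) * (\<integral>\<^sup>+x. ennreal (norm (fourier g x)) \<partial>lborel)"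
      by (rule nn_integral_cmult) measurable
    also have "\<dots> < \<top>"
      using integrable_u by (simp add: integrable_iff_bounded ennreal_mult_less_top)
    finally have "integrable lborel (\<lambda>x. (cmod (V x))\<^sup>2)"
      by (intro integrableI_bounded) auto
    from lborel_integrable_real_affine[OF this, of "- 1" 0]
    have "integrable lebesgue (\<lambda>x. (cmod (V (- x)))\<^sup>2)"
      by (subst integrable_lebesgue_iff) auto
    moreover have "(\<lambda>x. (cmod (g x))\<^sup>2) \<in> borel_measurable lebesgue"
      using gm by measurable
    moreover have "AE x in lebesgue. (cmod (V (- x)))\<^sup>2 = (cmod (g x))\<^sup>2"
      using inv by eventually_elim simp
    ultimately have "integrable lebesgue (\<lambda>x. (cmod (g x))\<^sup>2)"
      by (rule integrable_cong_AE_imp)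
    then show ?thesis
      using gm by (simp add: L2_def)
  qed
  obtain A B where AB: "0 < A" "0 < B" and bounds: "sampling_bounds A B \<beta> \<alpha>"
    using sampling_frame_bounds[OF \<beta> \<alpha> M mean] by blast
  let ?E = "\<lambda>(k, m). gabor_atom g \<alpha> \<beta> k m"
  have sum_eq: "gabor_sum g \<alpha> \<beta> f
      = frame_sum ?E f" for f
    by (simp add: case_prod_unfold)
  have E: "?E i \<in> L2" for i
    using gabor_atom_L2[OF gL] by (auto split: prod.split)
  have AB': "0 < A / \<beta>" "0 < B / \<beta>"
    using AB \<beta> by simp_all
  show ?thesis
    unfolding gabor_frame_def
  proof (intro conjI exI ballI gL)
    show "0 < A / \<beta> / 4" "0 < 4 * (B / \<beta>)"
      using AB' by simp_all
    fix f
    assume f: "f \<in> L2"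
    have "ennreal (A / \<beta> / 4 * (L2_norm f)\<^sup>2) \<le> frame_sum ?E f \<and>
      frame_sum ?E f \<le> ennreal (4 * (B / \<beta>) * (L2_norm f)\<^sup>2)"
    proof (rule frame_extend[OF E AB' _ f])
      fix R h
      assume "supported_within R h"
      from gabor_bounds_supported[OF inv gm \<beta> AB bounds this]
      show "ennreal (A / \<beta> * (L2_norm h)\<^sup>2) \<le> frame_sum ?E h \<and>
          frame_sum ?E h \<le> ennreal (B / \<beta> * (L2_norm h)\<^sup>2)"
        unfolding sum_eq .
    qed
    then show "ennreal (A / \<beta> / 4 * (L2_norm f)\<^sup>2)
          \<le> gabor_sum g \<alpha> \<beta> f"
      "gabor_sum g \<alpha> \<beta> f
          \<le> ennreal (4 * (B / \<beta>) * (L2_norm f)\<^sup>2)"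
      unfolding sum_eq by blast+
  qed
qed

lemma exists_dilate_gabor_frame:
  assumes \<phi>: "type_I \<phi>" and \<alpha>: "0 < \<alpha>" and \<beta>: "0 < \<beta>" and \<alpha>\<beta>: "\<alpha> * \<beta> < 1"
  shows "\<exists>\<gamma>>0. gabor_frame (dilate \<gamma> \<phi>) \<alpha> \<beta>"
proof -
  define W where "W = enn2real (lattice_mass \<beta>)"
  have W: "lattice_mass \<beta> = ennreal W" "0 \<le> W"
    using lattice_weight_sum_finite[OF \<beta>] by (simp_all add: W_def)
  define M where "M \<gamma> = \<beta>\<^sup>2 / 4 + 4 / (2 * pi / \<gamma>\<^sup>2) * W" for \<gamma>
  have "((\<lambda>\<gamma>. 2 * \<alpha> * sqrt (\<beta>\<^sup>2 / 4 + 2 * \<gamma>\<^sup>2 / pi * W)) \<longlongrightarrow> 2 * \<alpha> * sqrt (\<beta>\<^sup>2 / 4 + 2 * 0\<^sup>2 / pi * W)) (at_right 0)"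
    by (intro tendsto_intros) auto
  moreover have "2 * \<alpha> * sqrt (\<beta>\<^sup>2 / 4 + 2 * 0\<^sup>2 / pi * W) < 1"
    using \<alpha>\<beta> \<beta> by (simp add: real_sqrt_divide)
  ultimately have "\<forall>\<^sub>F \<gamma> in at_right 0. 2 * \<alpha> * sqrt (\<beta>\<^sup>2 / 4 + 2 * \<gamma>\<^sup>2 / pi * W) < 1"
    by (rule order_tendstoD(2))
  moreover have "\<forall>\<^sub>F \<gamma> in at_right 0. \<gamma> \<in> {0<..<1::real}"
    by (rule eventually_at_right_real) simp
  ultimately have "\<forall>\<^sub>F \<gamma> in at_right 0. 2 * \<alpha> * sqrt (\<beta>\<^sup>2 / 4 + 2 * \<gamma>\<^sup>2 / pi * W) < 1 \<and> \<gamma> \<in> {0<..<1::real}"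
    by (rule eventually_conj)
  then obtain \<gamma> :: real where \<gamma>: "0 < \<gamma>" "\<gamma> < 1" "2 * \<alpha> * sqrt (\<beta>\<^sup>2 / 4 + 2 * \<gamma>\<^sup>2 / pi * W) < 1"
    using eventually_happens'[of "at_right (0::real)"] by (auto simp: trivial_limit_at_right_real)
  have M: "0 \<le> M \<gamma>" "2 * \<alpha> * sqrt (M \<gamma>) < 1"
    using \<gamma> W(2) by (simp_all add: M_def)
  have c: "1 \<le> 2 * pi / \<gamma>\<^sup>2"
  proof -
    have "\<gamma>\<^sup>2 \<le> 1"
      using \<gamma> by (simp add: power_le_one)
    then show ?thesis
      using \<gamma> pi_gt3 by (simp add: pos_le_divide_eq)
  qed
  have int: "integrable lebesgue (dilate \<gamma> \<phi>)"
    using \<phi> \<gamma> by (intro integrable_dilate) (auto simp: type_I_def)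
  note G = dilate_gaussian_decreasing[OF \<phi> \<gamma>(1)]
  have "ennreal (\<beta>\<^sup>2 / 4) + ennreal (4 / (2 * pi / \<gamma>\<^sup>2)) * lattice_mass \<beta> = ennreal (M \<gamma>)"
    unfolding W(1) M_def using W(2) by (simp flip: ennreal_mult ennreal_plus)
  with lattice_mean_square_le[OF G c \<beta>]
  have "gabor_frame (dilate \<gamma> \<phi>) \<alpha> \<beta>"
    by (intro gabor_frame_if_mean_square_small[OF int G c \<alpha> \<beta> M]) simp
  then show ?thesis
    using \<gamma>(1) by blast
qed

theorem theorem4p1:
  fixes \<phi> :: "real \<Rightarrow> complex"
  assumes "type_I \<phi>"
  shows "(\<forall>\<beta>>0. ((\<lambda>\<gamma>. M_const (dilate \<gamma> \<phi>) (1 / \<beta>)) \<longlongrightarrow> ennreal (\<beta>\<^sup>2 / 4)) (at_right 0)) \<and>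
    (\<forall>\<alpha> \<beta>. 0 < \<alpha> \<and> 0 < \<beta> \<and> \<alpha> * \<beta> < 1 \<longrightarrow>
      (\<exists>\<gamma>>0. gabor_frame (dilate \<gamma> \<phi>) \<alpha> \<beta>))"
  using M_const_dilate_tendsto[OF assms] exists_dilate_gabor_frame[OF assms] by blast

end
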